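(* Let $(S,\|\cdot\|)$ be a complete $RN$ module over $C$ with base $(\Omega,\mathcal F,P)$, and let $A:D(A)\subset S\to S$ be a module homomorphism. Suppose that $\tau,M\in L^{0}(\mathcal F,R)$ and $M\geq 1$. Then the following assertions are equivalent. (a) $(A,D(A))$ generates an a.s. bounded $C_{0}$--semigroup $\{T(t):t\geq 0\}$ satisfying $\|T(t)\|\leq Me^{\tau t}$ for any $t\geq 0$. (b) $(A,D(A))$ is closed, densely defined, and for each $\xi\in L^{0}(\mathcal F,R)$ with $\xi-\tau\in L^{0}_{++}(\mathcal F)$ one has $\xi\in\rho(A)$ and $\|[(\xi-\tau)R(\xi,A)]^{n}\|\leq M$ for any $n\in N$. (c) $(A,D(A))$ is closed, densely defined, and for each $\xi\in L^{0}(\mathcal F,C)$ with $\mathrm{Re}\,\xi-\tau\in L^{0}_{++}(\mathcal F)$ one has $\xi\in\rho(A)$ and $\|R(\xi,A)^{n}\|\leq \frac{M}{(\mathrm{Re}\,\xi-\tau)^{n}}$ for any $n\in N$.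
   Context: $(\Omega,\mathcal F,P)$ is a probability space; $L^{0}(\mathcal F,K)$ ($K=R$ or $C$) is the algebra of equivalence classes of $K$-valued $\mathcal F$-measurable random variables (identified a.s.), ordered by $\xi\le\eta$ iff $\xi\le\eta$ a.s.; $L^{0}_{+}(\mathcal F)=\{\xi\in L^0(\mathcal F,R):\xi\ge 0\}$, $L^{0}_{++}(\mathcal F)=\{\xi\in L^0(\mathcal F,R):\xi>0 \text{ a.s. on }\Omega\}$. Suprema/infima of subsets of $L^0$ are taken in the complete lattice of (extended) random variables. An $RN$ module over $K$ with base $(\Omega,\mathcal F,P)$ is a left $L^0(\mathcal F,K)$-module $S$ with a map $\|\cdot\|:S\to L^0_+(\mathcal F)$ (the $L^0$-norm) such that $\|\xi x\|=|\xi|\|x\|$, $\|x+y\|\le\|x\|+\|y\|$, and $\|x\|=0$ implies $x=0$. $S$ carries the $(\varepsilon,\lambda)$-topology, with base at $0$ given by $N_\theta(\varepsilon,\lambda)=\{x: P\{\|x\|<\varepsilon\}>1-\lambda\}$ ($\varepsilon>0$, $0<\lambda<1$); thus $x_n\to x$ iff $\|x_n-x\|\to 0$ in probability; completeness refers to this topology. $B(S)$ is the set of continuous module homomorphisms $T:S\to S$, equivalently those with $\|Tx\|\le\xi\|x\|$ for some $\xi\in L^0_+(\mathcal F)$ and all $x$; $\|T\|=\bigwedge\{\xi\in L^0_+(\mathcal F): \|Tx\|\le \xi\|x\|\ \forall x\}$. A $C_0$--semigroup is a family $\{T(t):t\ge0\}\subset B(S)$ with $T(0)=I$, $T(s)T(t)=T(s+t)$,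 and $\lim_{t\downarrow0}T(t)x=x$ for every $x\in S$. It is a.s. bounded if there is a real $L>0$ with $\bigvee_{t\in[0,L]}\|T(t)\|\in L^0_+(\mathcal F)$. Its infinitesimal generator is $Ax=\lim_{t\downarrow0}\frac{T(t)x-x}{t}$ on $D(A)=\{x:\text{this limit exists}\}$; "$(A,D(A))$ generates $\{T(t)\}$" means $A$ is its infinitesimal generator. $A$ is closed if its graph is closed in $S\times S$, densely defined if $D(A)$ is dense. The resolvent set is $\rho(A)=\{\xi\in L^0(\mathcal F,K): \xi I-A \text{ is bijective from } D(A) \text{ onto } S \text{ and } (\xi I-A)^{-1}\in B(S)\}$, and $R(\xi,A)=(\xi I-A)^{-1}$. *)

theory Defs
  imports "HOL-Probability.Probability"
begin

text \<open>
Encoding conventions.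
  * The base probability space is a measure M with prob_space M; the sigma-algebra F is sets M.
  * Elements of L0(F,K) are represented by F-measurable functions 'w => K; two representatives
    denote the same element iff they agree M-almost everywhere. All (in)equalities between
    elements of L0 are therefore stated with AE.
  * The RN module S is the whole type 'a (an abelian group), with module action sm by
    elements of L0(F,C) and L0-norm nrm : 'a => ('w => real). The action is required to depend
    only on the a.e.-class of the scalar.
\<close>

definition RN_module ::
  "'w measure \<Rightarrow> (('w \<Rightarrow> complex) \<Rightarrow> 'a::ab_group_add \<Rightarrow> 'a) \<Rightarrow> ('a \<Rightarrow> 'w \<Rightarrow> real) \<Rightarrow> bool" where
  "RN_module M sm nrm \<longleftrightarrow>
     prob_space M \<and>
     (\<forall>\<xi> \<eta> x. \<xi> \<in> borel_measurable M \<longrightarrow> \<eta> \<in> borel_measurable M \<longrightarrow>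
        (AE \<omega> in M. \<xi> \<omega> = \<eta> \<omega>) \<longrightarrow> sm \<xi> x = sm \<eta> x) \<and>
     (\<forall>\<xi> \<eta> x. \<xi> \<in> borel_measurable M \<longrightarrow> \<eta> \<in> borel_measurable M \<longrightarrow>
        sm (\<lambda>\<omega>. \<xi> \<omega> + \<eta> \<omega>) x = sm \<xi> x + sm \<eta> x) \<and>
     (\<forall>\<xi> x y. \<xi> \<in> borel_measurable M \<longrightarrow> sm \<xi> (x + y) = sm \<xi> x + sm \<xi> y) \<and>
     (\<forall>\<xi> \<eta> x. \<xi> \<in> borel_measurable M \<longrightarrow> \<eta> \<in> borel_measurable M \<longrightarrow>
        sm (\<lambda>\<omega>. \<xi> \<omega> * \<eta> \<omega>) x = sm \<xi> (sm \<eta> x)) \<and>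
     (\<forall>x. sm (\<lambda>_. 1) x = x) \<and>
     (\<forall>x. nrm x \<in> borel_measurable M \<and> (AE \<omega> in M. 0 \<le> nrm x \<omega>)) \<and>
     (\<forall>\<xi> x. \<xi> \<in> borel_measurable M \<longrightarrow>
        (AE \<omega> in M. nrm (sm \<xi> x) \<omega> = cmod (\<xi> \<omega>) * nrm x \<omega>)) \<and>
     (\<forall>x y. AE \<omega> in M. nrm (x + y) \<omega> \<le> nrm x \<omega> + nrm y \<omega>) \<and>
     (\<forall>x. (AE \<omega> in M. nrm x \<omega> = 0) \<longrightarrow> x = 0)"

definition eps_lambda_nbhd ::
  "'w measure \<Rightarrow> ('a::ab_group_add \<Rightarrow> 'w \<Rightarrow> real) \<Rightarrow> real \<Rightarrow> real \<Rightarrow> 'a set" where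
  "eps_lambda_nbhd M nrm \<epsilon> lam = {z. measure M {\<omega> \<in> space M. nrm z \<omega> < \<epsilon>} > 1 - lam}"

definition eps_lambda_open ::
  "'w measure \<Rightarrow> ('a::ab_group_add \<Rightarrow> 'w \<Rightarrow> real) \<Rightarrow> 'a set \<Rightarrow> bool" where
  "eps_lambda_open M nrm U \<longleftrightarrow>
     (\<forall>x\<in>U. \<exists>\<epsilon>>0. \<exists>lam. 0 < lam \<and> lam < 1 \<and> {y. y - x \<in> eps_lambda_nbhd M nrm \<epsilon> lam} \<subseteq> U)"

definition eps_lambda_topology ::
  "'w measure \<Rightarrow> ('a::ab_group_add \<Rightarrow> 'w \<Rightarrow> real) \<Rightarrow> 'a topology" where
  "eps_lambda_topology M nrm = topology (eps_lambda_open M nrm)"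

definition RN_complete ::
  "'w measure \<Rightarrow> ('a::ab_group_add \<Rightarrow> 'w \<Rightarrow> real) \<Rightarrow> bool" where
  "RN_complete M nrm \<longleftrightarrow>
     (\<forall>x :: nat \<Rightarrow> 'a.
        (\<forall>\<epsilon>>0. \<forall>lam. 0 < lam \<and> lam < 1 \<longrightarrow>
           (\<exists>N. \<forall>m\<ge>N. \<forall>n\<ge>N. x n - x m \<in> eps_lambda_nbhd M nrm \<epsilon> lam))
        \<longrightarrow> (\<exists>l. limitin (eps_lambda_topology M nrm) x l sequentially))"

definition is_L0_inf :: "'w measure \<Rightarrow> ('w \<Rightarrow> ereal) set \<Rightarrow> ('w \<Rightarrow> ereal) \<Rightarrow> bool" where
  "is_L0_inf M H g \<longleftrightarrow> g \<in> borel_measurable M \<and>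
     (\<forall>f\<in>H. AE \<omega> in M. g \<omega> \<le> f \<omega>) \<and>
     (\<forall>h\<in>borel_measurable M. (\<forall>f\<in>H. AE \<omega> in M. h \<omega> \<le> f \<omega>) \<longrightarrow> (AE \<omega> in M. h \<omega> \<le> g \<omega>))"

definition is_L0_sup :: "'w measure \<Rightarrow> ('w \<Rightarrow> ereal) set \<Rightarrow> ('w \<Rightarrow> ereal) \<Rightarrow> bool" where
  "is_L0_sup M H g \<longleftrightarrow> g \<in> borel_measurable M \<and>
     (\<forall>f\<in>H. AE \<omega> in M. f \<omega> \<le> g \<omega>) \<and>
     (\<forall>h\<in>borel_measurable M. (\<forall>f\<in>H. AE \<omega> in M. f \<omega> \<le> h \<omega>) \<longrightarrow> (AE \<omega> in M. g \<omega> \<le> h \<omega>))"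

definition L0_Inf :: "'w measure \<Rightarrow> ('w \<Rightarrow> ereal) set \<Rightarrow> 'w \<Rightarrow> ereal" where
  "L0_Inf M H = (SOME g. is_L0_inf M H g)"

definition L0_Sup :: "'w measure \<Rightarrow> ('w \<Rightarrow> ereal) set \<Rightarrow> 'w \<Rightarrow> ereal" where
  "L0_Sup M H = (SOME g. is_L0_sup M H g)"

definition bounded_op ::
  "'w measure \<Rightarrow> (('w \<Rightarrow> complex) \<Rightarrow> 'a::ab_group_add \<Rightarrow> 'a) \<Rightarrow> ('a \<Rightarrow> 'w \<Rightarrow> real)
   \<Rightarrow> ('a \<Rightarrow> 'a) \<Rightarrow> bool" where
  "bounded_op M sm nrm T \<longleftrightarrow>
     (\<forall>x y. T (x + y) = T x + T y) \<and>
     (\<forall>\<xi> x. \<xi> \<in> borel_measurable M \<longrightarrow> T (sm \<xi> x) = sm \<xi> (T x)) \<and>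
     continuous_map (eps_lambda_topology M nrm) (eps_lambda_topology M nrm) T"

definition op_norm ::
  "'w measure \<Rightarrow> ('a \<Rightarrow> 'w \<Rightarrow> real) \<Rightarrow> ('a \<Rightarrow> 'a) \<Rightarrow> 'w \<Rightarrow> ereal" where
  "op_norm M nrm T = L0_Inf M
     {(\<lambda>\<omega>. ereal (\<xi> \<omega>)) | \<xi>. \<xi> \<in> borel_measurable M \<and> (AE \<omega> in M. 0 \<le> \<xi> \<omega>) \<and>
        (\<forall>x. AE \<omega> in M. nrm (T x) \<omega> \<le> \<xi> \<omega> * nrm x \<omega>)}"

definition C0_semigroup ::
  "'w measure \<Rightarrow> (('w \<Rightarrow> complex) \<Rightarrow> 'a::ab_group_add \<Rightarrow> 'a) \<Rightarrow> ('a \<Rightarrow> 'w \<Rightarrow> real)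
   \<Rightarrow> (real \<Rightarrow> 'a \<Rightarrow> 'a) \<Rightarrow> bool" where
  "C0_semigroup M sm nrm T \<longleftrightarrow>
     (\<forall>t\<ge>0. bounded_op M sm nrm (T t)) \<and>
     T 0 = id \<and>
     (\<forall>s\<ge>0. \<forall>t\<ge>0. T s \<circ> T t = T (s + t)) \<and>
     (\<forall>x. limitin (eps_lambda_topology M nrm) (\<lambda>t. T t x) x (at_right 0))"

definition as_bounded_semigroup ::
  "'w measure \<Rightarrow> ('a \<Rightarrow> 'w \<Rightarrow> real) \<Rightarrow> (real \<Rightarrow> 'a \<Rightarrow> 'a) \<Rightarrow> bool" where
  "as_bounded_semigroup M nrm T \<longleftrightarrow>
     (\<exists>L::real. L > 0 \<and>
        (AE \<omega> in M. L0_Sup M {op_norm M nrm (T t) | t. t \<in> {0..L}} \<omega> < \<infinity>))"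

definition generates ::
  "'w measure \<Rightarrow> (('w \<Rightarrow> complex) \<Rightarrow> 'a::ab_group_add \<Rightarrow> 'a) \<Rightarrow> ('a \<Rightarrow> 'w \<Rightarrow> real)
   \<Rightarrow> ('a \<Rightarrow> 'a) \<Rightarrow> 'a set \<Rightarrow> (real \<Rightarrow> 'a \<Rightarrow> 'a) \<Rightarrow> bool" where
  "generates M sm nrm A D T \<longleftrightarrow>
     D = {x. \<exists>y. limitin (eps_lambda_topology M nrm)
                   (\<lambda>t. sm (\<lambda>_. complex_of_real (1 / t)) (T t x - x)) y (at_right 0)} \<and>
     (\<forall>x\<in>D. limitin (eps_lambda_topology M nrm)
                   (\<lambda>t. sm (\<lambda>_. complex_of_real (1 / t)) (T t x - x)) (A x) (at_right 0))"

definition module_hom_on ::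
  "'w measure \<Rightarrow> (('w \<Rightarrow> complex) \<Rightarrow> 'a::ab_group_add \<Rightarrow> 'a) \<Rightarrow> 'a set \<Rightarrow> ('a \<Rightarrow> 'a) \<Rightarrow> bool" where
  "module_hom_on M sm D A \<longleftrightarrow>
     0 \<in> D \<and> (\<forall>x\<in>D. \<forall>y\<in>D. x + y \<in> D) \<and>
     (\<forall>\<xi> x. \<xi> \<in> borel_measurable M \<longrightarrow> x \<in> D \<longrightarrow> sm \<xi> x \<in> D) \<and>
     (\<forall>x\<in>D. \<forall>y\<in>D. A (x + y) = A x + A y) \<and>
     (\<forall>\<xi> x. \<xi> \<in> borel_measurable M \<longrightarrow> x \<in> D \<longrightarrow> A (sm \<xi> x) = sm \<xi> (A x))"

definition closed_op ::
  "'w measure \<Rightarrow> ('a::ab_group_add \<Rightarrow> 'w \<Rightarrow> real) \<Rightarrow> ('a \<Rightarrow> 'a) \<Rightarrow> 'a set \<Rightarrow> bool" where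
  "closed_op M nrm A D \<longleftrightarrow>
     closedin (prod_topology (eps_lambda_topology M nrm) (eps_lambda_topology M nrm))
       {(x, A x) | x. x \<in> D}"

definition densely_defined ::
  "'w measure \<Rightarrow> ('a::ab_group_add \<Rightarrow> 'w \<Rightarrow> real) \<Rightarrow> 'a set \<Rightarrow> bool" where
  "densely_defined M nrm D \<longleftrightarrow> (eps_lambda_topology M nrm) closure_of D = UNIV"

definition resolvent ::
  "(('w \<Rightarrow> complex) \<Rightarrow> 'a::ab_group_add \<Rightarrow> 'a) \<Rightarrow> ('a \<Rightarrow> 'a) \<Rightarrow> 'a set \<Rightarrow> ('w \<Rightarrow> complex) \<Rightarrow> 'a \<Rightarrow> 'a" where
  "resolvent sm A D \<xi> = the_inv_into D (\<lambda>x. sm \<xi> x - A x)"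

definition in_resolvent_set ::
  "'w measure \<Rightarrow> (('w \<Rightarrow> complex) \<Rightarrow> 'a::ab_group_add \<Rightarrow> 'a) \<Rightarrow> ('a \<Rightarrow> 'w \<Rightarrow> real)
   \<Rightarrow> ('a \<Rightarrow> 'a) \<Rightarrow> 'a set \<Rightarrow> ('w \<Rightarrow> complex) \<Rightarrow> bool" where
  "in_resolvent_set M sm nrm A D \<xi> \<longleftrightarrow>
     bij_betw (\<lambda>x. sm \<xi> x - A x) D UNIV \<and>
     bounded_op M sm nrm (resolvent sm A D \<xi>)"

definition assertion_a where
  "assertion_a M sm nrm A D \<tau> Mb \<longleftrightarrow>
     (\<exists>T. C0_semigroup M sm nrm T \<and> as_bounded_semigroup M nrm T \<and>
          generates M sm nrm A D T \<and>
          (\<forall>t\<ge>0. AE \<omega> in M. op_norm M nrm (T t) \<omega> \<le> ereal (Mb \<omega> * exp (\<tau> \<omega> * t))))"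

definition assertion_b where
  "assertion_b M sm nrm A D \<tau> Mb \<longleftrightarrow>
     closed_op M nrm A D \<and> densely_defined M nrm D \<and>
     (\<forall>\<xi>::'w \<Rightarrow> real. \<xi> \<in> borel_measurable M \<longrightarrow> (AE \<omega> in M. \<xi> \<omega> - \<tau> \<omega> > 0) \<longrightarrow>
        in_resolvent_set M sm nrm A D (\<lambda>\<omega>. complex_of_real (\<xi> \<omega>)) \<and>
        (\<forall>n::nat. n \<ge> 1 \<longrightarrow>
           (AE \<omega> in M. op_norm M nrm
              ((\<lambda>x. sm (\<lambda>\<omega>. complex_of_real (\<xi> \<omega> - \<tau> \<omega>))
                       (resolvent sm A D (\<lambda>\<omega>. complex_of_real (\<xi> \<omega>)) x)) ^^ n) \<omega>
              \<le> ereal (Mb \<omega>))))"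

definition assertion_c where
  "assertion_c M sm nrm A D \<tau> Mb \<longleftrightarrow>
     closed_op M nrm A D \<and> densely_defined M nrm D \<and>
     (\<forall>\<xi>::'w \<Rightarrow> complex. \<xi> \<in> borel_measurable M \<longrightarrow> (AE \<omega> in M. Re (\<xi> \<omega>) - \<tau> \<omega> > 0) \<longrightarrow>
        in_resolvent_set M sm nrm A D \<xi> \<and>
        (\<forall>n::nat. n \<ge> 1 \<longrightarrow>
           (AE \<omega> in M. op_norm M nrm (resolvent sm A D \<xi> ^^ n) \<omega>
              \<le> ereal (Mb \<omega> / (Re (\<xi> \<omega>) - \<tau> \<omega>) ^ n))))"

end

theory Submission
  imports Defs
begin

text \<open>
(c) implies (b) is a rescaling. The other two implications avoid integration in \<open>S\<close>, which is not
locally convex, and use only \<open>L0\<close>-norm estimates and convergence in probability, measured by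
\<open>E[min 1 |g|]\<close>.

(a) implies (c): \<open>S t = exp (- \<xi> t) T t\<close> satisfies \<open>\<parallel>S t\<parallel> \<le> M exp (- \<delta> t)\<close> with \<open>\<delta> = Re \<xi> - \<tau> > 0\<close>. For the
equivalent norm \<open>N x = sup exp (\<delta> q) \<parallel>S q x\<parallel>\<close> over rational \<open>q \<ge> 0\<close>, the difference quotients of
\<open>S\<close> at \<open>x\<close> bound \<open>\<delta> N x\<close> in the limit; this yields injectivity of \<open>\<xi> - A\<close> and the bounds on the
powers of the resolvent, and it makes the dyadic Riemann sums of \<open>S t y\<close> over growing intervals a
Cauchy sequence, whose limit is the resolvent at \<open>y\<close>.

(b) implies (a): for \<open>B = A - \<tau>\<close> and \<open>J h = (1 - h B)\<^sup>-\<^sup>1\<close>, the Euler approximations \<open>J (t / n) ^ n\<close> converge,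
because on the domain of \<open>B\<^sup>2\<close> one step of size \<open>s\<close> agrees with \<open>1 + s B\<close> up to \<open>O(s\<^sup>2)\<close> and all
products of the commuting operators \<open>J h\<close> in play are uniformly bounded.
\<close>

section \<open>Convergence in probability and essential infima\<close>

text \<open>The obstacle is that estimates hold only almost surely, with a null set depending on the
  vectors and times involved, while orbits are continuous merely in probability. An inequality
  therefore survives a limit only along an a.e. convergent subsequence, and a time average of
  vectors close to \<open>y\<close> need not be close to \<open>y\<close> unless it is weighted by a
  majorant of the whole orbit. The decay rate \<delta> is random and may come arbitrarily close to
  0, so Riemann sums have no uniform tail estimate. They are controlled indirectly: a difference
  quotient of a Riemann sum telescopes to averages over a short time, which are close to
  \<open>y\<close>, up to a decaying tail. A random shift \<tau> is as harmless as a constant one,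
  because exp (\<tau> t) is itself a scalar of the module; from (b) only the points \<xi> = \<tau> +
  1 / h are taken. In both directions \<open>Mb\<close> must not enter with a power that grows with
  the number of steps. For resolvent powers the renorming prevents this, for Euler products the
  common bound on all powers of one \<open>J h\<close>.\<close>

definition dp :: "'w measure \<Rightarrow> ('w \<Rightarrow> real) \<Rightarrow> real" where
  "dp M g = (\<integral>\<omega>. min 1 \<bar>g \<omega>\<bar> \<partial>M)"

definition cip :: "'w measure \<Rightarrow> 'i filter \<Rightarrow> ('i \<Rightarrow> 'w \<Rightarrow> real) \<Rightarrow> bool" where
  "cip M F g \<longleftrightarrow> ((\<lambda>i. dp M (g i)) \<longlongrightarrow> 0) F"

context prob_space
begin

lemma integrable_min [simp]:
  fixes g :: "'a \<Rightarrow> real"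
  assumes [measurable]: "g \<in> borel_measurable M"
  shows "integrable M (\<lambda>\<omega>. min 1 \<bar>g \<omega>\<bar>)"
  by (rule integrable_const_bound[where B=1]) auto

lemma integrable_prob_indicator [simp]:
  "A \<in> sets M \<Longrightarrow> integrable M (indicator A :: 'a \<Rightarrow> real)"
  by (rule integrable_const_bound[where B=1]) auto

lemma dp_nonneg: "0 \<le> dp M g"
  unfolding dp_def by (rule integral_nonneg_AE) auto

lemma dp_mono:
  assumes "f \<in> borel_measurable M" "g \<in> borel_measurable M" "AE \<omega> in M. \<bar>f \<omega>\<bar> \<le> \<bar>g \<omega>\<bar>"
  shows "dp M f \<le> dp M g"
  unfolding dp_def
  by (rule integral_mono_AE) (use assms in \<open>auto elim!: eventually_mono\<close>)

lemma dp_triangle: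
  assumes "f \<in> borel_measurable M" "g \<in> borel_measurable M" "h \<in> borel_measurable M"
    "AE \<omega> in M. \<bar>f \<omega>\<bar> \<le> \<bar>g \<omega>\<bar> + \<bar>h \<omega>\<bar>"
  shows "dp M f \<le> dp M g + dp M h"
proof -
  have "dp M f \<le> (\<integral>\<omega>. min 1 \<bar>g \<omega>\<bar> + min 1 \<bar>h \<omega>\<bar> \<partial>M)"
    unfolding dp_def
    by (rule integral_mono_AE) (use assms in \<open>auto elim!: eventually_mono\<close>)
  also have "\<dots> = dp M g + dp M h"
    unfolding dp_def using assms by (intro Bochner_Integration.integral_add) auto
  finally show ?thesis .
qed

lemma dp_const: "dp M (\<lambda>_. c) = min 1 \<bar>c\<bar>"
  by (simp add: dp_def prob_space)

lemma dp_le_integral: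
  assumes "integrable M g" "AE \<omega> in M. 0 \<le> g \<omega>"
  shows "dp M g \<le> (\<integral>\<omega>. g \<omega> \<partial>M)"
  unfolding dp_def
  by (rule integral_mono_AE) (use assms in \<open>auto elim!: eventually_mono\<close>)

lemma dp_eq_0D:
  assumes [measurable]: "g \<in> borel_measurable M" and "dp M g = 0"
  shows "AE \<omega> in M. g \<omega> = 0"
proof -
  have "AE \<omega> in M. min 1 \<bar>g \<omega>\<bar> = 0"
    using assms by (subst integral_nonneg_eq_0_iff_AE[symmetric]) (auto simp: dp_def)
  then show ?thesis by eventually_elim (auto simp: min_def split: if_splits)
qed

text \<open>This bound and the Markov inequality \<open>prob_le_dp\<close>, where truncation at 1
  forces \<open>e \<le> 1\<close>, compare \<open>dp\<close> with tail probabilities in both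
  directions. They later match \<open>dp\<close> with the (\<epsilon>,
  \<lambda>)-neighbourhoods.\<close>

lemma dp_le_prob:
  assumes [measurable]: "g \<in> borel_measurable M" and "0 \<le> e"
  shows "dp M g \<le> e + prob {\<omega> \<in> space M. e \<le> \<bar>g \<omega>\<bar>}"
proof -
  have "dp M g \<le> (\<integral>\<omega>. e + indicator {\<omega> \<in> space M. e \<le> \<bar>g \<omega>\<bar>} \<omega> \<partial>M)"
    unfolding dp_def using assms
    by (intro integral_mono integrable_min Bochner_Integration.integrable_add integrable_prob_indicator)
      (auto simp: indicator_def)
  also have "\<dots> = e + prob {\<omega> \<in> space M. e \<le> \<bar>g \<omega>\<bar>}"
    by (subst Bochner_Integration.integral_add) (auto simp: prob_space)
  finally show ?thesis .
qed

lemma prob_le_dp: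
  assumes [measurable]: "g \<in> borel_measurable M" and "0 < e" "e \<le> 1"
  shows "e * prob {\<omega> \<in> space M. e \<le> \<bar>g \<omega>\<bar>} \<le> dp M g"
proof -
  have "(\<integral>\<omega>. e * indicator {\<omega> \<in> space M. e \<le> \<bar>g \<omega>\<bar>} \<omega> \<partial>M) \<le> dp M g"
    unfolding dp_def using assms
    by (intro integral_mono integrable_min integrable_mult_right integrable_prob_indicator)
      (auto simp: indicator_def)
  then show ?thesis by simp
qed

lemma cip_AE:
  assumes [measurable]: "\<And>n. g n \<in> borel_measurable M"
    and lim: "AE \<omega> in M. (\<lambda>n. g n \<omega>) \<longlonglongrightarrow> 0"
  shows "cip M sequentially g"
proof -
  have "(\<lambda>n. \<integral>\<omega>. min 1 \<bar>g n \<omega>\<bar> \<partial>M) \<longlonglongrightarrow> (\<integral>\<omega>. 0 \<partial>M)"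
  proof (rule integral_dominated_convergence[where w="\<lambda>_. 1"])
    show "AE \<omega> in M. (\<lambda>n. min 1 \<bar>g n \<omega>\<bar>) \<longlonglongrightarrow> 0"
      using lim
    proof eventually_elim
      case (elim \<omega>)
      from tendsto_min[OF tendsto_const tendsto_rabs[OF elim], of 1] show ?case by simp
    qed
  qed auto
  then show ?thesis by (simp add: cip_def dp_def)
qed

text \<open>Serves to carry a.e. inequalities through limits in probability. The truncation does no
  harm: values of \<open>min 1\<close> that tend to 0 are eventually below 1 and hence
  untruncated.\<close>

lemma cip_subseq:
  assumes [measurable]: "\<And>n. g n \<in> borel_measurable M" and "cip M sequentially g"
  obtains r :: "nat \<Rightarrow> nat" where "strict_mono r" "AE \<omega> in M. (\<lambda>n. g (r n) \<omega>) \<longlonglongrightarrow> 0"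
proof -
  have "(\<lambda>n. \<integral>\<omega>. norm (min 1 \<bar>g n \<omega>\<bar>) \<partial>M) \<longlonglongrightarrow> 0"
    using assms(2) by (simp add: cip_def dp_def)
  from tendsto_L1_AE_subseq[OF _ this]
  obtain r where r: "strict_mono r" "AE \<omega> in M. (\<lambda>n. min 1 \<bar>g (r n) \<omega>\<bar>) \<longlonglongrightarrow> 0"
    by auto
  from r(2) have "AE \<omega> in M. (\<lambda>n. g (r n) \<omega>) \<longlonglongrightarrow> 0"
  proof eventually_elim
    case (elim \<omega>)
    then have "eventually (\<lambda>n. min 1 \<bar>g (r n) \<omega>\<bar> < 1) sequentially"
      by (rule order_tendstoD) simp
    then have "eventually (\<lambda>n. min 1 \<bar>g (r n) \<omega>\<bar> = \<bar>g (r n) \<omega>\<bar>) sequentially"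
      by eventually_elim auto
    with elim have "(\<lambda>n. \<bar>g (r n) \<omega>\<bar>) \<longlonglongrightarrow> 0" by (simp add: tendsto_cong)
    then show ?case by (rule tendsto_rabs_zero_cancel)
  qed
  with r(1) show ?thesis by (rule that)
qed

lemma cip_le:
  assumes "cip M F g" "\<And>i. f i \<in> borel_measurable M" "\<And>i. g i \<in> borel_measurable M"
    and "eventually (\<lambda>i. AE \<omega> in M. \<bar>f i \<omega>\<bar> \<le> \<bar>g i \<omega>\<bar>) F"
  shows "cip M F f"
  unfolding cip_def
proof (rule tendsto_sandwich[OF _ _ tendsto_const])
  show "((\<lambda>i. dp M (g i)) \<longlongrightarrow> 0) F" using assms(1) by (simp add: cip_def)
  show "\<forall>\<^sub>F i in F. dp M (f i) \<le> dp M (g i)"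
    using assms(4) by eventually_elim (use assms in \<open>auto intro: dp_mono\<close>)
qed (auto simp: dp_nonneg)

lemma cip_add:
  assumes "cip M F f" "cip M F g" "\<And>i. f i \<in> borel_measurable M" "\<And>i. g i \<in> borel_measurable M"
  shows "cip M F (\<lambda>i \<omega>. f i \<omega> + g i \<omega>)"
  unfolding cip_def
proof (rule tendsto_sandwich[OF _ _ tendsto_const])
  show "((\<lambda>i. dp M (f i) + dp M (g i)) \<longlongrightarrow> 0) F"
    using tendsto_add[OF assms(1,2)[unfolded cip_def]] by simp
  show "\<forall>\<^sub>F i in F. dp M (\<lambda>\<omega>. f i \<omega> + g i \<omega>) \<le> dp M (f i) + dp M (g i)"
    by (intro always_eventually allI dp_triangle) (use assms in auto)
qed (auto simp: dp_nonneg)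

lemma exists_prob_tail:
  fixes K :: "'a \<Rightarrow> real"
  assumes [measurable]: "K \<in> borel_measurable M" and "0 < e"
  obtains c where "1 \<le> c" "prob {\<omega> \<in> space M. c < \<bar>K \<omega>\<bar>} < e"
proof -
  have "(\<lambda>n. \<integral>\<omega>. (indicator {\<omega> \<in> space M. real n < \<bar>K \<omega>\<bar>} \<omega> :: real) \<partial>M)
    \<longlonglongrightarrow> (\<integral>\<omega>. 0 \<partial>M)"
  proof (rule integral_dominated_convergence[where w="\<lambda>_. 1"])
    show "AE \<omega> in M. (\<lambda>n. indicator {\<omega> \<in> space M. real n < \<bar>K \<omega>\<bar>} \<omega>) \<longlonglongrightarrow> (0::real)"
    proof (rule AE_I2)
      fix \<omega>
      obtain m :: nat where m: "\<bar>K \<omega>\<bar> \<le> real m" using real_arch_simple by blast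
      have "eventually (\<lambda>n. indicator {\<omega> \<in> space M. real n < \<bar>K \<omega>\<bar>} \<omega> = (0::real)) sequentially"
        using eventually_ge_at_top[of m] by eventually_elim (use m in \<open>auto simp: indicator_def\<close>)
      then show "(\<lambda>n. indicator {\<omega> \<in> space M. real n < \<bar>K \<omega>\<bar>} \<omega>) \<longlonglongrightarrow> (0::real)"
        by (rule tendsto_eventually)
    qed
  qed (auto simp: indicator_def)
  then have "(\<lambda>n. prob {\<omega> \<in> space M. real n < \<bar>K \<omega>\<bar>}) \<longlonglongrightarrow> 0" by simp
  from order_tendstoD(2)[OF this \<open>0 < e\<close>]
  have "eventually (\<lambda>n. prob {\<omega> \<in> space M. real n < \<bar>K \<omega>\<bar>} < e \<and> 1 \<le> n) sequentially"
    using eventually_ge_at_top[of 1] by (rule eventually_conj)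
  then obtain n where "prob {\<omega> \<in> space M. real n < \<bar>K \<omega>\<bar>} < e" "1 \<le> n"
    unfolding eventually_sequentially by blast
  then show ?thesis by (intro that[of "real n"]) auto
qed

text \<open>\<open>K\<close> may be unbounded, so there is no Lipschitz estimate. Where
  \<bar>K\<bar> is at most c, the truncated integrand grows by at most the factor c (here c \<ge> 1
  matters); the remaining tail costs at most its probability, made small before the index
  \<open>i\<close> is chosen.\<close>

lemma cip_mult:
  assumes g: "cip M F g" and [measurable]: "\<And>i. g i \<in> borel_measurable M" "K \<in> borel_measurable M"
  shows "cip M F (\<lambda>i \<omega>. K \<omega> * g i \<omega>)"
  unfolding cip_def
proof (rule tendstoI)
  fix e :: real assume "0 < e"
  then obtain c where c: "1 \<le> c" "prob {\<omega> \<in> space M. c < \<bar>K \<omega>\<bar>} < e/2"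
    using exists_prob_tail[of K "e/2"] by auto
  have le: "dp M (\<lambda>\<omega>. K \<omega> * g i \<omega>) \<le> prob {\<omega> \<in> space M. c < \<bar>K \<omega>\<bar>} + c * dp M (g i)" for i
  proof -
    have "dp M (\<lambda>\<omega>. K \<omega> * g i \<omega>)
        \<le> (\<integral>\<omega>. indicator {\<omega> \<in> space M. c < \<bar>K \<omega>\<bar>} \<omega> + c * min 1 \<bar>g i \<omega>\<bar> \<partial>M)"
      unfolding dp_def
    proof (rule integral_mono)
      fix \<omega> assume "\<omega> \<in> space M"
      show "min 1 \<bar>K \<omega> * g i \<omega>\<bar> \<le> indicator {\<omega> \<in> space M. c < \<bar>K \<omega>\<bar>} \<omega> + c * min 1 \<bar>g i \<omega>\<bar>"
      proof (cases "c < \<bar>K \<omega>\<bar>")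
        case True
        then show ?thesis using \<open>\<omega> \<in> space M\<close> c
          by (auto simp: indicator_def intro: add_increasing2)
      next
        case False
        then have "\<bar>K \<omega>\<bar> * \<bar>g i \<omega>\<bar> \<le> c * \<bar>g i \<omega>\<bar>" by (intro mult_right_mono) auto
        then show ?thesis using c False by (auto simp: abs_mult min_def)
      qed
    qed (auto intro!: Bochner_Integration.integrable_add)
    also have "\<dots> = prob {\<omega> \<in> space M. c < \<bar>K \<omega>\<bar>} + c * dp M (g i)"
      unfolding dp_def by (subst Bochner_Integration.integral_add) auto
    finally show ?thesis .
  qed
  have "eventually (\<lambda>i. dp M (g i) < e / 2 / c) F"
    using g \<open>0 < e\<close> c by (intro order_tendstoD) (auto simp: cip_def)
  then show "eventually (\<lambda>i. dist (dp M (\<lambda>\<omega>. K \<omega> * g i \<omega>)) 0 < e) F"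
  proof eventually_elim
    case (elim i)
    have "c * dp M (g i) < e/2" using elim c by (simp add: field_simps)
    then show ?case using le[of i] c dp_nonneg[of "\<lambda>\<omega>. K \<omega> * g i \<omega>"] by simp
  qed
qed

lemma cip_const:
  assumes "(c \<longlongrightarrow> 0) F"
  shows "cip M F (\<lambda>i \<omega>. c i)"
  unfolding cip_def dp_const using tendsto_min[OF tendsto_const tendsto_rabs[OF assms], of 1] by simp

lemma cip_scale:
  assumes "(c \<longlongrightarrow> 0) F" "g \<in> borel_measurable M"
  shows "cip M F (\<lambda>i \<omega>. c i * g \<omega>)"
  using cip_mult[OF cip_const[OF assms(1)] _ assms(2)] by (simp add: mult.commute)

text \<open>Averages of functions that are merely small in probability need not be small in probability;
  a common majorant \<open>G\<close> makes the convex functional \<open>E[u / (1 + G)]\<close> available.\<close>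

lemma integral_weighted_average_le:
  fixes k :: nat and g :: "nat \<Rightarrow> 'a \<Rightarrow> real"
  assumes [measurable]: "\<And>j. g j \<in> borel_measurable M" "G \<in> borel_measurable M"
    and le: "\<And>j. j < k \<Longrightarrow> AE \<omega> in M. 0 \<le> g j \<omega> \<and> g j \<omega> \<le> G \<omega>"
    and dp: "\<And>j. j < k \<Longrightarrow> dp M (g j) \<le> e" and "0 < k"
  shows "dp M (\<lambda>\<omega>. (1 / (1 + \<bar>G \<omega>\<bar>)) * ((\<Sum>j<k. g j \<omega>) / k)) \<le> e"
proof -
  \<comment> \<open>The weighted \<open>g j\<close> is at most 1 because \<open>g j \<le> G\<close>,
    and at most \<open>g j\<close> because the weight is at most 1. It thus lies below
    \<open>min 1 (g j)\<close> and is still linear in \<open>g j\<close>, so the average can be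
    pulled out of the integral.\<close>
  let ?w = "\<lambda>\<omega>. 1 / (1 + \<bar>G \<omega>\<bar>)"
  have AEw: "AE \<omega> in M. 0 \<le> ?w \<omega> * g j \<omega> \<and> ?w \<omega> * g j \<omega> \<le> min 1 \<bar>g j \<omega>\<bar>" if "j < k" for j
    using le[OF that]
  proof eventually_elim
    case (elim \<omega>)
    have "g j \<omega> \<le> 1 + \<bar>G \<omega>\<bar>" using elim by linarith
    moreover have "g j \<omega> * 1 \<le> g j \<omega> * (1 + \<bar>G \<omega>\<bar>)"
      using elim by (intro mult_left_mono) auto
    ultimately show ?case using elim by (auto simp: field_simps add_pos_nonneg)
  qed
  have int: "integrable M (\<lambda>\<omega>. ?w \<omega> * g j \<omega>)" if "j < k" for j
  proof (rule Bochner_Integration.integrable_bound[OF integrable_min[of "g j"]])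
    show "AE \<omega> in M. norm (?w \<omega> * g j \<omega>) \<le> norm (min 1 \<bar>g j \<omega>\<bar>)"
      using AEw[OF that] by eventually_elim (metis abs_of_nonneg order_trans real_norm_def)
  qed auto
  have intle: "(\<integral>\<omega>. ?w \<omega> * g j \<omega> \<partial>M) \<le> e" if "j < k" for j
  proof -
    have "(\<integral>\<omega>. ?w \<omega> * g j \<omega> \<partial>M) \<le> dp M (g j)"
      unfolding dp_def
      by (rule integral_mono_AE[OF int[OF that] integrable_min[OF assms(1)] eventually_mono[OF AEw[OF that]]])
        (rule conjunct2)
    with dp[OF that] show ?thesis by simp
  qed
  have eq: "?w \<omega> * ((\<Sum>j<k. g j \<omega>) / k) = (\<Sum>j<k. ?w \<omega> * g j \<omega>) / k" for \<omega>
    by (simp add: sum_distrib_left sum_divide_distrib)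
  have "AE \<omega> in M. \<forall>j\<in>{..<k}. 0 \<le> ?w \<omega> * g j \<omega> \<and> ?w \<omega> * g j \<omega> \<le> min 1 \<bar>g j \<omega>\<bar>"
    using AEw by (intro AE_finite_allI) auto
  then have pos: "AE \<omega> in M. 0 \<le> (\<Sum>j<k. ?w \<omega> * g j \<omega>) / k"
    by eventually_elim (intro divide_nonneg_nonneg sum_nonneg of_nat_0_le_iff, blast)
  have "dp M (\<lambda>\<omega>. (\<Sum>j<k. ?w \<omega> * g j \<omega>) / k) \<le> (\<integral>\<omega>. (\<Sum>j<k. ?w \<omega> * g j \<omega>) / k \<partial>M)"
    using int pos
    by (intro dp_le_integral integrable_divide Bochner_Integration.integrable_sum) (simp_all only: lessThan_iff)
  also have "\<dots> = (\<Sum>j<k. \<integral>\<omega>. ?w \<omega> * g j \<omega> \<partial>M) / k"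
    using int by (simp add: Bochner_Integration.integral_sum)
  also have "\<dots> \<le> (\<Sum>j<k. e) / k"
    using intle by (intro divide_right_mono sum_mono) auto
  also have "\<dots> = e" using \<open>0 < k\<close> by simp
  finally show ?thesis by (simp only: eq)
qed

end

section \<open>Essential infima and suprema, and the operator norm\<close>

definition ereal_squash :: "ereal \<Rightarrow> real" where
  "ereal_squash x = (if x = \<infinity> then pi/2 else if x = -\<infinity> then -pi/2 else arctan (real_of_ereal x))"

lemma ereal_squash_strict_mono: "x < y \<Longrightarrow> ereal_squash x < ereal_squash y"
  using arctan_ubound arctan_lbound pi_gt_zero
  by (cases x; cases y) (auto simp: ereal_squash_def arctan_less_iff field_simps)

lemma ereal_squash_mono: "x \<le> y \<Longrightarrow> ereal_squash x \<le> ereal_squash y"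
  using ereal_squash_strict_mono[of x y] by (cases "x = y") (auto simp: order.strict_iff_order)

lemma abs_ereal_squash_le: "\<bar>ereal_squash x\<bar> \<le> pi / 2"
  using arctan_bounded[of "real_of_ereal x"] by (auto simp: ereal_squash_def abs_le_iff)

lemma measurable_ereal_squash [measurable]: "ereal_squash \<in> borel_measurable borel"
  unfolding ereal_squash_def by measurable

context prob_space
begin

text \<open>\<open>L0_Inf\<close> is a choice by SOME and says nothing until existence is known.
  Among pointwise infima of countable subfamilies, one minimises the expectation after a bounded,
  strictly increasing change of scale by arctan. The union of a minimising sequence of subfamilies
  attains the minimum. Adjoining a further \<open>f\<close> cannot lower the expectation, so by
  strictness it does not change the infimum a.e.\<close>

lemma ex_L0_inf:
  assumes H: "\<And>f. f \<in> H \<Longrightarrow> f \<in> borel_measurable M"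
  shows "\<exists>g. is_L0_inf M H g"
proof (cases "H = {}")
  case True
  then show ?thesis by (intro exI[of _ "\<lambda>_. \<infinity>"]) (auto simp: is_L0_inf_def)
next
  case False
  define Cs where "Cs = {C. C \<subseteq> H \<and> countable C \<and> C \<noteq> {}}"
  define I where "I C = (\<lambda>\<omega>. INF f\<in>C. f \<omega>)" for C :: "('a \<Rightarrow> ereal) set"
  define E where "E g = (\<integral>\<omega>. ereal_squash (g \<omega>) \<partial>M)" for g
  have Im [measurable]: "I C \<in> borel_measurable M" if "C \<in> Cs" for C
    unfolding I_def using that H by (intro borel_measurable_INF) (auto simp: Cs_def)
  have int: "integrable M (\<lambda>\<omega>. ereal_squash (g \<omega>))" if "g \<in> borel_measurable M" for g
    using that abs_ereal_squash_le by (intro integrable_const_bound[where B="pi/2"]) auto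
  have lb: "- (pi/2) \<le> E g" if "g \<in> borel_measurable M" for g
  proof -
    have "(\<integral>\<omega>. - (pi/2) \<partial>M) \<le> E g" unfolding E_def
      using int[OF that] abs_ereal_squash_le[THEN abs_le_D2]
      by (intro integral_mono) (auto simp: minus_le_iff)
    then show ?thesis by (simp add: prob_space)
  qed
  obtain f0 where "f0 \<in> H" using False by blast
  then have ne: "{f0} \<in> Cs" by (auto simp: Cs_def)
  define c where "c = (INF C\<in>Cs. E (I C))"
  have bdd: "bdd_below ((\<lambda>C. E (I C)) ` Cs)" using lb Im by (intro bdd_belowI[of _ "- (pi/2)"]) auto
  have "\<exists>C\<in>Cs. E (I C) < c + 1 / Suc n" for n
  proof (rule ccontr)
    assume "\<not> ?thesis"
    then have "c + 1 / Suc n \<le> c" unfolding c_def using ne by (intro cINF_greatest) (auto simp: not_less)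
    then show False by (simp add: field_simps)
  qed
  then obtain Cn where Cn: "\<And>n. Cn n \<in> Cs" "\<And>n::nat. E (I (Cn n)) < c + 1 / Suc n" by metis
  define C where "C = (\<Union>n. Cn n)"
  have C: "C \<in> Cs" using Cn(1) by (fastforce simp: C_def Cs_def)
  have E_mono: "E g \<le> E h" if "g \<in> borel_measurable M" "h \<in> borel_measurable M" "\<And>\<omega>. g \<omega> \<le> h \<omega>" for g h
    unfolding E_def using that by (intro integral_mono int ereal_squash_mono) auto
  have "E (I C) \<le> c + 1 / Suc n" for n
  proof -
    have "E (I C) \<le> E (I (Cn n))"
      using C Cn(1) by (intro E_mono Im) (auto simp: I_def C_def intro!: INF_superset_mono)
    then show ?thesis using Cn(2)[of n] by simp
  qed
  then have "E (I C) \<le> c"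
    using tendsto_add[OF tendsto_const[of c] LIMSEQ_Suc[OF lim_1_over_n]]
    by (intro LIMSEQ_le_const[of "\<lambda>n. c + 1 / Suc n"]) auto
  have "AE \<omega> in M. I C \<omega> \<le> f \<omega>" if "f \<in> H" for f
  proof -
    have C': "insert f C \<in> Cs" using C that by (auto simp: Cs_def)
    have le: "I (insert f C) \<omega> \<le> I C \<omega>" for \<omega> unfolding I_def by (intro INF_superset_mono) auto
    have "c \<le> E (I (insert f C))" unfolding c_def using bdd C' by (rule cINF_lower)
    with \<open>E (I C) \<le> c\<close> have "E (I C) \<le> E (I (insert f C))" by simp
    moreover have "E (I (insert f C)) \<le> E (I C)" using C C' le by (intro E_mono) auto
    ultimately have "E (I C) - E (I (insert f C)) = 0" by simp
    then have "(\<integral>\<omega>. ereal_squash (I C \<omega>) - ereal_squash (I (insert f C) \<omega>) \<partial>M) = 0"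
      unfolding E_def using C C' by (subst Bochner_Integration.integral_diff) (auto intro: int)
    then have "AE \<omega> in M. ereal_squash (I C \<omega>) - ereal_squash (I (insert f C) \<omega>) = 0"
      using C C' le
      by (subst integral_nonneg_eq_0_iff_AE[symmetric])
        (auto intro!: int Bochner_Integration.integrable_diff ereal_squash_mono)
    then show ?thesis
    proof eventually_elim
      case (elim \<omega>)
      have "I (insert f C) \<omega> = I C \<omega>"
        using elim le[of \<omega>] ereal_squash_strict_mono[of "I (insert f C) \<omega>" "I C \<omega>"] by fastforce
      moreover have "I (insert f C) \<omega> \<le> f \<omega>" unfolding I_def by (rule INF_lower) auto
      ultimately show ?case by simp
    qed
  qed
  moreover have "AE \<omega> in M. h \<omega> \<le> I C \<omega>"
    if "h \<in> borel_measurable M" "\<forall>f\<in>H. AE \<omega> in M. h \<omega> \<le> f \<omega>" for h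
  proof -
    have "AE \<omega> in M. \<forall>f\<in>C. h \<omega> \<le> f \<omega>"
      using C that by (intro AE_ball_countable[THEN iffD2]) (auto simp: Cs_def)
    then show ?thesis by eventually_elim (auto simp: I_def intro: INF_greatest)
  qed
  ultimately have "is_L0_inf M H (I C)" using C by (auto simp: is_L0_inf_def)
  then show ?thesis by (rule exI[of _ "I C"])
qed

lemma ex_L0_sup:
  assumes H: "\<And>f. f \<in> H \<Longrightarrow> f \<in> borel_measurable M"
  shows "\<exists>g. is_L0_sup M H g"
proof -
  have "\<exists>g. is_L0_inf M ((\<lambda>f \<omega>. - f \<omega>) ` H) g"
    using H by (intro ex_L0_inf) auto
  then obtain g where g: "is_L0_inf M ((\<lambda>f \<omega>. - f \<omega>) ` H) g" ..
  have "is_L0_sup M H (\<lambda>\<omega>. - g \<omega>)"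
    unfolding is_L0_sup_def
  proof (intro conjI ballI impI)
    show "(\<lambda>\<omega>. - g \<omega>) \<in> borel_measurable M" using g by (auto simp: is_L0_inf_def)
    show "AE \<omega> in M. f \<omega> \<le> - g \<omega>" if "f \<in> H" for f
    proof -
      have "AE \<omega> in M. g \<omega> \<le> - f \<omega>" using g that by (auto simp: is_L0_inf_def)
      then show ?thesis by eventually_elim (metis ereal_minus_le_minus ereal_uminus_uminus)
    qed
    show "AE \<omega> in M. - g \<omega> \<le> h \<omega>" if "h \<in> borel_measurable M" "\<forall>f\<in>H. AE \<omega> in M. f \<omega> \<le> h \<omega>" for h
    proof -
      have "(\<lambda>\<omega>. - h \<omega>) \<in> borel_measurable M" using that by auto
      moreover have "\<forall>f\<in>(\<lambda>f \<omega>. - f \<omega>) ` H. AE \<omega> in M. - h \<omega> \<le> f \<omega>" using that by auto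
      ultimately have "AE \<omega> in M. - h \<omega> \<le> g \<omega>"
        by (rule g[unfolded is_L0_inf_def, THEN conjunct2, THEN conjunct2, THEN bspec, THEN mp])
      then show ?thesis by eventually_elim (metis ereal_minus_le_minus ereal_uminus_uminus)
    qed
  qed
  then show ?thesis by (rule exI[of _ "\<lambda>\<omega>. - g \<omega>"])
qed

lemma is_L0_sup_L0_Sup:
  assumes "\<And>f. f \<in> H \<Longrightarrow> f \<in> borel_measurable M"
  shows "is_L0_sup M H (L0_Sup M H)"
  unfolding L0_Sup_def by (rule someI_ex[OF ex_L0_sup[OF assms]])

lemma is_L0_inf_op_norm:
  "is_L0_inf M {(\<lambda>\<omega>. ereal (\<xi> \<omega>)) | \<xi>. \<xi> \<in> borel_measurable M \<and> (AE \<omega> in M. 0 \<le> \<xi> \<omega>) \<and>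
        (\<forall>x. AE \<omega> in M. nrm (T x) \<omega> \<le> \<xi> \<omega> * nrm x \<omega>)} (op_norm M nrm T)"
  unfolding op_norm_def L0_Inf_def by (rule someI_ex[OF ex_L0_inf]) auto

lemma op_norm_measurable: "op_norm M nrm T \<in> borel_measurable M"
  using is_L0_inf_op_norm[of nrm T] by (simp add: is_L0_inf_def)

lemma op_norm_leI:
  assumes "\<xi> \<in> borel_measurable M" "AE \<omega> in M. 0 \<le> \<xi> \<omega>" "\<And>x. AE \<omega> in M. nrm (T x) \<omega> \<le> \<xi> \<omega> * nrm x \<omega>"
  shows "AE \<omega> in M. op_norm M nrm T \<omega> \<le> ereal (\<xi> \<omega>)"
  proof -
  have "(\<lambda>\<omega>. ereal (\<xi> \<omega>)) \<in> {(\<lambda>\<omega>. ereal (\<xi> \<omega>)) | \<xi>. \<xi> \<in> borel_measurable M \<and> (AE \<omega> in M. 0 \<le> \<xi> \<omega>) \<and>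
        (\<forall>x. AE \<omega> in M. nrm (T x) \<omega> \<le> \<xi> \<omega> * nrm x \<omega>)}"
    using assms by blast
  then show ?thesis by (rule is_L0_inf_op_norm[unfolded is_L0_inf_def, THEN conjunct2, THEN conjunct1, THEN bspec])
qed

text \<open>For fixed \<open>x\<close> the ratio of \<open>nrm (T x)\<close> to \<open>nrm x\<close>
  is a lower bound of the admissible family, hence lies below its infimum. An empty family has
  infimum \<infinity>, which contradicts the real bound \<xi>.\<close>

lemma op_norm_leD:
  assumes [measurable]: "\<And>x. nrm x \<in> borel_measurable M"
    and nonneg: "\<And>x. AE \<omega> in M. 0 \<le> nrm x \<omega>"
    and le: "AE \<omega> in M. op_norm M nrm T \<omega> \<le> ereal (\<xi> \<omega>)"
  shows "AE \<omega> in M. nrm (T x) \<omega> \<le> \<xi> \<omega> * nrm x \<omega>"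
proof -
  define H where "H = {(\<lambda>\<omega>. ereal (\<xi> \<omega>)) | \<xi>. \<xi> \<in> borel_measurable M \<and> (AE \<omega> in M. 0 \<le> \<xi> \<omega>) \<and>
        (\<forall>x. AE \<omega> in M. nrm (T x) \<omega> \<le> \<xi> \<omega> * nrm x \<omega>)}"
  have inf: "is_L0_inf M H (op_norm M nrm T)" unfolding H_def by (rule is_L0_inf_op_norm)
  show ?thesis
  proof (cases "H = {}")
    case True
    then have "AE \<omega> in M. \<infinity> = op_norm M nrm T \<omega>"
      using inf unfolding is_L0_inf_def by (auto dest!: bspec[of _ _ "\<lambda>_. \<infinity>"])
    with le have "AE \<omega> in M. False" by eventually_elim auto
    then show ?thesis by eventually_elim auto
  next
    case False
    \<comment> \<open>Where \<open>nrm x\<close> vanishes the quotient is 0 by convention and tells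
      nothing about \<open>T x\<close>; there any member \<eta> of the family gives
      \<open>nrm (T x) \<omega> \<le> 0\<close>.\<close>
    then obtain \<eta> where \<eta>: "AE \<omega> in M. nrm (T x) \<omega> \<le> \<eta> \<omega> * nrm x \<omega>" unfolding H_def by blast
    define h where "h \<omega> = ereal (nrm (T x) \<omega> / nrm x \<omega>)" for \<omega>
    have "AE \<omega> in M. h \<omega> \<le> f \<omega>" if "f \<in> H" for f
    proof -
      from that obtain \<zeta> where \<zeta>: "f = (\<lambda>\<omega>. ereal (\<zeta> \<omega>))" "AE \<omega> in M. 0 \<le> \<zeta> \<omega>"
        "AE \<omega> in M. nrm (T x) \<omega> \<le> \<zeta> \<omega> * nrm x \<omega>" unfolding H_def by blast
      from \<zeta>(2,3) nonneg[of x] show ?thesis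
        by eventually_elim (auto simp: h_def \<zeta>(1) divide_le_eq)
    qed
    moreover have "h \<in> borel_measurable M" unfolding h_def by measurable
    ultimately have "AE \<omega> in M. h \<omega> \<le> op_norm M nrm T \<omega>" using inf unfolding is_L0_inf_def by blast
    with le \<eta> nonneg[of x] show ?thesis
    proof eventually_elim
      case (elim \<omega>)
      then have "nrm (T x) \<omega> / nrm x \<omega> \<le> \<xi> \<omega>" unfolding h_def
        by (metis ereal_less_eq(3) order_trans)
      with elim show ?case by (cases "nrm x \<omega> = 0") (auto simp: divide_le_eq)
    qed
  qed
qed

end

section \<open>Random normed modules\<close>

text \<open>The right-hand side is \<open>t\<close> times a quantity depending on \<open>z\<close>
  alone. For random \<open>z\<close> this is a vanishing number times a fixed random variable, the
  form that \<open>cip_scale\<close> handles; the same holds for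
  \<open>cmod_exp_quotient\<close>.\<close>

lemma cmod_exp_minus_1:
  fixes z :: complex
  assumes "0 \<le> t" "t \<le> 1"
  shows "cmod (exp (z * of_real t) - 1) \<le> t * (cmod z * exp (cmod z))"
proof -
  have "\<bar>Re (z * of_real t)\<bar> \<le> cmod (z * of_real t)" by (rule abs_Re_le_cmod)
  also have "\<dots> \<le> cmod z" using assms by (simp add: norm_mult mult_left_le)
  finally have "exp \<bar>Re (z * of_real t)\<bar> \<le> exp (cmod z)" by simp
  moreover have "cmod (exp (z * of_real t) - 1) \<le> exp \<bar>Re (z * of_real t)\<bar> * cmod (z * of_real t)"
    using Taylor_exp[of "z * of_real t" 0] by simp
  ultimately have "cmod (exp (z * of_real t) - 1) \<le> exp (cmod z) * cmod (z * of_real t)"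
    by (meson mult_right_mono norm_ge_zero order_trans)
  then show ?thesis using assms by (simp add: norm_mult ac_simps)
qed

lemma cmod_exp_quotient:
  fixes z :: complex
  assumes "0 < t" "t \<le> 1"
  shows "cmod ((exp (z * of_real t) - 1) / of_real t - z) \<le> t * ((cmod z)\<^sup>2 * exp (cmod z))"
proof -
  have "\<bar>Re (z * of_real t)\<bar> \<le> cmod (z * of_real t)" by (rule abs_Re_le_cmod)
  also have "\<dots> \<le> cmod z" using assms by (simp add: norm_mult mult_left_le)
  finally have "exp \<bar>Re (z * of_real t)\<bar> \<le> exp (cmod z)" by simp
  moreover have "cmod (exp (z * of_real t) - (1 + z * of_real t)) \<le> exp \<bar>Re (z * of_real t)\<bar> * (cmod (z * of_real t))\<^sup>2"
    using Taylor_exp[of "z * of_real t" 1] by (simp add: power2_eq_square)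
  ultimately have le: "cmod (exp (z * of_real t) - (1 + z * of_real t)) \<le> exp (cmod z) * (cmod (z * of_real t))\<^sup>2"
    by (meson mult_right_mono zero_le_power2 order_trans)
  have "(exp (z * of_real t) - 1) / of_real t - z = (exp (z * of_real t) - (1 + z * of_real t)) / of_real t"
    using assms by (simp add: field_simps)
  then have "cmod ((exp (z * of_real t) - 1) / of_real t - z) = cmod (exp (z * of_real t) - (1 + z * of_real t)) / t"
    using assms by (simp add: norm_divide)
  also have "\<dots> \<le> exp (cmod z) * (cmod (z * of_real t))\<^sup>2 / t"
    using le assms by (intro divide_right_mono) auto
  also have "\<dots> = t * ((cmod z)\<^sup>2 * exp (cmod z))"
    using assms by (simp add: norm_mult power2_eq_square)
  finally show ?thesis .
qed

lemma eventually_at_right_01: "\<forall>\<^sub>F t in at_right 0. 0 < t \<and> t \<le> (1::real)"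
  unfolding eventually_at_right_field by (intro exI[of _ 1]) auto

lemma inverse_Suc_at_right_0: "filterlim (\<lambda>n. 1 / real (Suc n)) (at_right 0) sequentially"
  using LIMSEQ_Suc[OF lim_1_over_n[where 'a=real]]
  by (auto simp: filterlim_at)

section \<open>Algebra of random normed modules, bounded homomorphisms and convergence\<close>

locale rn_module = prob_space M for M :: "'w measure" +
  fixes sm :: "('w \<Rightarrow> complex) \<Rightarrow> 'a::ab_group_add \<Rightarrow> 'a"
    and nrm :: "'a \<Rightarrow> 'w \<Rightarrow> real"
  assumes rn: "RN_module M sm nrm"
begin

lemma nrm_measurable [measurable, simp]: "nrm x \<in> borel_measurable M"
  using rn by (simp add: RN_module_def)

lemma nrm_nonneg: "AE \<omega> in M. 0 \<le> nrm x \<omega>"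
  using rn by (simp add: RN_module_def)

lemma sm_add_left:
  "\<xi> \<in> borel_measurable M \<Longrightarrow> \<eta> \<in> borel_measurable M \<Longrightarrow> sm (\<lambda>\<omega>. \<xi> \<omega> + \<eta> \<omega>) x = sm \<xi> x + sm \<eta> x"
  by (rule rn[unfolded RN_module_def, THEN conjunct2, THEN conjunct2, THEN conjunct1, rule_format])

lemma sm_add_right: "\<xi> \<in> borel_measurable M \<Longrightarrow> sm \<xi> (x + y) = sm \<xi> x + sm \<xi> y"
  by (rule rn[unfolded RN_module_def, THEN conjunct2, THEN conjunct2, THEN conjunct2, THEN conjunct1, rule_format])

lemma sm_mult:
  "\<xi> \<in> borel_measurable M \<Longrightarrow> \<eta> \<in> borel_measurable M \<Longrightarrow> sm (\<lambda>\<omega>. \<xi> \<omega> * \<eta> \<omega>) x = sm \<xi> (sm \<eta> x)"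
  by (rule rn[unfolded RN_module_def, THEN conjunct2, THEN conjunct2, THEN conjunct2, THEN conjunct2, THEN conjunct1, rule_format])

lemma sm_one [simp]: "sm (\<lambda>_. 1) x = x"
  using rn by (simp add: RN_module_def)

lemma nrm_sm: "\<xi> \<in> borel_measurable M \<Longrightarrow> AE \<omega> in M. nrm (sm \<xi> x) \<omega> = cmod (\<xi> \<omega>) * nrm x \<omega>"
  by (rule rn[unfolded RN_module_def, THEN conjunct2, THEN conjunct2, THEN conjunct2, THEN conjunct2, THEN conjunct2, THEN conjunct2, THEN conjunct2, THEN conjunct1, rule_format])

lemma nrm_triangle: "AE \<omega> in M. nrm (x + y) \<omega> \<le> nrm x \<omega> + nrm y \<omega>"
  by (rule rn[unfolded RN_module_def, THEN conjunct2, THEN conjunct2, THEN conjunct2, THEN conjunct2, THEN conjunct2, THEN conjunct2, THEN conjunct2, THEN conjunct2, THEN conjunct1, rule_format])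

lemma nrm_eq_0D: "AE \<omega> in M. nrm x \<omega> = 0 \<Longrightarrow> x = 0"
  by (rule rn[unfolded RN_module_def, THEN conjunct2, THEN conjunct2, THEN conjunct2, THEN conjunct2, THEN conjunct2, THEN conjunct2, THEN conjunct2, THEN conjunct2, THEN conjunct2, rule_format])

lemma sm_zero_left [simp]: "sm (\<lambda>_. 0) x = 0"
  using sm_add_left[of "\<lambda>_. 0" "\<lambda>_. 0" x] by simp

lemma sm_zero_right [simp]: "\<xi> \<in> borel_measurable M \<Longrightarrow> sm \<xi> 0 = 0"
  using sm_add_right[of \<xi> 0 0] by simp

lemma sm_minus_left: "\<xi> \<in> borel_measurable M \<Longrightarrow> sm (\<lambda>\<omega>. - \<xi> \<omega>) x = - sm \<xi> x"
  using sm_add_left[of \<xi> "\<lambda>\<omega>. - \<xi> \<omega>" x] by (simp add: eq_neg_iff_add_eq_0 add.commute)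

lemma sm_minus_right: "\<xi> \<in> borel_measurable M \<Longrightarrow> sm \<xi> (- x) = - sm \<xi> x"
  using sm_add_right[of \<xi> x "- x"] by (simp add: eq_neg_iff_add_eq_0 add.commute)

lemma sm_diff_left:
  "\<xi> \<in> borel_measurable M \<Longrightarrow> \<eta> \<in> borel_measurable M \<Longrightarrow> sm (\<lambda>\<omega>. \<xi> \<omega> - \<eta> \<omega>) x = sm \<xi> x - sm \<eta> x"
  using sm_add_left[of \<xi> "\<lambda>\<omega>. - \<eta> \<omega>" x] by (simp add: sm_minus_left)

lemma sm_diff_right: "\<xi> \<in> borel_measurable M \<Longrightarrow> sm \<xi> (x - y) = sm \<xi> x - sm \<xi> y"
  using sm_add_right[of \<xi> x "- y"] by (simp add: sm_minus_right)

lemma nrm_zero: "AE \<omega> in M. nrm 0 \<omega> = 0"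
  using nrm_sm[of "\<lambda>_. 0" 0] by simp

lemma nrm_minus: "AE \<omega> in M. nrm (- x) \<omega> = nrm x \<omega>"
  using nrm_sm[of "\<lambda>_. - 1" x] by (simp add: sm_minus_left)

lemma nrm_commute: "AE \<omega> in M. nrm (x - y) \<omega> = nrm (y - x) \<omega>"
  using nrm_minus[of "x - y"] by (simp add: eq_commute)

lemma nrm_diff_triangle: "AE \<omega> in M. nrm (x - z) \<omega> \<le> nrm (x - y) \<omega> + nrm (y - z) \<omega>"
  using nrm_triangle[of "x - y" "y - z"] by simp

lemma nrm_diff_le: "AE \<omega> in M. nrm (x - y) \<omega> \<le> nrm x \<omega> + nrm y \<omega>"
  using nrm_triangle[of x "- y"] nrm_minus[of y] by (simp, eventually_elim, simp)

lemma nrm_sum_le: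
  fixes k :: nat
  shows "AE \<omega> in M. nrm (\<Sum>j<k. f j) \<omega> \<le> (\<Sum>j<k. nrm (f j) \<omega>)"
proof (induction k)
  case 0
  show ?case using nrm_zero by (auto elim!: eventually_mono)
next
  case (Suc k)
  from Suc.IH nrm_triangle[of "\<Sum>j<k. f j" "f k"] show ?case by eventually_elim auto
qed

abbreviation rs :: "real \<Rightarrow> 'a \<Rightarrow> 'a" where
  "rs c x \<equiv> sm (\<lambda>_. complex_of_real c) x"

lemma rs_add_left: "rs (a + b) x = rs a x + rs b x"
  using sm_add_left[of "\<lambda>_. complex_of_real a" "\<lambda>_. complex_of_real b" x] by simp

lemma rs_mult: "rs a (rs b x) = rs (a * b) x"
  using sm_mult[of "\<lambda>_. complex_of_real a" "\<lambda>_. complex_of_real b" x] by simp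

lemma rs_of_nat: "rs (real k) x = (\<Sum>j<k. x)"
  by (induction k) (simp_all add: sm_add_left add.commute)

lemma nrm_rs: "AE \<omega> in M. nrm (rs c x) \<omega> = \<bar>c\<bar> * nrm x \<omega>"
  using nrm_sm[of "\<lambda>_. complex_of_real c" x] by simp

definition hom :: "('a \<Rightarrow> 'a) \<Rightarrow> bool" where
  "hom T \<longleftrightarrow> (\<forall>x y. T (x + y) = T x + T y) \<and>
     (\<forall>\<xi> x. \<xi> \<in> borel_measurable M \<longrightarrow> T (sm \<xi> x) = sm \<xi> (T x))"

text \<open>The vector is quantified outside the almost sure statement: the null set may depend on
  \<open>x\<close>, and there are in general uncountably many vectors.\<close>

definition bnd :: "('a \<Rightarrow> 'a) \<Rightarrow> ('w \<Rightarrow> real) \<Rightarrow> bool" where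
  "bnd T K \<longleftrightarrow> (\<forall>x. AE \<omega> in M. nrm (T x) \<omega> \<le> K \<omega> * nrm x \<omega>)"

lemma hom_add: "hom T \<Longrightarrow> T (x + y) = T x + T y"
  by (simp add: hom_def)

lemma hom_sm: "hom T \<Longrightarrow> \<xi> \<in> borel_measurable M \<Longrightarrow> T (sm \<xi> x) = sm \<xi> (T x)"
  by (simp add: hom_def)

lemma hom_zero [simp]: "hom T \<Longrightarrow> T 0 = 0"
  using hom_add[of T 0 0] by simp

lemma hom_minus: "hom T \<Longrightarrow> T (- x) = - T x"
  using hom_add[of T x "- x"] by (simp add: eq_neg_iff_add_eq_0 add.commute)

lemma hom_diff: "hom T \<Longrightarrow> T (x - y) = T x - T y"
  using hom_add[of T x "- y"] by (simp add: hom_minus)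

lemma hom_sum: "hom T \<Longrightarrow> T (\<Sum>j\<in>I. f j) = (\<Sum>j\<in>I. T (f j))"
  by (induction I rule: infinite_finite_induct) (simp_all add: hom_add)

lemma hom_id: "hom (\<lambda>x. x)" by (simp add: hom_def)

lemma hom_comp: "hom T \<Longrightarrow> hom U \<Longrightarrow> hom (\<lambda>x. T (U x))" by (simp add: hom_def)

lemma hom_funpow: "hom T \<Longrightarrow> hom (T ^^ n)"
  by (induction n) (auto simp: hom_def)

lemma hom_sm_scalar: "\<xi> \<in> borel_measurable M \<Longrightarrow> hom (sm \<xi>)"
  unfolding hom_def using sm_mult by (auto simp: sm_add_right) (metis (no_types, lifting) mult.commute ext)

lemma bndD: "bnd T K \<Longrightarrow> AE \<omega> in M. nrm (T x) \<omega> \<le> K \<omega> * nrm x \<omega>"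
  by (simp add: bnd_def)

lemma bnd_sm:
  assumes "\<xi> \<in> borel_measurable M"
  shows "bnd (sm \<xi>) (\<lambda>\<omega>. cmod (\<xi> \<omega>))"
  unfolding bnd_def
proof
  fix x
  from nrm_sm[OF assms, of x] show "AE \<omega> in M. nrm (sm \<xi> x) \<omega> \<le> cmod (\<xi> \<omega>) * nrm x \<omega>"
    by eventually_elim simp
qed

lemma bnd_comp:
  assumes "bnd T K" "bnd U L" "AE \<omega> in M. 0 \<le> K \<omega>"
  shows "bnd (\<lambda>x. T (U x)) (\<lambda>\<omega>. K \<omega> * L \<omega>)"
  unfolding bnd_def
proof
  fix x
  from bndD[OF assms(1), of "U x"] bndD[OF assms(2), of x] assms(3)
  show "AE \<omega> in M. nrm (T (U x)) \<omega> \<le> K \<omega> * L \<omega> * nrm x \<omega>"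
    by eventually_elim (metis mult.assoc mult_left_mono order_trans)
qed

lemma bnd_mono:
  assumes "bnd T K" "AE \<omega> in M. K \<omega> \<le> L \<omega>"
  shows "bnd T L"
  unfolding bnd_def
proof
  fix x
  from bndD[OF assms(1), of "x"] assms(2) nrm_nonneg[of x]
  show "AE \<omega> in M. nrm (T x) \<omega> \<le> L \<omega> * nrm x \<omega>"
    by eventually_elim (metis mult_right_mono order_trans)
qed

lemma bnd_diff_ops:
  assumes "hom U" "hom V" "bnd U K" "bnd V L"
  shows "hom (\<lambda>x. U x - V x) \<and> bnd (\<lambda>x. U x - V x) (\<lambda>\<omega>. K \<omega> + L \<omega>)"
proof
  show "hom (\<lambda>x. U x - V x)" using assms(1,2) by (auto simp: hom_def sm_diff_right)
  show "bnd (\<lambda>x. U x - V x) (\<lambda>\<omega>. K \<omega> + L \<omega>)"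
    unfolding bnd_def
  proof
    fix x
    from bndD[OF assms(3), of x] bndD[OF assms(4), of x] nrm_diff_le[of "U x" "V x"]
    show "AE \<omega> in M. nrm (U x - V x) \<omega> \<le> (K \<omega> + L \<omega>) * nrm x \<omega>"
      by eventually_elim (simp add: distrib_right)
  qed
qed

text \<open>Trades the operator norm, an essential infimum fixed only up to null sets, for plain
  inequalities on vectors. All estimates below are made with \<open>bnd\<close>.\<close>

lemma op_norm_le_iff_bnd:
  assumes "K \<in> borel_measurable M" "AE \<omega> in M. 0 \<le> K \<omega>"
  shows "(AE \<omega> in M. op_norm M nrm T \<omega> \<le> ereal (K \<omega>)) \<longleftrightarrow> bnd T K"
proof
  show "bnd T K" if "AE \<omega> in M. op_norm M nrm T \<omega> \<le> ereal (K \<omega>)"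
    unfolding bnd_def using op_norm_leD[OF nrm_measurable nrm_nonneg that] by blast
  show "AE \<omega> in M. op_norm M nrm T \<omega> \<le> ereal (K \<omega>)" if "bnd T K"
    by (rule op_norm_leI[OF assms]) (rule bndD[OF that])
qed

definition tends :: "'i filter \<Rightarrow> ('i \<Rightarrow> 'a) \<Rightarrow> 'a \<Rightarrow> bool" where
  "tends F f l \<longleftrightarrow> cip M F (\<lambda>i. nrm (f i - l))"

lemma tendsI:
  assumes "cip M F g" "\<And>i. g i \<in> borel_measurable M"
    "eventually (\<lambda>i. AE \<omega> in M. nrm (f i - l) \<omega> \<le> g i \<omega>) F"
  shows "tends F f l"
  unfolding tends_def
proof (rule cip_le[OF assms(1)])
  show "\<forall>\<^sub>F i in F. AE \<omega> in M. \<bar>nrm (f i - l) \<omega>\<bar> \<le> \<bar>g i \<omega>\<bar>"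
    using assms(3)
  proof eventually_elim
    case (elim i)
    with nrm_nonneg[of "f i - l"] show ?case by eventually_elim linarith
  qed
qed (use assms in auto)

lemma tends_const: "tends F (\<lambda>_. l) l"
  using cip_const[OF tendsto_const, of F]
  by (intro tendsI[of _ "\<lambda>_ _. 0"] always_eventually[of _ F] allI)
    (auto intro!: eventually_mono[OF nrm_zero])

lemma tends_add:
  assumes "tends F f l" "tends F g m"
  shows "tends F (\<lambda>i. f i + g i) (l + m)"
proof (rule tendsI[OF cip_add[OF assms[unfolded tends_def]]])
  show "\<forall>\<^sub>F i in F. AE \<omega> in M. nrm (f i + g i - (l + m)) \<omega> \<le> nrm (f i - l) \<omega> + nrm (g i - m) \<omega>"
    by (rule always_eventually, rule allI) (simp only: add_diff_add nrm_triangle)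
qed auto

lemma tends_op:
  assumes "tends F f l" "bnd T K" "hom T" "K \<in> borel_measurable M"
  shows "tends F (\<lambda>i. T (f i)) (T l)"
proof (rule tendsI[OF cip_mult[OF assms(1)[unfolded tends_def] _ assms(4)]])
  show "\<forall>\<^sub>F i in F. AE \<omega> in M. nrm (T (f i) - T l) \<omega> \<le> K \<omega> * nrm (f i - l) \<omega>"
    using bndD[OF assms(2)] by (intro always_eventually[of _ F] allI) (simp flip: hom_diff[OF assms(3)])
qed (use assms in auto)

lemma tends_sm: "tends F f l \<Longrightarrow> \<xi> \<in> borel_measurable M \<Longrightarrow> tends F (\<lambda>i. sm \<xi> (f i)) (sm \<xi> l)"
  by (erule tends_op[OF _ bnd_sm hom_sm_scalar]) auto

lemma tends_minus: "tends F f l \<Longrightarrow> tends F (\<lambda>i. - f i) (- l)"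
  using tends_sm[of F f l "\<lambda>_. - 1"] by (simp add: sm_minus_left)

lemma tends_diff: "tends F f l \<Longrightarrow> tends F g m \<Longrightarrow> tends F (\<lambda>i. f i - g i) (l - m)"
  using tends_add[of F f l "\<lambda>i. - g i" "- m"] by (simp add: tends_minus)

lemma tends_cong:
  assumes "eventually (\<lambda>i. f i = g i) F"
  shows "tends F f l \<longleftrightarrow> tends F g l"
  unfolding tends_def cip_def
  by (rule tendsto_cong) (use assms in eventually_elim, simp)

lemma tends_zero_iff: "tends F (\<lambda>i. f i - l) 0 \<longleftrightarrow> tends F f l"
  by (simp add: tends_def)

lemma tends_bounded_family:
  assumes "tends F f 0" "K \<in> borel_measurable M"
    "eventually (\<lambda>i. AE \<omega> in M. nrm (g i) \<omega> \<le> K \<omega> * nrm (f i) \<omega>) F"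
  shows "tends F g 0"
  by (rule tendsI[OF cip_mult[OF assms(1)[unfolded tends_def] _ assms(2)]]) (use assms in auto)

lemma tends_rs:
  assumes "(c \<longlongrightarrow> a) F" "tends F z l"
  shows "tends F (\<lambda>i. rs (c i) (z i)) (rs a l)"
proof (rule tendsI)
  have "((\<lambda>i. c i - a) \<longlongrightarrow> 0) F" using tendsto_diff[OF assms(1) tendsto_const[of a]] by simp
  then have "((\<lambda>i. \<bar>c i - a\<bar>) \<longlongrightarrow> 0) F" by (rule tendsto_rabs_zero)
  then show "cip M F (\<lambda>i \<omega>. (\<bar>a\<bar> + 1) * nrm (z i - l) \<omega> + \<bar>c i - a\<bar> * nrm l \<omega>)"
    using assms(2) unfolding tends_def by (intro cip_add cip_mult cip_scale) auto
  from order_tendstoD(2)[OF \<open>((\<lambda>i. \<bar>c i - a\<bar>) \<longlongrightarrow> 0) F\<close>, of 1]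
  have "\<forall>\<^sub>F i in F. \<bar>c i - a\<bar> < 1" by simp
  then show "\<forall>\<^sub>F i in F. AE \<omega> in M. nrm (rs (c i) (z i) - rs a l) \<omega>
      \<le> (\<bar>a\<bar> + 1) * nrm (z i - l) \<omega> + \<bar>c i - a\<bar> * nrm l \<omega>"
  proof eventually_elim
    case (elim i)
    have "rs (c i) (z i) - rs a l = rs (c i) (z i - l) + rs (c i - a) l"
      using sm_diff_left[of "\<lambda>_. complex_of_real (c i)" "\<lambda>_. complex_of_real a" l]
      by (simp add: sm_diff_right)
    with nrm_triangle[of "rs (c i) (z i - l)" "rs (c i - a) l"]
    have "AE \<omega> in M. nrm (rs (c i) (z i) - rs a l) \<omega> \<le> nrm (rs (c i) (z i - l)) \<omega> + nrm (rs (c i - a) l) \<omega>"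
      by simp
    with nrm_rs[of "c i" "z i - l"] nrm_rs[of "c i - a" l] nrm_nonneg[of "z i - l"]
    show ?case
    proof eventually_elim
      fix \<omega>
      assume 1: "nrm (rs (c i) (z i - l)) \<omega> = \<bar>c i\<bar> * nrm (z i - l) \<omega>"
        "nrm (rs (c i - a) l) \<omega> = \<bar>c i - a\<bar> * nrm l \<omega>" "0 \<le> nrm (z i - l) \<omega>"
        "nrm (rs (c i) (z i) - rs a l) \<omega> \<le> nrm (rs (c i) (z i - l)) \<omega> + nrm (rs (c i - a) l) \<omega>"
      have "\<bar>c i\<bar> * nrm (z i - l) \<omega> \<le> (\<bar>a\<bar> + 1) * nrm (z i - l) \<omega>"
        using elim 1(3) by (intro mult_right_mono) auto
      with 1 show "nrm (rs (c i) (z i) - rs a l) \<omega>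
        \<le> (\<bar>a\<bar> + 1) * nrm (z i - l) \<omega> + \<bar>c i - a\<bar> * nrm l \<omega>" by linarith
    qed
  qed
qed auto

lemma tends_compose:
  assumes "tends F f l" "filterlim h F G"
  shows "tends G (\<lambda>i. f (h i)) l"
  using filterlim_compose[OF assms(1)[unfolded tends_def cip_def] assms(2)] by (simp add: tends_def cip_def)

text \<open>By the triangle inequality \<open>nrm l\<close> is at most \<open>g\<close> plus the
  distance of \<open>f n\<close> to \<open>l\<close>, and that distance vanishes a.e. along a
  subsequence.\<close>

lemma tends_nrm_le:
  fixes f :: "nat \<Rightarrow> 'a"
  assumes "tends sequentially f l" "\<And>n. AE \<omega> in M. nrm (f n) \<omega> \<le> g \<omega>"
  shows "AE \<omega> in M. nrm l \<omega> \<le> g \<omega>"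
proof -
  obtain r :: "nat \<Rightarrow> nat" where r: "AE \<omega> in M. (\<lambda>n. nrm (f (r n) - l) \<omega>) \<longlonglongrightarrow> 0"
    by (rule cip_subseq[OF _ assms(1)[unfolded tends_def]]) auto
  have "AE \<omega> in M. nrm l \<omega> \<le> g \<omega> + nrm (f (r n) - l) \<omega>" for n
    using nrm_triangle[of "f (r n)" "- (f (r n) - l)"] nrm_minus[of "f (r n) - l"] assms(2)[of "r n"]
    by eventually_elim simp
  then have "AE \<omega> in M. \<forall>n. nrm l \<omega> \<le> g \<omega> + nrm (f (r n) - l) \<omega>" by (simp add: AE_all_countable)
  with r show ?thesis
  proof eventually_elim
    case (elim \<omega>)
    from tendsto_add[OF tendsto_const elim(1), of "g \<omega>"] have "nrm l \<omega> \<le> g \<omega> + 0"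
      by (rule LIMSEQ_le_const) (use elim in auto)
    then show ?case by simp
  qed
qed

text \<open>Interchange of limits: the error \<open>a k\<close> is uniform in \<open>i\<close>, so
  \<open>k\<close> is fixed first to make it small, and only then does \<open>b k i\<close> vanish
  along \<open>F\<close>.\<close>

lemma tends_zero_approx:
  assumes "\<And>k::nat. eventually (\<lambda>i. AE \<omega> in M. nrm (f i) \<omega> \<le> a k \<omega> + b k i \<omega>) F"
    and "cip M sequentially a" "\<And>k. cip M F (b k)"
    and [measurable]: "\<And>k. a k \<in> borel_measurable M" "\<And>k i. b k i \<in> borel_measurable M"
  shows "tends F f 0"
  unfolding tends_def cip_def
proof (rule tendstoI)
  fix e :: real assume "0 < e"
  then have "\<forall>\<^sub>F k in sequentially. dp M (a k) < e / 2"
    by (intro order_tendstoD(2)[OF assms(2)[unfolded cip_def]]) simp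
  then obtain k where k: "dp M (a k) < e / 2" by (auto simp: eventually_sequentially)
  have "\<forall>\<^sub>F i in F. dp M (b k i) < e / 2"
    using \<open>0 < e\<close> by (intro order_tendstoD(2)[OF assms(3)[unfolded cip_def]]) simp
  with assms(1)[of k] show "\<forall>\<^sub>F i in F. dist (dp M (nrm (f i - 0))) 0 < e"
  proof eventually_elim
    case (elim i)
    have "dp M (nrm (f i)) \<le> dp M (a k) + dp M (b k i)"
    proof (rule dp_triangle)
      from elim(1) nrm_nonneg[of "f i"] show "AE \<omega> in M. \<bar>nrm (f i) \<omega>\<bar> \<le> \<bar>a k \<omega>\<bar> + \<bar>b k i \<omega>\<bar>"
        by eventually_elim linarith
    qed auto
    with elim k show ?case by (simp add: dp_nonneg)
  qed
qed

text \<open>The easy half of Banach--Steinhaus. A common random bound \<open>K\<close> extends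
  convergence from a dense set to all vectors; it is applied to differences of operators.\<close>

lemma tends_zero_dense:
  assumes [measurable]: "K \<in> borel_measurable M"
    and W: "eventually (\<lambda>i. hom (W i) \<and> bnd (W i) K) F"
    and u: "tends sequentially u x" and Wu: "\<And>k::nat. tends F (\<lambda>i. W i (u k)) 0"
  shows "tends F (\<lambda>i. W i x) 0"
proof (rule tends_zero_approx)
  show "cip M sequentially (\<lambda>k \<omega>. K \<omega> * nrm (u k - x) \<omega>)"
    using u unfolding tends_def by (rule cip_mult) auto
  show "cip M F (\<lambda>i. nrm (W i (u k)))" for k using Wu[of k] by (simp add: tends_def)
  show "\<forall>\<^sub>F i in F. AE \<omega> in M. nrm (W i x) \<omega> \<le> K \<omega> * nrm (u k - x) \<omega> + nrm (W i (u k)) \<omega>" for k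
    using W
  proof eventually_elim
    case (elim i)
    then have "W i (u k - x) = W i (u k) - W i x" by (simp add: hom_diff)
    with nrm_diff_le[of "W i (u k)" "W i (u k - x)"] bndD[of "W i" K "u k - x"] elim
    have "AE \<omega> in M. nrm (W i x) \<omega> \<le> nrm (W i (u k)) \<omega> + nrm (W i (u k - x)) \<omega>"
      "AE \<omega> in M. nrm (W i (u k - x)) \<omega> \<le> K \<omega> * nrm (u k - x) \<omega>" by auto
    then show ?case by eventually_elim linarith
  qed
qed auto

section \<open>Generators as relations, and the metric of the (\<epsilon>,
  \<lambda>)-topology\<close>

definition gen :: "(real \<Rightarrow> 'a \<Rightarrow> 'a) \<Rightarrow> 'a \<Rightarrow> 'a \<Rightarrow> bool" where
  "gen T x y \<longleftrightarrow> tends (at_right 0) (\<lambda>t. rs (1 / t) (T t x - x)) y"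

definition mdist :: "'a \<Rightarrow> 'a \<Rightarrow> real" where "mdist x y = dp M (nrm (x - y))"

sublocale mod: Metric_space UNIV mdist
proof
  show "mdist x y = mdist y x" for x y
    unfolding mdist_def using nrm_commute[of x y]
    by (intro antisym dp_mono) (auto elim!: eventually_mono)
  show "mdist x y = 0 \<longleftrightarrow> x = y" for x y
    using dp_eq_0D[of "nrm (x - y)"] nrm_eq_0D[of "x - y"] dp_const[of 0] dp_nonneg[of "nrm 0"] nrm_zero
      dp_mono[of "nrm 0" "\<lambda>_. 0"]
    unfolding mdist_def by (auto elim!: eventually_mono)
  show "mdist x z \<le> mdist x y + mdist y z" for x y z
    unfolding mdist_def
  proof (rule dp_triangle)
    from nrm_diff_triangle[of x z y] nrm_nonneg[of "x - z"]
    show "AE \<omega> in M. \<bar>nrm (x - z) \<omega>\<bar> \<le> \<bar>nrm (x - y) \<omega>\<bar> + \<bar>nrm (y - z) \<omega>\<bar>"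
      by eventually_elim linarith
  qed auto
qed (auto simp: mdist_def dp_nonneg)

lemma tends_iff_mdist: "tends F f l \<longleftrightarrow> ((\<lambda>i. mdist (f i) l) \<longlongrightarrow> 0) F"
  by (simp add: tends_def cip_def mdist_def)

lemma tends_unique: "F \<noteq> bot \<Longrightarrow> tends F f l \<Longrightarrow> tends F f m \<Longrightarrow> l = m"
proof -
  assume F: "F \<noteq> bot" and lim: "tends F f l" "tends F f m"
  have "((\<lambda>i. mdist (f i) l + mdist (f i) m) \<longlongrightarrow> 0) F"
    using tendsto_add[OF lim[unfolded tends_iff_mdist]] by simp
  then have "mdist l m \<le> 0"
    by (rule tendsto_lowerbound)
      (use F mod.triangle''[of l _ m] in \<open>auto intro!: always_eventually\<close>)
  then show ?thesis using mod.nonneg[of l m] by (simp add: order_antisym)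
qed

lemma prob_nrm_less:
  "0 < e \<Longrightarrow> prob {\<omega> \<in> space M. nrm x \<omega> < e} = 1 - prob {\<omega> \<in> space M. e \<le> \<bar>nrm x \<omega>\<bar>}"
proof -
  assume "0 < e"
  have "prob {\<omega> \<in> space M. nrm x \<omega> < e} = prob {\<omega> \<in> space M. \<not> e \<le> \<bar>nrm x \<omega>\<bar>}"
    using nrm_nonneg[of x] by (intro measure_eq_AE) (auto elim!: eventually_mono)
  also have "\<dots> = 1 - prob {\<omega> \<in> space M. e \<le> \<bar>nrm x \<omega>\<bar>}"
    by (rule prob_neg) measurable
  finally show ?thesis .
qed

text \<open>With \<open>ball_subset_nbhd\<close> this shows that metric balls and (\<epsilon>,
  \<lambda>)-neighbourhoods refine each other, so both define the same open sets and the topology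
  inherits the library of \<open>Metric_space\<close>.\<close>

lemma nbhd_subset_ball:
  assumes "0 < r"
  shows "\<exists>e>0. \<exists>lam. 0 < lam \<and> lam < 1 \<and> {y. y - x \<in> eps_lambda_nbhd M nrm e lam} \<subseteq> mod.mball x r"
proof (intro exI conjI subsetI)
  \<comment> \<open>The threshold and the probability each contribute r/2 in
    \<open>dp_le_prob\<close>; the minimum with 1/2 keeps \<lambda> below 1.\<close>
  fix y assume "y \<in> {y. y - x \<in> eps_lambda_nbhd M nrm (r/2) (min (r/2) (1/2))}"
  then have "prob {\<omega> \<in> space M. r/2 \<le> \<bar>nrm (y - x) \<omega>\<bar>} < min (r/2) (1/2)"
    using assms prob_nrm_less[of "r/2" "y - x"] unfolding eps_lambda_nbhd_def by simp
  with dp_le_prob[of "nrm (y - x)" "r/2"] assms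
  show "y \<in> mod.mball x r" unfolding mod.in_mball mod.commute[of x y] by (simp add: mdist_def)
qed (use assms in auto)

lemma ball_subset_nbhd:
  assumes "0 < e" "0 < lam"
  shows "\<exists>r>0. mod.mball x r \<subseteq> {y. y - x \<in> eps_lambda_nbhd M nrm e lam}"
proof (intro exI conjI subsetI)
  \<comment> \<open>The Markov bound \<open>prob_le_dp\<close> needs a threshold of at most
    1.\<close>
  let ?e = "min e 1"
  show "0 < ?e * lam" using assms by simp
  fix y assume "y \<in> mod.mball x (?e * lam)"
  then have "dp M (nrm (y - x)) < ?e * lam" using mod.commute[of x y] by (simp add: mdist_def)
  moreover have "?e * prob {\<omega> \<in> space M. ?e \<le> \<bar>nrm (y - x) \<omega>\<bar>} \<le> dp M (nrm (y - x))"
    using assms by (intro prob_le_dp) auto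
  ultimately have "?e * prob {\<omega> \<in> space M. ?e \<le> \<bar>nrm (y - x) \<omega>\<bar>} < ?e * lam" by linarith
  then have "prob {\<omega> \<in> space M. ?e \<le> \<bar>nrm (y - x) \<omega>\<bar>} < lam"
    by (rule mult_less_cancel_left_pos[THEN iffD1, rotated]) (use assms in auto)
  moreover have "prob {\<omega> \<in> space M. e \<le> \<bar>nrm (y - x) \<omega>\<bar>} \<le> prob {\<omega> \<in> space M. ?e \<le> \<bar>nrm (y - x) \<omega>\<bar>}"
    by (intro finite_measure_mono) auto
  ultimately show "y \<in> {y. y - x \<in> eps_lambda_nbhd M nrm e lam}"
    using assms by (simp add: eps_lambda_nbhd_def prob_nrm_less)
qed

lemma eps_lambda_topology_eq: "eps_lambda_topology M nrm = mod.mtopology"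
proof -
  have "eps_lambda_open M nrm U \<longleftrightarrow> mod.mopen U" for U
    unfolding eps_lambda_open_def mod.mopen_def
    using nbhd_subset_ball ball_subset_nbhd by (meson order_trans subset_UNIV)
  then have "eps_lambda_open M nrm = mod.mopen" by blast
  then show ?thesis by (simp add: eps_lambda_topology_def mod.mtopology_def)
qed

lemma limitin_iff_tends: "limitin (eps_lambda_topology M nrm) f l F \<longleftrightarrow> tends F f l"
  unfolding eps_lambda_topology_eq mod.limitin_metric tends_iff_mdist tendsto_iff
  by simp

lemma continuous_op:
  assumes "bnd T K" "hom T" "K \<in> borel_measurable M"
  shows "continuous_map (eps_lambda_topology M nrm) (eps_lambda_topology M nrm) T"
  unfolding eps_lambda_topology_eq mod.metric_continuous_map[OF mod.Metric_space_axioms]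
proof (intro conjI ballI allI impI)
  fix a and e :: real assume "0 < e"
  \<comment> \<open>The neighbourhood filter of \<open>a\<close>, written as the pullback of
    \<open>nhds 0\<close> under the distance to \<open>a\<close>. The identity converges to
    \<open>a\<close> along it, so \<open>tends_op\<close> delivers the epsilon-delta
    statement.\<close>
  let ?F = "filtercomap (\<lambda>x. mdist x a) (nhds 0)"
  have "tends ?F (\<lambda>x. x) a" unfolding tends_iff_mdist by (rule filterlim_filtercomap)
  from tends_op[OF this assms] have "((\<lambda>x. mdist (T x) (T a)) \<longlongrightarrow> 0) ?F"
    by (simp add: tends_iff_mdist)
  from order_tendstoD(2)[OF this \<open>0 < e\<close>] obtain Q where
    Q: "eventually Q (nhds (0::real))" "\<And>x. Q (mdist x a) \<Longrightarrow> mdist (T x) (T a) < e"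
    unfolding eventually_filtercomap by blast
  from Q(1) obtain r where "0 < r" "\<And>t. dist t 0 < r \<Longrightarrow> Q t"
    unfolding eventually_nhds_metric by blast
  with Q(2) show "\<exists>r>0. \<forall>x. x \<in> UNIV \<and> mdist a x < r \<longrightarrow> mdist (T a) (T x) < e"
    by (intro exI[of _ r]) (auto simp: mod.commute)
qed auto

lemma bounded_opI:
  assumes "bnd T K" "hom T" "K \<in> borel_measurable M"
  shows "bounded_op M sm nrm T"
  using continuous_op[OF assms] assms(2) unfolding bounded_op_def hom_def by blast

lemma bounded_op_hom: "bounded_op M sm nrm T \<Longrightarrow> hom T"
  unfolding bounded_op_def hom_def by blast

lemma densely_defined_iff: "densely_defined M nrm D \<longleftrightarrow> (\<forall>x. \<exists>u. (\<forall>n::nat. u n \<in> D) \<and> tends sequentially u x)"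
proof -
  have "(\<forall>r>0. \<exists>y\<in>D. mdist x y < r) \<longleftrightarrow> (\<exists>u. (\<forall>n::nat. u n \<in> D) \<and> tends sequentially u x)" (is "?L \<longleftrightarrow> ?R") for x
  proof
    assume ?L
    then have "\<exists>y\<in>D. mdist x y < 1 / Suc n" for n by simp
    then obtain u where u: "\<And>n. u n \<in> D" "\<And>n::nat. mdist x (u n) < 1 / Suc n" by metis
    have "(\<lambda>n. mdist (u n) x) \<longlonglongrightarrow> 0"
    proof (rule tendsto_sandwich[OF _ _ tendsto_const LIMSEQ_Suc[OF lim_1_over_n]])
      show "\<forall>\<^sub>F n in sequentially. mdist (u n) x \<le> 1 / of_nat (Suc n)"
        using u(2) by (intro always_eventually allI) (metis less_imp_le mod.commute)
    qed auto
    then show ?R using u(1) by (auto simp: tends_iff_mdist)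
  next
    assume ?R
    then obtain u where u: "\<And>n::nat. u n \<in> D" "(\<lambda>n. mdist (u n) x) \<longlonglongrightarrow> 0" by (auto simp: tends_iff_mdist)
    show ?L
    proof (intro allI impI)
      fix r :: real assume "0 < r"
      from order_tendstoD(2)[OF u(2) this] obtain n where "mdist (u n) x < r"
        by (auto simp: eventually_sequentially)
      then show "\<exists>y\<in>D. mdist x y < r" using u(1) by (metis mod.commute)
    qed
  qed
  then show ?thesis
    unfolding densely_defined_def eps_lambda_topology_eq mod.metric_closure_of by (simp add: set_eq_iff)
qed

text \<open>The graph becomes the equaliser of two continuous maps into a Hausdorff space. For a
  resolvent \<open>R\<close> at \<xi> the maps will be R \<xi> - 1 in the first coordinate and R in
  the second.\<close>

lemma closed_opI:
  assumes "hom U" "bnd U K" "K \<in> borel_measurable M" "hom V" "bnd V L" "L \<in> borel_measurable M"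
    and graph: "\<And>x y. (x \<in> D \<and> y = A x) \<longleftrightarrow> U x = V y"
  shows "closed_op M nrm A D"
proof -
  let ?T = "eps_lambda_topology M nrm"
  have "Hausdorff_space ?T" unfolding eps_lambda_topology_eq by (rule mod.Hausdorff_space_mtopology)
  moreover have "continuous_map (prod_topology ?T ?T) ?T (U \<circ> fst)" "continuous_map (prod_topology ?T ?T) ?T (V \<circ> snd)"
    using continuous_op assms by (blast intro: continuous_map_compose continuous_map_fst continuous_map_snd)+
  ultimately have "closedin (prod_topology ?T ?T) {z \<in> topspace (prod_topology ?T ?T). (U \<circ> fst) z = (V \<circ> snd) z}"
    by (rule closedin_continuous_maps_eq)
  moreover have "{z \<in> topspace (prod_topology ?T ?T). (U \<circ> fst) z = (V \<circ> snd) z} = {(x, A x) | x. x \<in> D}"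
    using graph[symmetric] by (auto simp: eps_lambda_topology_eq)
  ultimately show ?thesis by (simp add: closed_op_def)
qed

section \<open>Rescaling by random exponentials, which shifts the generator by a scalar\<close>

definition exp_scaled :: "('w \<Rightarrow> complex) \<Rightarrow> (real \<Rightarrow> 'a \<Rightarrow> 'a) \<Rightarrow> real \<Rightarrow> 'a \<Rightarrow> 'a" where
  "exp_scaled \<zeta> T t x = sm (\<lambda>\<omega>. exp (\<zeta> \<omega> * complex_of_real t)) (T t x)"

lemma exp_measurable:
  assumes [measurable]: "\<zeta> \<in> borel_measurable M"
  shows "(\<lambda>\<omega>. exp (\<zeta> \<omega> * complex_of_real t)) \<in> borel_measurable M"
  by measurable

lemma tends_exp_sm:
  assumes [measurable]: "\<zeta> \<in> borel_measurable M" and f: "tends (at_right 0) f l"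
  shows "tends (at_right 0) (\<lambda>t. sm (\<lambda>\<omega>. exp (\<zeta> \<omega> * complex_of_real t)) (f t)) l"
proof (rule tendsI)
  define K where "K \<omega> = cmod (\<zeta> \<omega>) * exp (cmod (\<zeta> \<omega>))" for \<omega>
  have K [measurable]: "K \<in> borel_measurable M" unfolding K_def by measurable
  have Kpos: "0 \<le> K \<omega>" for \<omega> by (simp add: K_def)
  show "cip M (at_right 0) (\<lambda>t \<omega>. (1 + K \<omega>) * nrm (f t - l) \<omega> + t * (K \<omega> * nrm l \<omega>))"
    using f unfolding tends_def by (intro cip_add cip_mult cip_scale) auto
  from eventually_at_right_01
  show "\<forall>\<^sub>F t in at_right 0. AE \<omega> in M. nrm (sm (\<lambda>\<omega>. exp (\<zeta> \<omega> * complex_of_real t)) (f t) - l) \<omega>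
      \<le> (1 + K \<omega>) * nrm (f t - l) \<omega> + t * (K \<omega> * nrm l \<omega>)"
  proof eventually_elim
    case (elim t)
    let ?E = "\<lambda>\<omega>. exp (\<zeta> \<omega> * complex_of_real t) - 1"
    have eq: "sm (\<lambda>\<omega>. exp (\<zeta> \<omega> * complex_of_real t)) (f t) - l = (f t - l) + sm ?E (f t)"
      using sm_diff_left[of "\<lambda>\<omega>. exp (\<zeta> \<omega> * complex_of_real t)" "\<lambda>_. 1" "f t"] by simp
    have "AE \<omega> in M. nrm (sm ?E (f t)) \<omega> = cmod (?E \<omega>) * nrm (f t) \<omega>"
      by (rule nrm_sm) measurable
    moreover have "AE \<omega> in M. nrm (f t) \<omega> \<le> nrm (f t - l) \<omega> + nrm l \<omega>"
      using nrm_triangle[of "f t - l" l] by simp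
    moreover note nrm_triangle[of "f t - l" "sm ?E (f t)"] nrm_nonneg[of "f t"] nrm_nonneg[of "f t - l"]
    ultimately
    have "AE \<omega> in M. nrm (f t - l + sm ?E (f t)) \<omega> \<le> (1 + K \<omega>) * nrm (f t - l) \<omega> + t * (K \<omega> * nrm l \<omega>)"
    proof eventually_elim
      fix \<omega>
      assume 1: "nrm (f t - l + sm ?E (f t)) \<omega> \<le> nrm (f t - l) \<omega> + nrm (sm ?E (f t)) \<omega>"
        and 2: "nrm (sm ?E (f t)) \<omega> = cmod (?E \<omega>) * nrm (f t) \<omega>"
        and 3: "nrm (f t) \<omega> \<le> nrm (f t - l) \<omega> + nrm l \<omega>"
        and 4: "0 \<le> nrm (f t) \<omega>" "0 \<le> nrm (f t - l) \<omega>"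
      have "cmod (?E \<omega>) * nrm (f t) \<omega> \<le> (t * K \<omega>) * nrm (f t) \<omega>"
        using elim 4 by (intro mult_right_mono) (auto simp: K_def intro!: cmod_exp_minus_1)
      also have "\<dots> \<le> (t * K \<omega>) * (nrm (f t - l) \<omega> + nrm l \<omega>)"
        using elim 3 Kpos by (intro mult_left_mono) auto
      also have "\<dots> = t * (K \<omega> * nrm (f t - l) \<omega>) + t * (K \<omega> * nrm l \<omega>)"
        by (simp add: algebra_simps)
      \<comment> \<open>The cross term is a product of two small quantities. Giving up the factor
        \<open>t\<close> leaves a coefficient independent of \<open>t\<close>, as
        \<open>cip_mult\<close> requires.\<close>
      also have "t * (K \<omega> * nrm (f t - l) \<omega>) \<le> 1 * (K \<omega> * nrm (f t - l) \<omega>)"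
        using elim 4 Kpos by (intro mult_right_mono) auto
      finally show "nrm (f t - l + sm ?E (f t)) \<omega> \<le> (1 + K \<omega>) * nrm (f t - l) \<omega> + t * (K \<omega> * nrm l \<omega>)"
        using 1 2 by (simp add: distrib_right)
    qed
    then show ?case unfolding eq .
  qed
  show "(\<lambda>\<omega>. (1 + K \<omega>) * nrm (f t - l) \<omega> + t * (K \<omega> * nrm l \<omega>)) \<in> borel_measurable M" for t
    by measurable
qed

text \<open>Product rule: the quotient of exp (\<zeta> t) T t at \<open>x\<close> is exp (\<zeta> t)
  times the quotient of \<open>T\<close> plus (exp (\<zeta> t) - 1) / t applied to \<open>x\<close>.
  With \<zeta> = - \<xi> the resolvent at \<xi> becomes an inverse of the generator up to sign; with
  \<zeta> = \<tau> the shift by \<tau> is undone.\<close>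

lemma gen_exp_scaled:
  assumes [measurable]: "\<zeta> \<in> borel_measurable M" and gen: "gen T x y"
  shows "gen (exp_scaled \<zeta> T) x (y + sm \<zeta> x)"
proof -
  let ?e = "\<lambda>t \<omega>. exp (\<zeta> \<omega> * complex_of_real t)"
  let ?q = "\<lambda>t \<omega>. (exp (\<zeta> \<omega> * complex_of_real t) - 1) / complex_of_real t"
  have 1: "tends (at_right 0) (\<lambda>t. sm (?e t) (rs (1 / t) (T t x - x))) y"
    using gen unfolding gen_def by (intro tends_exp_sm) auto
  have 2: "tends (at_right 0) (\<lambda>t. sm (?q t) x) (sm \<zeta> x)"
  proof (rule tendsI)
    show "cip M (at_right 0) (\<lambda>t \<omega>. t * ((cmod (\<zeta> \<omega>))\<^sup>2 * exp (cmod (\<zeta> \<omega>)) * nrm x \<omega>))"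
      by (rule cip_scale) auto
    from eventually_at_right_01 show "\<forall>\<^sub>F t in at_right 0. AE \<omega> in M. nrm (sm (?q t) x - sm \<zeta> x) \<omega>
        \<le> t * ((cmod (\<zeta> \<omega>))\<^sup>2 * exp (cmod (\<zeta> \<omega>)) * nrm x \<omega>)"
    proof eventually_elim
      case (elim t)
      have eq: "sm (?q t) x - sm \<zeta> x = sm (\<lambda>\<omega>. ?q t \<omega> - \<zeta> \<omega>) x"
        by (rule sm_diff_left[symmetric]) measurable
      have "AE \<omega> in M. nrm (sm (\<lambda>\<omega>. ?q t \<omega> - \<zeta> \<omega>) x) \<omega> = cmod (?q t \<omega> - \<zeta> \<omega>) * nrm x \<omega>"
        by (rule nrm_sm) measurable
      with nrm_nonneg[of x] show ?case unfolding eq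
      proof eventually_elim
        case (elim \<omega>)
        have "cmod (?q t \<omega> - \<zeta> \<omega>) * nrm x \<omega> \<le> (t * ((cmod (\<zeta> \<omega>))\<^sup>2 * exp (cmod (\<zeta> \<omega>)))) * nrm x \<omega>"
          using elim \<open>0 < t \<and> t \<le> 1\<close> by (intro mult_right_mono cmod_exp_quotient) auto
        with elim show ?case by (simp add: mult.assoc)
      qed
    qed
  qed auto
  have "tends (at_right 0) (\<lambda>t. sm (?e t) (rs (1 / t) (T t x - x)) + sm (?q t) x) (y + sm \<zeta> x)"
    by (rule tends_add[OF 1 2])
  moreover have "sm (?e t) (rs (1 / t) (T t x - x)) + sm (?q t) x = rs (1 / t) (exp_scaled \<zeta> T t x - x)" for t
  proof -
    have "sm (?q t) x = sm (\<lambda>\<omega>. complex_of_real (1 / t) * (?e t \<omega> - 1)) x"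
      by (simp add: field_simps)
    also have "\<dots> = rs (1 / t) (sm (\<lambda>\<omega>. ?e t \<omega> - 1) x)"
      by (rule sm_mult) measurable
    also have "sm (\<lambda>\<omega>. ?e t \<omega> - 1) x = sm (?e t) x - x"
      using sm_diff_left[of "?e t" "\<lambda>_. 1" x] by simp
    finally have q: "sm (?q t) x = rs (1 / t) (sm (?e t) x - x)" .
    have "sm (?e t) (rs (1 / t) (T t x - x)) = rs (1 / t) (sm (?e t) (T t x - x))"
      by (rule hom_sm[OF hom_sm_scalar]) measurable
    then show ?thesis unfolding q exp_scaled_def
      by (simp add: sm_add_right[symmetric] sm_diff_right)
  qed
  ultimately show ?thesis unfolding gen_def by simp
qed

lemma exp_scaled_inverse:
  assumes [measurable]: "\<zeta> \<in> borel_measurable M"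
  shows "exp_scaled \<zeta> (exp_scaled (\<lambda>\<omega>. - \<zeta> \<omega>) T) = T"
proof (intro ext)
  fix t x
  have "exp_scaled \<zeta> (exp_scaled (\<lambda>\<omega>. - \<zeta> \<omega>) T) t x
      = sm (\<lambda>\<omega>. exp (\<zeta> \<omega> * complex_of_real t) * exp (- \<zeta> \<omega> * complex_of_real t)) (T t x)"
    unfolding exp_scaled_def by (rule sm_mult[symmetric]) measurable
  also have "\<dots> = T t x" by (simp flip: exp_add)
  finally show "exp_scaled \<zeta> (exp_scaled (\<lambda>\<omega>. - \<zeta> \<omega>) T) t x = T t x" .
qed

lemma gen_exp_scaled_iff:
  assumes [measurable]: "\<zeta> \<in> borel_measurable M"
  shows "gen (exp_scaled \<zeta> T) x y \<longleftrightarrow> gen T x (y - sm \<zeta> x)"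
proof
  assume "gen T x (y - sm \<zeta> x)"
  from gen_exp_scaled[OF assms this] show "gen (exp_scaled \<zeta> T) x y" by simp
next
  assume "gen (exp_scaled \<zeta> T) x y"
  from gen_exp_scaled[OF _ this, of "\<lambda>\<omega>. - \<zeta> \<omega>"]
  have "gen (exp_scaled (\<lambda>\<omega>. - \<zeta> \<omega>) (exp_scaled \<zeta> T)) x (y - sm \<zeta> x)" by (simp add: sm_minus_left)
  then show "gen T x (y - sm \<zeta> x)" using exp_scaled_inverse[of "\<lambda>\<omega>. - \<zeta> \<omega>" T] by simp
qed

lemma exp_scaled_hom:
  assumes [measurable]: "\<zeta> \<in> borel_measurable M" and "hom (T t)"
  shows "hom (exp_scaled \<zeta> T t)"
  unfolding exp_scaled_def[abs_def]
  by (rule hom_comp[OF hom_sm_scalar[OF exp_measurable] assms(2)]) measurable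

lemma exp_scaled_add:
  assumes [measurable]: "\<zeta> \<in> borel_measurable M" and "hom (T s)" "T (s + t) x = T s (T t x)"
  shows "exp_scaled \<zeta> T (s + t) x = exp_scaled \<zeta> T s (exp_scaled \<zeta> T t x)"
proof -
  have "exp_scaled \<zeta> T (s + t) x
      = sm (\<lambda>\<omega>. exp (\<zeta> \<omega> * complex_of_real s) * exp (\<zeta> \<omega> * complex_of_real t)) (T s (T t x))"
    unfolding exp_scaled_def assms(3) by (simp add: distrib_left exp_add)
  also have "\<dots> = sm (\<lambda>\<omega>. exp (\<zeta> \<omega> * complex_of_real s)) (sm (\<lambda>\<omega>. exp (\<zeta> \<omega> * complex_of_real t)) (T s (T t x)))"
    by (rule sm_mult) measurable
  also have "\<dots> = exp_scaled \<zeta> T s (exp_scaled \<zeta> T t x)"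
    unfolding exp_scaled_def by (simp add: hom_sm[OF assms(2)])
  finally show ?thesis .
qed

lemma exp_scaled_bnd:
  assumes "\<zeta> \<in> borel_measurable M" "bnd (T t) K"
  shows "bnd (exp_scaled \<zeta> T t) (\<lambda>\<omega>. exp (Re (\<zeta> \<omega>) * t) * K \<omega>)"
  using bnd_comp[OF bnd_sm[OF exp_measurable[OF assms(1), of t]] assms(2)]
  by (simp add: exp_scaled_def[abs_def] norm_exp_eq_Re)

text \<open>Uniqueness of limits fuses the clause on the domain and the clause on the values into a
  single statement about the graph.\<close>

lemma generates_iff:
  "generates M sm nrm A D T \<longleftrightarrow> (\<forall>x y. gen T x y \<longleftrightarrow> x \<in> D \<and> y = A x)"
proof -
  have "y = z" if "gen T x y" "gen T x z" for x y z
    using that unfolding gen_def by (rule tends_unique[rotated]) simp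
  then show ?thesis unfolding generates_def limitin_iff_tends gen_def[symmetric] by blast
qed

end

locale complete_rn_module = rn_module M sm nrm
  for M :: "'w measure" and sm :: "('w \<Rightarrow> complex) \<Rightarrow> 'a::ab_group_add \<Rightarrow> 'a"
    and nrm :: "'a \<Rightarrow> 'w \<Rightarrow> real" +
  assumes complete: "RN_complete M nrm"
begin

text \<open>Quantifying over all selections \<open>m\<close> turns the double limit of the Cauchy condition into
  single limits.\<close>

lemma tends_exists:
  fixes x :: "nat \<Rightarrow> 'a"
  assumes "\<And>m. (\<And>n. n \<le> m n) \<Longrightarrow> tends sequentially (\<lambda>n. x n - x (m n)) 0"
  shows "\<exists>l. tends sequentially x l"
proof -
  have cauchy: "\<exists>N. \<forall>m\<ge>N. \<forall>n\<ge>N. mdist (x n) (x m) < r" if "0 < r" for r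
  proof -
    have "\<exists>N. \<forall>n\<ge>N. \<forall>m\<ge>n. mdist (x n) (x m) < r"
    proof (rule ccontr)
      assume "\<nexists>N. \<forall>n\<ge>N. \<forall>m\<ge>n. mdist (x n) (x m) < r"
      then have bad: "\<forall>N. \<exists>n\<ge>N. \<exists>m\<ge>n. r \<le> mdist (x n) (x m)" by (meson not_less)
      \<comment> \<open>\<open>m n\<close> is a partner far from \<open>n\<close> if one exists.
        Otherwise it is \<open>n\<close> itself, so that \<open>n \<le> m n\<close> holds for every
        \<open>n\<close> and the hypothesis applies.\<close>
      define m where "m n = (if \<exists>m\<ge>n. r \<le> mdist (x n) (x m) then SOME m. n \<le> m \<and> r \<le> mdist (x n) (x m) else n)" for n
      have ex: "n \<le> m n \<and> r \<le> mdist (x n) (x (m n))" if "\<exists>m\<ge>n. r \<le> mdist (x n) (x m)" for n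
        using someI_ex[of "\<lambda>m. n \<le> m \<and> r \<le> mdist (x n) (x m)"] that by (auto simp: m_def)
      have "n \<le> m n" for n using ex[of n] by (cases "\<exists>m\<ge>n. r \<le> mdist (x n) (x m)") (auto simp: m_def)
      from assms[OF this] have "(\<lambda>n. mdist (x n) (x (m n))) \<longlonglongrightarrow> 0"
        by (simp add: tends_iff_mdist mdist_def)
      from order_tendstoD(2)[OF this \<open>0 < r\<close>] obtain N where "\<forall>n\<ge>N. mdist (x n) (x (m n)) < r"
        by (auto simp: eventually_sequentially)
      with bad ex show False by (meson not_less)
    qed
    then obtain N where N: "\<And>n m. N \<le> n \<Longrightarrow> n \<le> m \<Longrightarrow> mdist (x n) (x m) < r" by blast
    then have "mdist (x n) (x m) < r" if "N \<le> n" "N \<le> m" for n m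
      using that N[of n m] N[of m n] mod.commute[of "x m" "x n"] by (cases "n \<le> m") auto
    then show ?thesis by blast
  qed
  have "\<forall>\<epsilon>>0. \<forall>lam. 0 < lam \<and> lam < 1 \<longrightarrow>
           (\<exists>N. \<forall>m\<ge>N. \<forall>n\<ge>N. x n - x m \<in> eps_lambda_nbhd M nrm \<epsilon> lam)"
  proof (intro allI impI)
    fix e lam :: real assume "0 < e" "0 < lam \<and> lam < 1"
    then obtain r where r: "0 < r" "mod.mball 0 r \<subseteq> {y. y - 0 \<in> eps_lambda_nbhd M nrm e lam}"
      using ball_subset_nbhd[of e lam 0] by auto
    have "x n - x m \<in> eps_lambda_nbhd M nrm e lam" if "mdist (x n) (x m) < r" for n m
    proof -
      have "x n - x m \<in> mod.mball 0 r"
        using that mod.commute[of 0 "x n - x m"] by (simp add: mdist_def)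
      then show ?thesis using r(2) by auto
    qed
    with cauchy[OF r(1)] show "\<exists>N. \<forall>m\<ge>N. \<forall>n\<ge>N. x n - x m \<in> eps_lambda_nbhd M nrm e lam" by meson
  qed
  then show ?thesis using complete unfolding RN_complete_def limitin_iff_tends by blast
qed

end

section \<open>Resolvents of exponentially stable semigroups\<close>

text \<open>The rate \<delta> is almost surely positive but need not be bounded away from 0, so
  \<open>S t\<close> decays for almost every \<omega> without any uniform rate.\<close>

locale stable_semigroup = complete_rn_module M sm nrm
  for M :: "'w measure" and sm :: "('w \<Rightarrow> complex) \<Rightarrow> 'a::ab_group_add \<Rightarrow> 'a"
    and nrm :: "'a \<Rightarrow> 'w \<Rightarrow> real" +
  fixes S :: "real \<Rightarrow> 'a \<Rightarrow> 'a" and Mb \<delta> :: "'w \<Rightarrow> real"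
  assumes Mb_measurable [measurable]: "Mb \<in> borel_measurable M"
    and \<delta>_measurable [measurable]: "\<delta> \<in> borel_measurable M"
    and Mb_ge_1: "AE \<omega> in M. 1 \<le> Mb \<omega>"
    and \<delta>_pos: "AE \<omega> in M. 0 < \<delta> \<omega>"
    and S_hom: "0 \<le> t \<Longrightarrow> hom (S t)"
    and S_zero: "S 0 x = x"
    and S_add: "0 \<le> s \<Longrightarrow> 0 \<le> t \<Longrightarrow> S (s + t) x = S s (S t x)"
    and S_bnd: "0 \<le> t \<Longrightarrow> bnd (S t) (\<lambda>\<omega>. Mb \<omega> * exp (- (\<delta> \<omega> * t)))"
    and S_cont: "tends (at_right 0) (\<lambda>t. S t x) x"
begin

section \<open>The equivalent norm and the bounds for inverses of the generator\<close>

lemma S_bnd_Mb: "0 \<le> t \<Longrightarrow> bnd (S t) Mb"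
proof (rule bnd_mono[OF S_bnd])
  assume "0 \<le> t"
  show "AE \<omega> in M. Mb \<omega> * exp (- (\<delta> \<omega> * t)) \<le> Mb \<omega>"
    using Mb_ge_1 \<delta>_pos
  proof eventually_elim
    case (elim \<omega>)
    then have "Mb \<omega> * exp (- (\<delta> \<omega> * t)) \<le> Mb \<omega> * 1"
      using \<open>0 \<le> t\<close> by (intro mult_left_mono) auto
    then show ?case by simp
  qed
qed

text \<open>Closed under addition, which \<open>N_S\<close> needs in order to shift the supremum,
  and containing the steps 1 / (n + 1) and 1 / 2 ^ n at which difference quotients will be
  taken.\<close>

definition rat_times :: "real set" where "rat_times = {q \<in> \<rat>. 0 \<le> q}"

lemma rat_times_nonneg: "q \<in> rat_times \<Longrightarrow> 0 \<le> q"
  by (simp add: rat_times_def)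

lemma zero_rat_times: "0 \<in> rat_times"
  by (simp add: rat_times_def)

lemma add_rat_times: "p \<in> rat_times \<Longrightarrow> q \<in> rat_times \<Longrightarrow> p + q \<in> rat_times"
  by (simp add: rat_times_def)

lemma countable_rat_times: "countable rat_times"
  unfolding rat_times_def by (rule countable_subset[OF _ countable_rat]) auto

text \<open>An equivalent norm in which \<open>S\<close> contracts like \<open>exp (- \<delta> t)\<close>; only countably many times
  enter the supremum, so that almost sure inequalities can be combined.\<close>

definition N :: "'a \<Rightarrow> 'w \<Rightarrow> real" where
  "N x \<omega> = (SUP q\<in>rat_times. exp (\<delta> \<omega> * q) * nrm (S q x) \<omega>)"

text \<open>Collects one null set for all rational times. Outside it the supremum defining
  \<open>N\<close> runs over a set bounded above, without which the real \<open>SUP\<close> would be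
  meaningless.\<close>

lemma AE_N_bdd:
  "AE \<omega> in M. \<forall>q\<in>rat_times. 0 \<le> nrm (S q x) \<omega> \<and> exp (\<delta> \<omega> * q) * nrm (S q x) \<omega> \<le> Mb \<omega> * nrm x \<omega>"
proof (subst AE_ball_countable[OF countable_rat_times], intro ballI)
  fix q assume q: "q \<in> rat_times"
  from nrm_nonneg[of "S q x"] bndD[OF S_bnd[OF rat_times_nonneg[OF q]], of x]
  show "AE \<omega> in M. 0 \<le> nrm (S q x) \<omega> \<and> exp (\<delta> \<omega> * q) * nrm (S q x) \<omega> \<le> Mb \<omega> * nrm x \<omega>"
  proof eventually_elim
    case (elim \<omega>)
    then have "exp (\<delta> \<omega> * q) * nrm (S q x) \<omega> \<le> exp (\<delta> \<omega> * q) * (Mb \<omega> * exp (- (\<delta> \<omega> * q)) * nrm x \<omega>)"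
      by (intro mult_left_mono) auto
    also have "\<dots> = Mb \<omega> * nrm x \<omega>" by (simp add: exp_minus)
    finally show ?case using elim by simp
  qed
qed

lemma bdd_above_N:
  assumes "\<forall>q\<in>rat_times. 0 \<le> nrm (S q x) \<omega> \<and> exp (\<delta> \<omega> * q) * nrm (S q x) \<omega> \<le> Mb \<omega> * nrm x \<omega>"
  shows "bdd_above ((\<lambda>q. exp (\<delta> \<omega> * q) * nrm (S q x) \<omega>) ` rat_times)"
  by (rule bdd_aboveI[of _ "Mb \<omega> * nrm x \<omega>"]) (use assms in auto)

lemma N_ge: "AE \<omega> in M. nrm x \<omega> \<le> N x \<omega>"
  using AE_N_bdd[of x]
proof eventually_elim
  case (elim \<omega>)
  from cSUP_upper[OF zero_rat_times bdd_above_N[OF elim]] show ?case by (simp add: N_def S_zero)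
qed

lemma N_nonneg: "AE \<omega> in M. 0 \<le> N x \<omega>"
  using N_ge[of x] nrm_nonneg[of x] by eventually_elim simp

lemma N_le: "AE \<omega> in M. N x \<omega> \<le> Mb \<omega> * nrm x \<omega>"
  using AE_N_bdd[of x]
proof eventually_elim
  case (elim \<omega>)
  show ?case unfolding N_def by (rule cSUP_least) (use elim zero_rat_times in auto)
qed

lemma N_triangle: "AE \<omega> in M. N (x + y) \<omega> \<le> N x \<omega> + N y \<omega>"
proof -
  have "AE \<omega> in M. \<forall>q\<in>rat_times. nrm (S q (x + y)) \<omega> \<le> nrm (S q x) \<omega> + nrm (S q y) \<omega>"
    by (subst AE_ball_countable[OF countable_rat_times])
      (auto simp: hom_add[OF S_hom[OF rat_times_nonneg]] intro: nrm_triangle)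
  with AE_N_bdd[of x] AE_N_bdd[of y] show ?thesis
  proof eventually_elim
    case (elim \<omega>)
    show ?case unfolding N_def[of "x + y"]
    proof (rule cSUP_least)
      show "rat_times \<noteq> {}" using zero_rat_times by blast
      fix q assume q: "q \<in> rat_times"
      have "exp (\<delta> \<omega> * q) * nrm (S q (x + y)) \<omega> \<le> exp (\<delta> \<omega> * q) * (nrm (S q x) \<omega> + nrm (S q y) \<omega>)"
        using elim(3) q by (intro mult_left_mono) auto
      also have "\<dots> \<le> N x \<omega> + N y \<omega>"
        unfolding distrib_left N_def
        by (intro add_mono cSUP_upper[OF q] bdd_above_N elim)
      finally show "exp (\<delta> \<omega> * q) * nrm (S q (x + y)) \<omega> \<le> N x \<omega> + N y \<omega>" .
    qed
  qed
qed

text \<open>Applying \<open>S h\<close> replaces the time \<open>q\<close> in the supremum by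
  \<open>q + h\<close>; the exponential weight then carries a surplus exp (\<delta> h), which can be
  taken out.\<close>

lemma N_S:
  assumes h: "h \<in> rat_times"
  shows "AE \<omega> in M. N (S h x) \<omega> \<le> exp (- (\<delta> \<omega> * h)) * N x \<omega>"
  using AE_N_bdd[of x]
proof eventually_elim
  case (elim \<omega>)
  show ?case unfolding N_def[of "S h x"]
  proof (rule cSUP_least)
    show "rat_times \<noteq> {}" using zero_rat_times by blast
    fix q assume q: "q \<in> rat_times"
    have "exp (\<delta> \<omega> * q) * nrm (S q (S h x)) \<omega>
        = exp (- (\<delta> \<omega> * h)) * (exp (\<delta> \<omega> * (q + h)) * nrm (S (q + h) x) \<omega>)"
      using S_add[OF rat_times_nonneg[OF q] rat_times_nonneg[OF h]]
      by (simp add: distrib_left exp_add exp_minus)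
    also have "\<dots> \<le> exp (- (\<delta> \<omega> * h)) * N x \<omega>"
      unfolding N_def
      by (intro mult_left_mono cSUP_upper[OF add_rat_times[OF q h]] bdd_above_N elim) auto
    finally show "exp (\<delta> \<omega> * q) * nrm (S q (S h x)) \<omega> \<le> exp (- (\<delta> \<omega> * h)) * N x \<omega>" .
  qed
qed

lemma N_rs: "AE \<omega> in M. N (rs c x) \<omega> \<le> \<bar>c\<bar> * N x \<omega>"
proof -
  have "AE \<omega> in M. \<forall>q\<in>rat_times. nrm (S q (rs c x)) \<omega> = \<bar>c\<bar> * nrm (S q x) \<omega>"
    by (subst AE_ball_countable[OF countable_rat_times])
      (auto simp: hom_sm[OF S_hom[OF rat_times_nonneg]] intro: nrm_rs)
  with AE_N_bdd[of x] show ?thesis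
  proof eventually_elim
    case (elim \<omega>)
    show ?case unfolding N_def[of "rs c x"]
    proof (rule cSUP_least)
      show "rat_times \<noteq> {}" using zero_rat_times by blast
      fix q assume q: "q \<in> rat_times"
      have "exp (\<delta> \<omega> * q) * nrm (S q (rs c x)) \<omega> = \<bar>c\<bar> * (exp (\<delta> \<omega> * q) * nrm (S q x) \<omega>)"
        using elim(2) q by simp
      also have "\<dots> \<le> \<bar>c\<bar> * N x \<omega>" unfolding N_def
        by (intro mult_left_mono cSUP_upper[OF q] bdd_above_N elim) auto
      finally show "exp (\<delta> \<omega> * q) * nrm (S q (rs c x)) \<omega> \<le> \<bar>c\<bar> * N x \<omega>" .
    qed
  qed
qed

text \<open>With \<open>z\<close> the difference quotient, x = S h x - h z, so N x \<le> exp (- u) N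
  x + h N z for u = \<delta> h. From exp (- u) \<le> 1 / (1 + u) one gets the factor h (1 + u) / u =
  1 / \<delta> + h. No differentiability of the orbit at \<open>x\<close> is involved, so the
  estimate also applies to differences of Riemann sums.\<close>

lemma N_le_difference_quotient:
  assumes h: "h \<in> rat_times" "0 < h"
  shows "AE \<omega> in M. N x \<omega> \<le> (1 / \<delta> \<omega> + h) * N (rs (1 / h) (S h x - x)) \<omega>"
proof -
  define z where "z = rs (1 / h) (S h x - x)"
  have "rs (- h) z = rs (- 1) (S h x - x)"
    unfolding z_def rs_mult using h by simp
  also have "\<dots> = x - S h x" by (simp add: sm_minus_left)
  finally have "rs (- h) z = x - S h x" .
  then have "x = rs (- h) z + S h x" by simp
  then have "AE \<omega> in M. N x \<omega> \<le> N (rs (- h) z) \<omega> + N (S h x) \<omega>"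
    using N_triangle[of "rs (- h) z" "S h x"] by simp
  with N_rs[of "- h" z] N_S[OF h(1), of x] \<delta>_pos N_nonneg[of x]
  have "AE \<omega> in M. N x \<omega> \<le> (1 / \<delta> \<omega> + h) * N z \<omega>"
  proof eventually_elim
    case (elim \<omega>)
    define u where "u = \<delta> \<omega> * h"
    have u: "0 < u" using elim h by (simp add: u_def)
    have "1 + u \<le> exp u" by (rule exp_ge_add_one_self)
    then have "exp (- u) \<le> 1 / (1 + u)" using u by (simp add: exp_minus divide_simps)
    then have "exp (- u) * N x \<omega> \<le> 1 / (1 + u) * N x \<omega>" using elim by (intro mult_right_mono) auto
    then have "N x \<omega> \<le> h * N z \<omega> + 1 / (1 + u) * N x \<omega>" using elim h by (simp add: u_def)
    then have "u * N x \<omega> \<le> (1 + u) * (h * N z \<omega>)" using u by (simp add: field_simps)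
    then have "h * (\<delta> \<omega> * N x \<omega>) \<le> h * ((1 + u) * N z \<omega>)" by (simp add: u_def ac_simps)
    then have "\<delta> \<omega> * N x \<omega> \<le> (1 + u) * N z \<omega>" using h by simp
    then show ?case using elim by (simp add: u_def field_simps)
  qed
  then show ?thesis by (simp add: z_def)
qed

text \<open>The limit h \<rightarrow> 0 of the previous estimate, taken along h = 1 / (n + 1) and a
  subsequence on which the quotients converge a.e.\<close>

lemma N_gen:
  assumes "gen S x y"
  shows "AE \<omega> in M. N x \<omega> \<le> N y \<omega> / \<delta> \<omega>"
proof -
  define h where "h n = 1 / real (Suc n)" for n
  define z where "z n = rs (1 / h n) (S (h n) x - x)" for n
  have h: "h n \<in> rat_times" "0 < h n" for n by (auto simp: h_def rat_times_def)
  have "tends sequentially z y"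
    unfolding z_def h_def
    by (rule tends_compose[OF assms[unfolded gen_def] inverse_Suc_at_right_0])
  then have "cip M sequentially (\<lambda>n. nrm (z n - y))" by (simp add: tends_def)
  then obtain r :: "nat \<Rightarrow> nat" where r: "strict_mono r" "AE \<omega> in M. (\<lambda>n. nrm (z (r n) - y) \<omega>) \<longlonglongrightarrow> 0"
    by (rule cip_subseq[rotated]) auto
  have "AE \<omega> in M. N x \<omega> \<le> (1 / \<delta> \<omega> + h n) * (N y \<omega> + Mb \<omega> * nrm (z n - y) \<omega>)" for n
    using N_le_difference_quotient[OF h(1)[of n] h(2)[of n], of x, folded z_def] N_triangle[of y "z n - y"] N_le[of "z n - y"] \<delta>_pos
  proof eventually_elim
    case (elim \<omega>)
    have "N (z n) \<omega> \<le> N y \<omega> + Mb \<omega> * nrm (z n - y) \<omega>" using elim by simp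
    then have "(1 / \<delta> \<omega> + h n) * N (z n) \<omega> \<le> (1 / \<delta> \<omega> + h n) * (N y \<omega> + Mb \<omega> * nrm (z n - y) \<omega>)"
      using elim h(2)[of n] by (intro mult_left_mono) auto
    with elim show ?case by linarith
  qed
  then have "AE \<omega> in M. \<forall>n. N x \<omega> \<le> (1 / \<delta> \<omega> + h n) * (N y \<omega> + Mb \<omega> * nrm (z n - y) \<omega>)"
    by (simp add: AE_all_countable)
  with r(2) show ?thesis
  proof eventually_elim
    case (elim \<omega>)
    have "(\<lambda>n. h (r n)) \<longlonglongrightarrow> 0"
      using LIMSEQ_subseq_LIMSEQ[OF LIMSEQ_Suc[OF lim_1_over_n[where 'a=real]] r(1)] by (simp add: h_def o_def)
    then have "(\<lambda>n. (1 / \<delta> \<omega> + h (r n)) * (N y \<omega> + Mb \<omega> * nrm (z (r n) - y) \<omega>))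
        \<longlonglongrightarrow> (1 / \<delta> \<omega> + 0) * (N y \<omega> + Mb \<omega> * 0)"
      by (intro tendsto_intros elim)
    then have "N x \<omega> \<le> (1 / \<delta> \<omega> + 0) * (N y \<omega> + Mb \<omega> * 0)"
      by (rule LIMSEQ_le_const) (use elim in auto)
    then show ?case by simp
  qed
qed

lemma gen_zero_imp_zero:
  assumes "gen S x 0"
  shows "x = 0"
proof (rule nrm_eq_0D)
  from N_gen[OF assms] N_le[of 0] nrm_zero N_ge[of x] nrm_nonneg[of x] \<delta>_pos N_nonneg[of 0]
  show "AE \<omega> in M. nrm x \<omega> = 0" by eventually_elim simp
qed

text \<open>This is what the renorming is for: in \<open>N\<close> each application of
  \<open>R\<close> costs exactly 1 / \<delta>, and \<open>Mb\<close> enters only once, in the final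
  comparison of \<open>N\<close> with \<open>nrm\<close>.\<close>

lemma nrm_iterated_inverse_le:
  fixes R :: "'a \<Rightarrow> 'a"
  assumes R: "\<And>y. gen S (R y) (- y)"
  shows "bnd (R ^^ n) (\<lambda>\<omega>. Mb \<omega> / \<delta> \<omega> ^ n)"
  unfolding bnd_def
proof
  fix y
  have neg: "AE \<omega> in M. N (- z) \<omega> \<le> N z \<omega>" for z
    using N_rs[of "- 1" z] by (simp add: sm_minus_left)
  have "AE \<omega> in M. N ((R ^^ n) y) \<omega> \<le> N y \<omega> / \<delta> \<omega> ^ n"
  proof (induction n)
    case (Suc n)
    from Suc.IH N_gen[OF R[of "(R ^^ n) y"]] neg[of "(R ^^ n) y"] \<delta>_pos
    show ?case
    proof eventually_elim
      case (elim \<omega>)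
      have "N (- (R ^^ n) y) \<omega> / \<delta> \<omega> \<le> N y \<omega> / \<delta> \<omega> ^ n / \<delta> \<omega>"
        using elim by (intro divide_right_mono) auto
      with elim show ?case by (simp add: mult.commute)
    qed
  qed simp
  with N_ge[of "(R ^^ n) y"] N_le[of y] \<delta>_pos
  show "AE \<omega> in M. nrm ((R ^^ n) y) \<omega> \<le> Mb \<omega> / \<delta> \<omega> ^ n * nrm y \<omega>"
  proof eventually_elim
    case (elim \<omega>)
    have "N y \<omega> / \<delta> \<omega> ^ n \<le> Mb \<omega> * nrm y \<omega> / \<delta> \<omega> ^ n"
      using elim by (intro divide_right_mono) auto
    with elim show ?case by simp
  qed
qed

section \<open>Averages and Riemann sums of orbits\<close>

lemma small_time:
  fixes y :: 'a
  assumes "0 < e"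
  obtains d where "0 < d" "\<And>s. 0 \<le> s \<Longrightarrow> s < d \<Longrightarrow> mdist (S s y) y < e"
proof -
  have "((\<lambda>t. mdist (S t y) y) \<longlongrightarrow> 0) (at_right 0)" using S_cont[of y] by (simp add: tends_iff_mdist)
  from order_tendstoD(2)[OF this assms]
  obtain d where "0 < d" "\<And>s. 0 < s \<Longrightarrow> s < d \<Longrightarrow> mdist (S s y) y < e"
    unfolding eventually_at_right_field by auto
  moreover have "mdist (S 0 y) y < e" using assms by (simp add: S_zero)
  ultimately show ?thesis by (intro that[of d]) (auto simp: less_le)
qed

lemma tends_S_zero:
  fixes s :: "nat \<Rightarrow> real"
  assumes "s \<longlonglongrightarrow> 0" "\<And>n. 0 \<le> s n"
  shows "tends sequentially (\<lambda>n. S (s n) y) y"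
  unfolding tends_iff_mdist
proof (rule tendstoI)
  fix e :: real assume "0 < e"
  then obtain d where d: "0 < d" "\<And>s. 0 \<le> s \<Longrightarrow> s < d \<Longrightarrow> mdist (S s y) y < e"
    using small_time[of e y] by blast
  from order_tendstoD(2)[OF assms(1) d(1)]
  show "\<forall>\<^sub>F n in sequentially. dist (mdist (S (s n) y) y) 0 < e"
    by eventually_elim (use d(2) assms(2) in simp)
qed

text \<open>The discrete counterpart of the mean (1/t) \<integral> S s y ds over [0, t].\<close>

definition avg :: "nat \<Rightarrow> (nat \<Rightarrow> real) \<Rightarrow> 'a \<Rightarrow> 'a" where
  "avg k s y = rs (1 / real k) (\<Sum>j<k. S (s j) y)"

lemma nrm_avg_diff:
  assumes "0 < k"
  shows "AE \<omega> in M. nrm (avg k s y - y) \<omega> \<le> (\<Sum>j<k. nrm (S (s j) y - y) \<omega>) / real k"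
proof -
  have "y = rs (1 / real k) (\<Sum>j<k. y)"
    using assms by (simp only: rs_of_nat[symmetric] rs_mult) simp
  then have "avg k s y - y = rs (1 / real k) (\<Sum>j<k. S (s j) y) - rs (1 / real k) (\<Sum>j<k. y)"
    unfolding avg_def by (rule arg_cong)
  also have "\<dots> = rs (1 / real k) (\<Sum>j<k. S (s j) y - y)"
    by (subst sm_diff_right[symmetric]) (simp_all add: sum_subtractf)
  finally have eq: "avg k s y - y = rs (1 / real k) (\<Sum>j<k. S (s j) y - y)" .
  from nrm_rs[of "1 / real k" "\<Sum>j<k. S (s j) y - y"] nrm_sum_le[of "\<lambda>j. S (s j) y - y" k]
  show ?thesis unfolding eq by eventually_elim (simp add: divide_right_mono)
qed

lemma nrm_avg_le:
  assumes "0 < k" "\<And>j. j < k \<Longrightarrow> 0 \<le> s j"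
  shows "AE \<omega> in M. nrm (avg k s y) \<omega> \<le> Mb \<omega> * nrm y \<omega>"
proof -
  have "AE \<omega> in M. \<forall>j\<in>{..<k}. nrm (S (s j) y) \<omega> \<le> Mb \<omega> * nrm y \<omega>"
    using assms(2) by (intro AE_finite_allI) (auto intro: bndD[OF S_bnd_Mb])
  with nrm_rs[of "1 / real k" "\<Sum>j<k. S (s j) y"] nrm_sum_le[of "\<lambda>j. S (s j) y" k]
  show ?thesis unfolding avg_def
  proof eventually_elim
    case (elim \<omega>)
    have "(\<Sum>j<k. nrm (S (s j) y) \<omega>) \<le> real k * (Mb \<omega> * nrm y \<omega>)"
      using sum_bounded_above[of "{..<k}" "\<lambda>j. nrm (S (s j) y) \<omega>" "Mb \<omega> * nrm y \<omega>"] elim(3) by simp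
    with elim(2) have "nrm (\<Sum>j<k. S (s j) y) \<omega> \<le> real k * (Mb \<omega> * nrm y \<omega>)" by linarith
    then have "1 / real k * nrm (\<Sum>j<k. S (s j) y) \<omega> \<le> Mb \<omega> * nrm y \<omega>"
      using assms(1) by (simp add: field_simps)
    with elim(1) show ?case by simp
  qed
qed

text \<open>Of the form 1 / (1 + G), where G = (1 + Mb) nrm y dominates
  \<open>nrm (S s y - y)\<close> for each s \<ge> 0, as \<open>integral_weighted_average_le\<close>
  demands. It depends on \<open>y\<close> only and is strictly positive, so it can be cancelled at
  the end.\<close>

definition weight :: "'a \<Rightarrow> 'w \<Rightarrow> real" where
  "weight y \<omega> = 1 / (1 + \<bar>(1 + Mb \<omega>) * nrm y \<omega>\<bar>)"

lemma weight_measurable [measurable]: "weight y \<in> borel_measurable M"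
  unfolding weight_def by measurable

lemma cip_weight_cancel:
  assumes "cip M F (\<lambda>i \<omega>. weight y \<omega> * g i \<omega>)" "\<And>i. g i \<in> borel_measurable M"
  shows "cip M F g"
proof -
  have eq: "(1 + \<bar>(1 + Mb \<omega>) * nrm y \<omega>\<bar>) * (weight y \<omega> * c) = c" for \<omega> c
  proof -
    have "1 + \<bar>(1 + Mb \<omega>) * nrm y \<omega>\<bar> \<noteq> 0" using abs_ge_zero[of "(1 + Mb \<omega>) * nrm y \<omega>"] by linarith
    then show ?thesis unfolding weight_def by (simp del: abs_mult)
  qed
  have "cip M F (\<lambda>i \<omega>. (1 + \<bar>(1 + Mb \<omega>) * nrm y \<omega>\<bar>) * (weight y \<omega> * g i \<omega>))"
    using assms(2) by (intro cip_mult[OF assms(1)]) auto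
  then show ?thesis by (simp only: eq)
qed

lemma dp_weight_avg_le:
  assumes "0 < k" "\<And>j. j < k \<Longrightarrow> 0 \<le> s j" "\<And>j. j < k \<Longrightarrow> mdist (S (s j) y) y \<le> e"
  shows "dp M (\<lambda>\<omega>. weight y \<omega> * nrm (avg k s y - y) \<omega>) \<le> e"
proof -
  have "dp M (\<lambda>\<omega>. weight y \<omega> * nrm (avg k s y - y) \<omega>)
      \<le> dp M (\<lambda>\<omega>. weight y \<omega> * ((\<Sum>j<k. nrm (S (s j) y - y) \<omega>) / real k))"
  proof (rule dp_mono)
    from nrm_avg_diff[OF assms(1), of s y] nrm_nonneg[of "avg k s y - y"]
    show "AE \<omega> in M. \<bar>weight y \<omega> * nrm (avg k s y - y) \<omega>\<bar>
        \<le> \<bar>weight y \<omega> * ((\<Sum>j<k. nrm (S (s j) y - y) \<omega>) / real k)\<bar>"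
      by eventually_elim (unfold abs_mult, intro mult_left_mono, linarith, simp)
  qed auto
  also have "\<dots> \<le> e"
    unfolding weight_def
  proof (rule integral_weighted_average_le)
    fix j assume j: "j < k"
    show "dp M (nrm (S (s j) y - y)) \<le> e" using assms(3)[OF j] by (simp add: mdist_def)
    from nrm_nonneg[of "S (s j) y - y"] nrm_diff_le[of "S (s j) y" y] bndD[OF S_bnd_Mb[OF assms(2)[OF j]], of y]
    show "AE \<omega> in M. 0 \<le> nrm (S (s j) y - y) \<omega> \<and> nrm (S (s j) y - y) \<omega> \<le> (1 + Mb \<omega>) * nrm y \<omega>"
      by eventually_elim (simp add: distrib_right)
  qed (use assms(1) in auto)
  finally show ?thesis .
qed

text \<open>The number \<open>k n\<close> of terms may grow arbitrarily while the times shrink to 0;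
  the weighted bound does not see the number of terms.\<close>

lemma tends_avg:
  fixes k :: "nat \<Rightarrow> nat"
  assumes "\<And>n. 0 < k n" "\<And>n j. j < k n \<Longrightarrow> 0 \<le> s n j \<and> s n j \<le> t n" "t \<longlonglongrightarrow> 0"
  shows "tends sequentially (\<lambda>n. avg (k n) (s n) y) y"
  unfolding tends_def
proof (rule cip_weight_cancel[of _ y], unfold cip_def, rule tendstoI)
  fix e :: real assume "0 < e"
  then have "0 < e/2" by simp
  then obtain d where d: "0 < d" "\<And>s. 0 \<le> s \<Longrightarrow> s < d \<Longrightarrow> mdist (S s y) y < e/2"
    using small_time[of "e/2" y] by blast
  from order_tendstoD(2)[OF assms(3) d(1)]
  show "\<forall>\<^sub>F n in sequentially. dist (dp M (\<lambda>\<omega>. weight y \<omega> * nrm (avg (k n) (s n) y - y) \<omega>)) 0 < e"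
  proof eventually_elim
    case (elim n)
    have "dp M (\<lambda>\<omega>. weight y \<omega> * nrm (avg (k n) (s n) y - y) \<omega>) \<le> e/2"
    proof (rule dp_weight_avg_le[OF assms(1)])
      fix j assume "j < k n"
      from assms(2)[OF this] elim d(2)[of "s n j"] show "0 \<le> s n j" "mdist (S (s n j) y) y \<le> e/2" by auto
    qed
    with \<open>0 < e\<close> dp_nonneg show ?case by simp
  qed
qed auto

text \<open>Splitting the sum over all indices below k + K at \<open>k\<close> or at
  \<open>K\<close> gives the same total. This avoids a case distinction on which of the two is
  larger.\<close>

lemma sum_shift_commute:
  fixes a :: "nat \<Rightarrow> 'a"
  shows "(\<Sum>j<K. a j) - (\<Sum>j<K. a (j + k)) = (\<Sum>j<k. a j - a (j + K))"
proof -
  have shift: "(\<Sum>j<p. a j) + (\<Sum>j<q. a (j + p)) = (\<Sum>j<p+q. a j)" for p q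
    by (induction q) (simp_all add: add.assoc[symmetric] add.commute)
  have "(\<Sum>j<K. a j) + (\<Sum>j<k. a (j + K)) = (\<Sum>j<k. a j) + (\<Sum>j<K. a (j + k))"
    unfolding shift by (simp add: add.commute)
  then show ?thesis by (simp add: sum_subtractf algebra_simps)
qed

text \<open>Discrete form of (1 - S t) \<integral> S s y ds over [0, L] = \<integral> S s (y - S L
  y) ds over [0, t], with t = k h and L = K h: the long interval is traded for a short one.\<close>

lemma riemann_sum_difference:
  assumes "0 \<le> h" "0 < k"
  shows "(\<Sum>j<K. S (real j * h) y) - S (real k * h) (\<Sum>j<K. S (real j * h) y)
      = rs (real k) (avg k (\<lambda>j. real j * h) (y - S (real K * h) y))"
proof -
  have S: "S (real j * h) (S (real i * h) x) = S (real (j + i) * h) x" for i j x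
    using S_add[of "real j * h" "real i * h" x] assms(1) by (simp add: distrib_right)
  have hom: "hom (S (real j * h))" for j using assms(1) by (intro S_hom) simp
  have "(\<Sum>j<K. S (real j * h) y) - S (real k * h) (\<Sum>j<K. S (real j * h) y)
      = (\<Sum>j<K. S (real j * h) y) - (\<Sum>j<K. S (real (j + k) * h) y)"
    by (simp only: hom_sum[OF hom] S add.commute[of k])
  also have "\<dots> = (\<Sum>j<k. S (real j * h) y - S (real (j + K) * h) y)"
    by (rule sum_shift_commute)
  also have "\<dots> = (\<Sum>j<k. S (real j * h) (y - S (real K * h) y))"
    by (simp only: hom_diff[OF hom] S)
  also have "\<dots> = rs (real k) (avg k (\<lambda>j. real j * h) (y - S (real K * h) y))"
    using assms(2) unfolding avg_def rs_mult by simp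
  finally show ?thesis .
qed

lemma avg_diff: "(\<And>j. j < k \<Longrightarrow> 0 \<le> s j) \<Longrightarrow> avg k s (x - y) = avg k s x - avg k s y"
  by (simp add: avg_def sm_diff_right[symmetric] sum_subtractf[symmetric] hom_diff[OF S_hom])

text \<open>As \<delta> is random, the convergence is only pointwise; the truncation in
  \<open>dp\<close> supplies the integrable majorant that turns it into convergence in
  probability.\<close>

lemma cip_exp_decay:
  assumes [measurable]: "g \<in> borel_measurable M"
  shows "cip M sequentially (\<lambda>n \<omega>. exp (- (\<delta> \<omega> * real n)) * g \<omega>)"
proof (rule cip_AE)
  show "AE \<omega> in M. (\<lambda>n. exp (- (\<delta> \<omega> * real n)) * g \<omega>) \<longlonglongrightarrow> 0"
    using \<delta>_pos
  proof eventually_elim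
    case (elim \<omega>)
    have "filterlim (\<lambda>n. real n * \<delta> \<omega>) at_top sequentially"
      using elim by (intro filterlim_at_top_mult_tendsto_pos[OF tendsto_const] filterlim_real_sequentially) auto
    then have "(\<lambda>n. exp (- (\<delta> \<omega> * real n))) \<longlonglongrightarrow> 0"
      by (auto intro!: filterlim_compose[OF exp_at_bot] simp: filterlim_uminus_at_bot mult.commute)
    then show ?case by (rule tendsto_mult_left_zero)
  qed
qed auto

lemma tends_S_infinity: "tends sequentially (\<lambda>n. S (real n) y) 0"
proof (rule tendsI[OF cip_exp_decay[of "\<lambda>\<omega>. Mb \<omega> * nrm y \<omega>"]])
  show "\<forall>\<^sub>F n in sequentially. AE \<omega> in M. nrm (S (real n) y - 0) \<omega> \<le> exp (- (\<delta> \<omega> * real n)) * (Mb \<omega> * nrm y \<omega>)"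
    using bndD[OF S_bnd, of _ y] by (intro always_eventually[of _ sequentially] allI) (simp add: ac_simps)
qed auto

text \<open>Mesh 1 / 2 ^ n on the interval [0, n]. The meshes are nested, so a step of mesh
  \<open>n\<close> is a whole number of steps of every finer mesh and
  \<open>riemann_difference\<close> applies to both sums with the same shift.\<close>

definition riemann :: "'a \<Rightarrow> nat \<Rightarrow> 'a" where
  "riemann y n = rs (1 / 2 ^ n) (\<Sum>j<n * 2 ^ n. S (real j * (1 / 2 ^ n)) y)"

lemma riemann_difference:
  assumes "0 < k"
  shows "riemann y n - S (real k / 2 ^ n) (riemann y n)
    = rs (real k / 2 ^ n) (avg k (\<lambda>j. real j / 2 ^ n) (y - S (real n) y))"
proof -
  have "hom (S (real k / 2 ^ n))" by (intro S_hom) simp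
  then have "riemann y n - S (real k / 2 ^ n) (riemann y n) = rs (1 / 2 ^ n)
     ((\<Sum>j<n * 2 ^ n. S (real j * (1 / 2 ^ n)) y) - S (real k * (1 / 2 ^ n)) (\<Sum>j<n * 2 ^ n. S (real j * (1 / 2 ^ n)) y))"
    by (simp add: riemann_def sm_diff_right hom_sm)
  also have "\<dots> = rs (1 / 2 ^ n) (rs (real k) (avg k (\<lambda>j. real j * (1 / 2 ^ n)) (y - S (real (n * 2 ^ n) * (1 / 2 ^ n)) y)))"
    using assms by (subst riemann_sum_difference) auto
  also have "\<dots> = rs (real k / 2 ^ n) (avg k (\<lambda>j. real j / 2 ^ n) (y - S (real n) y))"
    unfolding rs_mult by (simp add: mult.commute)
  finally show ?thesis .
qed

text \<open>Two Riemann sums are never compared term by term. The difference quotient with step 1 /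
  2 ^ n of their difference telescopes to a quantity tending to 0, and
  \<open>N_le_difference_quotient\<close> carries this back to the difference itself.\<close>

lemma riemann_convergent: "\<exists>x. tends sequentially (riemann y) x"
proof (rule tends_exists)
  fix m :: "nat \<Rightarrow> nat" assume m: "\<And>n. n \<le> m n"
  \<comment> \<open>The number of steps of mesh \<open>m n\<close> that make up one step of mesh
    \<open>n\<close>.\<close>
  define k where "k n = (2::nat) ^ (m n - n)" for n
  define s where "s n j = real j / 2 ^ m n" for n j
  have k: "0 < k n" for n by (simp add: k_def)
  have kn: "real (k n) / 2 ^ m n = 1 / 2 ^ n" for n
    using m[of n] power_add[of "2::real" n "m n - n"] by (simp add: k_def)
  have s: "0 \<le> s n j \<and> s n j \<le> 1 / 2 ^ n" if "j < k n" for n j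
    using that kn[of n] divide_right_mono[of "real j" "real (k n)" "2 ^ m n"] by (simp add: s_def)
  have lim0: "(\<lambda>n. 1 / 2 ^ n :: real) \<longlonglongrightarrow> 0"
    using LIMSEQ_realpow_zero[of "1/2"] by (simp add: power_divide)
  \<comment> \<open>Minus the difference quotient of the difference of the two sums: an average near
    time 0 subtracted from \<open>y\<close>, and two contributions from the far ends
    \<open>n\<close> and \<open>m n\<close> of the intervals.\<close>
  define B where "B n = (y - avg (k n) (s n) y) - S (real n) y + avg (k n) (s n) (S (real (m n)) y)" for n
  have quotient: "rs (1 / (1 / 2 ^ n)) (S (1 / 2 ^ n) (riemann y n - riemann y (m n)) - (riemann y n - riemann y (m n))) = - B n" for n
  proof -
    have "avg 1 (\<lambda>j. real j / 2 ^ n) (y - S (real n) y) = y - S (real n) y"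
      by (simp add: avg_def S_zero)
    then have 1: "riemann y n - S (1 / 2 ^ n) (riemann y n) = rs (1 / 2 ^ n) (y - S (real n) y)"
      using riemann_difference[of 1 y n] by simp
    have 2: "riemann y (m n) - S (1 / 2 ^ n) (riemann y (m n))
        = rs (1 / 2 ^ n) (avg (k n) (s n) y - avg (k n) (s n) (S (real (m n)) y))"
      using riemann_difference[OF k[of n], of y "m n"] s
      unfolding kn by (subst avg_diff[symmetric]) (auto simp: s_def[abs_def])
    have "hom (S (1 / 2 ^ n))" by (intro S_hom) simp
    then have "S (1 / 2 ^ n) (riemann y n - riemann y (m n)) - (riemann y n - riemann y (m n))
        = (riemann y (m n) - S (1 / 2 ^ n) (riemann y (m n))) - (riemann y n - S (1 / 2 ^ n) (riemann y n))"
      by (simp add: hom_diff)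
    also have "\<dots> = rs (1 / 2 ^ n) (- B n)"
      unfolding 1 2 by (subst sm_diff_right[symmetric]) (simp_all add: B_def algebra_simps)
    finally show ?thesis by (simp only: rs_mult) simp
  qed
  have "tends sequentially B (y - y - 0 + 0)"
    unfolding B_def
  proof (intro tends_add tends_diff tends_const tends_S_infinity)
    show "tends sequentially (\<lambda>n. avg (k n) (s n) y) y"
      by (rule tends_avg[OF k s lim0])
    have "filterlim m at_top sequentially"
      by (rule filterlim_at_top_mono[OF filterlim_ident]) (use m in auto)
    from tends_compose[OF tends_S_infinity this]
    have "tends sequentially (\<lambda>n. S (real (m n)) y) 0" .
    then show "tends sequentially (\<lambda>n. avg (k n) (s n) (S (real (m n)) y)) 0"
      by (rule tends_bounded_family[OF _ Mb_measurable])
        (intro always_eventually[of _ sequentially] allI nrm_avg_le k, use s in blast)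
  qed
  then have "tends sequentially B 0" by simp
  then show "tends sequentially (\<lambda>n. riemann y n - riemann y (m n)) 0"
  proof (rule tends_bounded_family)
    show "(\<lambda>\<omega>. (1 / \<delta> \<omega> + 1) * Mb \<omega>) \<in> borel_measurable M" by measurable
    have "AE \<omega> in M. nrm (riemann y n - riemann y (m n)) \<omega> \<le> ((1 / \<delta> \<omega> + 1) * Mb \<omega>) * nrm (B n) \<omega>" for n
    proof -
      have h: "1 / 2 ^ n \<in> rat_times" "0 < 1 / (2 ^ n :: real)" by (auto simp: rat_times_def)
      from N_le_difference_quotient[OF h, of "riemann y n - riemann y (m n)", unfolded quotient]
        N_ge[of "riemann y n - riemann y (m n)"] N_le[of "- B n"] nrm_minus[of "B n"] N_nonneg[of "- B n"] \<delta>_pos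
      show ?thesis
      proof eventually_elim
        case (elim \<omega>)
        have "(1 / \<delta> \<omega> + 1 / 2 ^ n) * N (- B n) \<omega> \<le> (1 / \<delta> \<omega> + 1) * N (- B n) \<omega>"
          using elim by (intro mult_right_mono add_left_mono) auto
        also have "\<dots> \<le> (1 / \<delta> \<omega> + 1) * (Mb \<omega> * nrm (B n) \<omega>)"
          using elim by (intro mult_left_mono) auto
        finally show ?case using elim by (simp add: mult.assoc)
      qed
    qed
    then show "\<forall>\<^sub>F n in sequentially. AE \<omega> in M. nrm (riemann y n - riemann y (m n)) \<omega>
        \<le> ((1 / \<delta> \<omega> + 1) * Mb \<omega>) * nrm (B n) \<omega>"
      by (intro always_eventually[of _ sequentially] allI)
  qed
qed

text \<open>The limit \<open>x\<close> of the Riemann sums plays the role of \<integral> S s y ds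
  over [0, \<infinity>). For fixed \<open>t\<close>, the quotient (x - S t x) / t is the limit of
  averages of \<open>y\<close> over [0, t], and these are close to \<open>y\<close> for small
  \<open>t\<close>.\<close>

lemma ex_gen: "\<exists>x. gen S x (- y)"
proof -
  obtain x where x: "tends sequentially (riemann y) x" using riemann_convergent by blast
  define P where "P t = rs (1 / t) (x - S t x)" for t
  \<comment> \<open>An estimate at a fixed \<open>t\<close> comes first, by n \<rightarrow>
    \<infinity>; t \<rightarrow> 0 is taken afterwards. The range up to 2 t leaves room for rounding
    \<open>t\<close> to the mesh.\<close>
  have bound: "dp M (\<lambda>\<omega>. weight y \<omega> * nrm (P t - y) \<omega>) \<le> e"
    if t: "0 < t" and e: "\<And>s. 0 \<le> s \<Longrightarrow> s \<le> 2 * t \<Longrightarrow> mdist (S s y) y \<le> e" for t e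
  proof -
    \<comment> \<open>Rounding up gives t' n \<ge> t, so S (t' n) factors as S t after S (t' n - t).
      Continuity at 0 then suffices to replace t' n by \<open>t\<close>.\<close>
    define k where "k n = nat \<lceil>t * 2 ^ n\<rceil>" for n
    define t' where "t' n = real (k n) / 2 ^ n" for n
    define s where "s n j = real j / 2 ^ n" for n j :: nat
    define A where "A n = avg (k n) (s n) y" for n
    define L where "L n = A n - avg (k n) (s n) (S (real n) y)" for n
    have k: "0 < k n" for n using t by (simp add: k_def)
    have kr: "t * 2 ^ n \<le> real (k n)" "real (k n) \<le> t * 2 ^ n + 1" for n
      using t by (auto simp: k_def of_nat_nat)
    have t': "t \<le> t' n" "t' n \<le> t + 1 / 2 ^ n" for n
      using kr[of n] by (auto simp: t'_def field_simps)
    have s: "0 \<le> s n j" "s n j \<le> t' n" if "j < k n" for n j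
      using that by (auto simp: s_def t'_def divide_right_mono)
    have lim0: "(\<lambda>n. 1 / 2 ^ n :: real) \<longlonglongrightarrow> 0"
      using LIMSEQ_realpow_zero[of "1/2"] by (simp add: power_divide)
    have t'_lim: "t' \<longlonglongrightarrow> t"
    proof (rule tendsto_sandwich[of "\<lambda>_. t" _ _ "\<lambda>n. t + 1 / 2 ^ n"])
      show "(\<lambda>n. t + 1 / 2 ^ n) \<longlonglongrightarrow> t" using tendsto_add[OF tendsto_const[of t] lim0] by simp
    qed (use t' in auto)
    have Leq: "rs (1 / t' n) (riemann y n - S (t' n) (riemann y n)) = L n" for n
    proof -
      have "0 < t' n" using t t'(1)[of n] by linarith
      moreover have "riemann y n - S (t' n) (riemann y n) = rs (t' n) (L n)"
        using riemann_difference[OF k[of n], of y n] s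
        unfolding L_def A_def by (subst avg_diff[symmetric]) (auto simp: s_def[abs_def] t'_def)
      ultimately show ?thesis by (simp only: rs_mult) simp
    qed
    have "tends sequentially (\<lambda>n. S (t' n) (riemann y n)) (S t x)"
    proof -
      have 1: "tends sequentially (\<lambda>n. S (t' n) (riemann y n - x)) 0"
        using x[THEN tends_zero_iff[THEN iffD2]]
      proof (rule tends_bounded_family[OF _ Mb_measurable])
        show "\<forall>\<^sub>F n in sequentially. AE \<omega> in M. nrm (S (t' n) (riemann y n - x)) \<omega> \<le> Mb \<omega> * nrm (riemann y n - x) \<omega>"
          by (intro always_eventually[of _ sequentially] allI bndD[OF S_bnd_Mb]) (use t t' in \<open>meson less_imp_le order_trans\<close>)
      qed
      have "(\<lambda>n. t' n - t) \<longlonglongrightarrow> 0" using tendsto_diff[OF t'_lim tendsto_const[of t]] by simp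
      then have "tends sequentially (\<lambda>n. S (t' n - t) x) x"
        by (rule tends_S_zero) (use t' in simp)
      then have "tends sequentially (\<lambda>n. S t (S (t' n - t) x)) (S t x)"
        by (rule tends_op[OF _ S_bnd_Mb S_hom Mb_measurable]) (use t in auto)
      moreover have "S t (S (t' n - t) x) = S (t' n) x" for n
        using S_add[of t "t' n - t" x] t t'(1)[of n] by simp
      ultimately have "tends sequentially (\<lambda>n. S (t' n) x) (S t x)" by simp
      from tends_add[OF 1 this] have "tends sequentially (\<lambda>n. S (t' n) (riemann y n - x) + S (t' n) x) (S t x)" by simp
      moreover have "S (t' n) (riemann y n - x) + S (t' n) x = S (t' n) (riemann y n)" for n
        using t t'(1)[of n] by (subst hom_add[symmetric]) (auto intro: S_hom)
      ultimately show ?thesis by simp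
    qed
    then have "tends sequentially (\<lambda>n. rs (1 / t' n) (riemann y n - S (t' n) (riemann y n))) (P t)"
      unfolding P_def using t by (intro tends_rs tends_diff x tendsto_intros t'_lim) auto
    then have "tends sequentially L (P t)" by (simp only: Leq)
    then have 1: "tends sequentially (\<lambda>n. L n - P t) 0" by (simp add: tends_zero_iff)
    have 2: "tends sequentially (\<lambda>n. A n - L n) 0"
      by (rule tends_bounded_family[OF tends_S_infinity[of y] Mb_measurable])
        (intro always_eventually[of _ sequentially] allI, simp add: L_def, intro nrm_avg_le k s(1))
    from tends_add[OF 1 2] have "tends sequentially (\<lambda>n. A n - P t) 0" by simp
    then have "cip M sequentially (\<lambda>n. nrm (A n - P t))" by (simp add: tends_def)
    then have "cip M sequentially (\<lambda>n \<omega>. weight y \<omega> * nrm (A n - P t) \<omega>)"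
      by (rule cip_mult) auto
    then have lim: "(\<lambda>n. dp M (\<lambda>\<omega>. weight y \<omega> * nrm (A n - P t) \<omega>) + e) \<longlonglongrightarrow> 0 + e"
      unfolding cip_def by (intro tendsto_intros)
    have "\<forall>\<^sub>F n in sequentially. t' n < 2 * t" using t by (intro order_tendstoD(2)[OF t'_lim]) simp
    then have "\<forall>\<^sub>F n in sequentially. dp M (\<lambda>\<omega>. weight y \<omega> * nrm (P t - y) \<omega>)
        \<le> dp M (\<lambda>\<omega>. weight y \<omega> * nrm (A n - P t) \<omega>) + e"
    proof eventually_elim
      case (elim n)
      have "dp M (\<lambda>\<omega>. weight y \<omega> * nrm (P t - y) \<omega>)
          \<le> dp M (\<lambda>\<omega>. weight y \<omega> * nrm (A n - P t) \<omega>) + dp M (\<lambda>\<omega>. weight y \<omega> * nrm (A n - y) \<omega>)"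
      proof (rule dp_triangle)
        from nrm_diff_triangle[of "P t" y "A n"] nrm_commute[of "P t" "A n"] nrm_nonneg[of "P t - y"]
        show "AE \<omega> in M. \<bar>weight y \<omega> * nrm (P t - y) \<omega>\<bar>
            \<le> \<bar>weight y \<omega> * nrm (A n - P t) \<omega>\<bar> + \<bar>weight y \<omega> * nrm (A n - y) \<omega>\<bar>"
        proof eventually_elim
          case (elim \<omega>)
          then have "\<bar>nrm (P t - y) \<omega>\<bar> \<le> \<bar>nrm (A n - P t) \<omega>\<bar> + \<bar>nrm (A n - y) \<omega>\<bar>" by linarith
          then show ?case unfolding abs_mult distrib_left[symmetric] by (rule mult_left_mono) simp
        qed
      qed auto
      moreover have "dp M (\<lambda>\<omega>. weight y \<omega> * nrm (A n - y) \<omega>) \<le> e"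
        unfolding A_def
      proof (intro dp_weight_avg_le[OF k] e)
        fix j assume "j < k n"
        from s[OF this] elim show "0 \<le> s n j" "0 \<le> s n j" "s n j \<le> 2 * t" by auto
      qed
      ultimately show ?case by simp
    qed
    then show ?thesis by (rule tendsto_lowerbound[OF lim, simplified])
  qed
  have "cip M (at_right 0) (\<lambda>t \<omega>. weight y \<omega> * nrm (P t - y) \<omega>)"
    unfolding cip_def
  proof (rule tendstoI)
    fix e :: real assume "0 < e"
    then have "0 < e/2" by simp
    then obtain d where d: "0 < d" "\<And>s. 0 \<le> s \<Longrightarrow> s < d \<Longrightarrow> mdist (S s y) y < e/2"
    using small_time[of "e/2" y] by blast
    have "\<forall>\<^sub>F t in at_right 0. t < d/2" "\<forall>\<^sub>F t in at_right 0. 0 < (t::real)"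
      using d(1) by (auto simp: eventually_at_right_field intro: exI[of _ "d/2"] gt_ex)
    then show "\<forall>\<^sub>F t in at_right 0. dist (dp M (\<lambda>\<omega>. weight y \<omega> * nrm (P t - y) \<omega>)) 0 < e"
    proof eventually_elim
      case (elim t)
      have "dp M (\<lambda>\<omega>. weight y \<omega> * nrm (P t - y) \<omega>) \<le> e/2"
        using elim by (intro bound less_imp_le[OF d(2)]) linarith+
      with \<open>0 < e\<close> dp_nonneg show ?case by simp
    qed
  qed
  then have "tends (at_right 0) P y" unfolding tends_def by (rule cip_weight_cancel) auto
  from tends_minus[OF this] have "gen S x (- y)"
    unfolding gen_def P_def by (simp add: sm_minus_right[symmetric])
  then show ?thesis ..
qed

section \<open>Density of the domain of the generator\<close>

lemma gen_S:
  assumes "gen S x y" "0 \<le> t"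
  shows "gen S (S t x) (S t y)"
proof -
  have "tends (at_right 0) (\<lambda>s. S t (rs (1 / s) (S s x - x))) (S t y)"
    by (rule tends_op[OF assms(1)[unfolded gen_def] S_bnd_Mb S_hom Mb_measurable]) (use assms in auto)
  moreover have "\<forall>\<^sub>F s in at_right 0. S t (rs (1 / s) (S s x - x)) = rs (1 / s) (S s (S t x) - S t x)"
  proof -
    have "\<forall>\<^sub>F s in at_right 0. 0 < (s::real)" by (simp add: eventually_at_right_less)
    then show ?thesis
    proof eventually_elim
      case (elim s)
      have "S t (S s x) = S s (S t x)" using S_add[of t s x] S_add[of s t x] elim assms(2) by (simp add: add.commute)
      then show ?case using S_hom[OF assms(2)] by (simp add: hom_sm hom_diff)
    qed
  qed
  ultimately show ?thesis unfolding gen_def by (simp add: tends_cong)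
qed

text \<open>By \<open>ex_gen\<close>, - x is the generator applied to some \<open>z\<close>. The
  negated difference quotients of the orbit of \<open>z\<close> converge to \<open>x\<close>, and
  each is a combination of \<open>z\<close> and S h z, both of which lie in the domain.\<close>

lemma gen_domain_dense: "\<exists>u. (\<forall>n::nat. \<exists>y. gen S (u n) y) \<and> tends sequentially u x"
proof -
  obtain z where z: "gen S z (- x)" using ex_gen by blast
  define h where "h n = 1 / real (Suc n)" for n
  have h: "0 < h n" for n by (simp add: h_def)
  define u where "u n = rs (- (1 / h n)) (S (h n) z - z)" for n
  have "tends sequentially (\<lambda>n. rs (1 / h n) (S (h n) z - z)) (- x)"
    unfolding h_def by (rule tends_compose[OF z[unfolded gen_def] inverse_Suc_at_right_0])
  from tends_minus[OF this] have "tends sequentially u x"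
    unfolding u_def by (simp add: sm_minus_left)
  moreover have "\<exists>y. gen S (u n) y" for n
  proof -
    let ?y = "rs (- (1 / h n)) (S (h n) (- x) - - x)"
    have "tends (at_right 0) (\<lambda>s. rs (- (1 / h n)) (rs (1 / s) (S s (S (h n) z) - S (h n) z) - rs (1 / s) (S s z - z))) ?y"
      using gen_S[OF z less_imp_le[OF h[of n]]] z unfolding gen_def
      by (intro tends_sm tends_diff) auto
    moreover have "\<forall>\<^sub>F s in at_right 0. rs (- (1 / h n)) (rs (1 / s) (S s (S (h n) z) - S (h n) z) - rs (1 / s) (S s z - z))
        = rs (1 / s) (S s (u n) - u n)"
    proof -
      have "\<forall>\<^sub>F s in at_right 0. 0 < (s::real)" by (simp add: eventually_at_right_less)
      then show ?thesis
      proof eventually_elim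
        case (elim s)
        have hom: "hom (S s)" using elim by (intro S_hom) simp
        have "rs (1 / s) (S s (u n) - u n) = rs (1 / s) (rs (- (1 / h n)) (S s (S (h n) z) - S (h n) z - (S s z - z)))"
          unfolding u_def by (simp add: hom_sm[OF hom] hom_diff[OF hom] sm_diff_right sm_add_right algebra_simps)
        also have "\<dots> = rs (- (1 / h n)) (rs (1 / s) (S s (S (h n) z) - S (h n) z - (S s z - z)))"
          unfolding rs_mult by (simp add: mult.commute)
        finally show ?case by (simp add: sm_diff_right)
      qed
    qed
    ultimately have "gen S (u n) ?y" unfolding gen_def by (simp add: tends_cong)
    then show ?thesis ..
  qed
  ultimately show ?thesis by blast
qed

end

section \<open>Euler approximations\<close>

text \<open>The shift \<tau> has already been absorbed into \<open>B\<close>, and \<open>J h\<close>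
  is the inverse of 1 - h B. The bound concerns powers of one \<open>J h\<close> at a time; powers
  of several such operators may be multiplied, but each further operator costs a factor
  \<open>Mb\<close>.\<close>

locale hille_yosida = complete_rn_module M sm nrm
  for M :: "'w measure" and sm :: "('w \<Rightarrow> complex) \<Rightarrow> 'a::ab_group_add \<Rightarrow> 'a"
    and nrm :: "'a \<Rightarrow> 'w \<Rightarrow> real" +
  fixes B :: "'a \<Rightarrow> 'a" and D :: "'a set" and J :: "real \<Rightarrow> 'a \<Rightarrow> 'a" and Mb :: "'w \<Rightarrow> real"
  assumes Mb_measurable [measurable]: "Mb \<in> borel_measurable M"
    and Mb_ge_1: "AE \<omega> in M. 1 \<le> Mb \<omega>"
    and B_hom: "module_hom_on M sm D B"
    and D_dense: "\<exists>u. (\<forall>n::nat. u n \<in> D) \<and> tends sequentially u x"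
    and J_in_D: "0 < h \<Longrightarrow> J h x \<in> D"
    and J_right: "0 < h \<Longrightarrow> J h x - rs h (B (J h x)) = x"
    and J_left: "0 < h \<Longrightarrow> x \<in> D \<Longrightarrow> J h (x - rs h (B x)) = x"
    and J_bnd: "0 < h \<Longrightarrow> bnd (J h ^^ n) Mb"
begin

section \<open>Commutation rules for \<open>B\<close> and the operators \<open>J h\<close>\<close>

lemma nrm_zero_le: "AE \<omega> in M. nrm 0 \<omega> \<le> 0"
  using nrm_zero by eventually_elim simp

lemma D_add: "x \<in> D \<Longrightarrow> y \<in> D \<Longrightarrow> x + y \<in> D"
  and D_sm: "\<xi> \<in> borel_measurable M \<Longrightarrow> x \<in> D \<Longrightarrow> sm \<xi> x \<in> D"
  and B_add: "x \<in> D \<Longrightarrow> y \<in> D \<Longrightarrow> B (x + y) = B x + B y"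
  and B_sm: "\<xi> \<in> borel_measurable M \<Longrightarrow> x \<in> D \<Longrightarrow> B (sm \<xi> x) = sm \<xi> (B x)"
  using B_hom by (auto simp: module_hom_on_def)

lemma D_minus: "x \<in> D \<Longrightarrow> - x \<in> D"
  using D_sm[of "\<lambda>_. - 1" x] by (simp add: sm_minus_left)

lemma D_diff: "x \<in> D \<Longrightarrow> y \<in> D \<Longrightarrow> x - y \<in> D"
  using D_add[of x "- y"] D_minus by simp

lemma B_minus: "x \<in> D \<Longrightarrow> B (- x) = - B x"
  using B_sm[of "\<lambda>_. - 1" x] by (simp add: sm_minus_left)

lemma B_diff: "x \<in> D \<Longrightarrow> y \<in> D \<Longrightarrow> B (x - y) = B x - B y"
  using B_add[of x "- y"] D_minus B_minus by simp

lemma J_hom: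
  assumes "0 < h"
  shows "hom (J h)"
  unfolding hom_def
proof (intro conjI allI impI)
  fix x y
  have "J h (J h x + J h y - rs h (B (J h x + J h y))) = J h x + J h y"
    by (intro J_left assms D_add J_in_D)
  also have "J h x + J h y - rs h (B (J h x + J h y))
      = (J h x - rs h (B (J h x))) + (J h y - rs h (B (J h y)))"
    using assms by (simp add: B_add J_in_D sm_add_right)
  finally show "J h (x + y) = J h x + J h y" using J_right[OF assms] by simp
next
  fix \<xi> :: "'w \<Rightarrow> complex" and x assume \<xi>: "\<xi> \<in> borel_measurable M"
  have "J h (sm \<xi> (J h x) - rs h (B (sm \<xi> (J h x)))) = sm \<xi> (J h x)"
    by (intro J_left assms D_sm J_in_D \<xi>)
  also have "sm \<xi> (J h x) - rs h (B (sm \<xi> (J h x))) = sm \<xi> (J h x - rs h (B (J h x)))"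
    using assms \<xi> by (simp add: B_sm J_in_D sm_diff_right hom_sm[OF hom_sm_scalar])
  finally show "J h (sm \<xi> x) = sm \<xi> (J h x)" using J_right[OF assms] by simp
qed

lemma J_funpow_hom: "0 < h \<Longrightarrow> hom (J h ^^ n)"
  by (intro hom_funpow J_hom)

lemma J_bnd1: "0 < h \<Longrightarrow> bnd (J h) Mb"
  using J_bnd[of h 1] by simp

lemma J_diff_id:
  assumes "0 < h" "x \<in> D"
  shows "J h x - x = rs h (J h (B x))"
  using J_left[OF assms] assms(1) by (simp add: hom_diff[OF J_hom] hom_sm[OF J_hom] algebra_simps)

lemma B_J:
  assumes "0 < h" "x \<in> D"
  shows "B (J h x) = J h (B x)"
proof -
  have "rs h (B (J h x)) = rs h (J h (B x))"
    using J_diff_id[OF assms] J_right[OF assms(1), of x] by (simp add: algebra_simps)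
  then have "rs (1 / h) (rs h (B (J h x))) = rs (1 / h) (rs h (J h (B x)))" by simp
  then show ?thesis unfolding rs_mult using assms(1) by simp
qed

text \<open>The vector J b (J a x) solves the equation w - a B w = J b x, whose only solution is J a
  (J b x).\<close>

lemma J_commute:
  assumes "0 < a" "0 < b"
  shows "J a (J b x) = J b (J a x)"
proof -
  have "J b (J a x) - rs a (B (J b (J a x))) = J b (J a x - rs a (B (J a x)))"
    using assms by (simp add: B_J J_in_D hom_diff[OF J_hom] hom_sm[OF J_hom])
  then have "J a (J b (J a x) - rs a (B (J b (J a x)))) = J a (J b x)"
    using assms by (simp add: J_right)
  then show ?thesis using assms by (simp add: J_left J_in_D)
qed

lemma J_funpow_commute:
  assumes "0 < a" "0 < b"
  shows "(J a ^^ n) ((J b ^^ m) x) = (J b ^^ m) ((J a ^^ n) x)"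
proof -
  have 1: "J a ((J b ^^ m) x) = (J b ^^ m) (J a x)" for x
    by (induction m) (simp_all add: J_commute[OF assms])
  show ?thesis by (induction n) (simp_all add: 1)
qed

section \<open>Taylor estimates on the domain of the square of \<open>B\<close>\<close>

definition D2 :: "'a set" where "D2 = {x \<in> D. B x \<in> D}"

lemma D2_D: "x \<in> D2 \<Longrightarrow> x \<in> D"
  and D2_B: "x \<in> D2 \<Longrightarrow> B x \<in> D"
  by (auto simp: D2_def)

lemma J_in_D2: "0 < h \<Longrightarrow> x \<in> D \<Longrightarrow> J h x \<in> D2"
  by (simp add: D2_def J_in_D B_J)

text \<open>Telescoping: each of the \<open>k\<close> increments is \<open>h\<close> times a power
  of \<open>J h\<close> applied to \<open>B x\<close>, and every such power is bounded by the same
  \<open>Mb\<close>.\<close>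

lemma nrm_J_funpow_diff:
  assumes h: "0 < h" and x: "x \<in> D"
  shows "AE \<omega> in M. nrm ((J h ^^ k) x - x) \<omega> \<le> (real k * h) * (Mb \<omega> * nrm (B x) \<omega>)"
proof (induction k)
  case 0
  show ?case using nrm_zero_le by simp
next
  case (Suc k)
  have "(J h ^^ Suc k) x - x = (J h ^^ k) (J h x - x) + ((J h ^^ k) x - x)"
    by (simp add: hom_diff[OF J_funpow_hom[OF h]] funpow_swap1)
  also have "(J h ^^ k) (J h x - x) = rs h ((J h ^^ Suc k) (B x))"
    unfolding J_diff_id[OF h x] by (simp add: hom_sm[OF J_funpow_hom[OF h]] funpow_swap1)
  finally have eq: "(J h ^^ Suc k) x - x = rs h ((J h ^^ Suc k) (B x)) + ((J h ^^ k) x - x)" .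
  from nrm_triangle[of "rs h ((J h ^^ Suc k) (B x))" "(J h ^^ k) x - x"] Suc.IH
    nrm_rs[of h "(J h ^^ Suc k) (B x)"] bndD[OF J_bnd[OF h], of "Suc k" "B x"]
  show ?case unfolding eq
  proof eventually_elim
    case (elim \<omega>)
    have "h * nrm ((J h ^^ Suc k) (B x)) \<omega> \<le> h * (Mb \<omega> * nrm (B x) \<omega>)"
      using elim h by (intro mult_left_mono) auto
    with elim h have "nrm (rs h ((J h ^^ Suc k) (B x)) + ((J h ^^ k) x - x)) \<omega>
        \<le> h * (Mb \<omega> * nrm (B x) \<omega>) + real k * h * (Mb \<omega> * nrm (B x) \<omega>)"
      unfolding abs_of_pos[OF h] by linarith
    also have "\<dots> = real (Suc k) * h * (Mb \<omega> * nrm (B x) \<omega>)" by (simp add: algebra_simps)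
    finally show ?case .
  qed
qed

text \<open>The step from \<open>k\<close> to k + 1 adds an error of at most (k + 1) h\<times>h
  times Mb nrm (B (B x)), and the induction closes because k\<times>k + (k + 1) \<le> (k +
  1)\<times>(k + 1). The bound sees only the total length k h, so it is the same for one long step
  and for many short ones and survives the passage to the limit semigroup.\<close>

lemma nrm_J_funpow_taylor:
  assumes h: "0 < h" and x: "x \<in> D2"
  shows "AE \<omega> in M. nrm ((J h ^^ k) x - x - rs (real k * h) (B x)) \<omega>
    \<le> (real k * h)\<^sup>2 * (Mb \<omega> * nrm (B (B x)) \<omega>)"
proof (induction k)
  case 0
  show ?case using nrm_zero_le by simp
next
  case (Suc k)
  have "(J h ^^ Suc k) x - (J h ^^ k) x = (J h ^^ k) (J h x - x)"
    by (simp add: hom_diff[OF J_funpow_hom[OF h]] funpow_swap1)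
  also have "\<dots> = rs h ((J h ^^ Suc k) (B x))"
    unfolding J_diff_id[OF h D2_D[OF x]] by (simp add: hom_sm[OF J_funpow_hom[OF h]] funpow_swap1)
  finally have 1: "(J h ^^ Suc k) x - (J h ^^ k) x = rs h ((J h ^^ Suc k) (B x))" .
  have 2: "rs (real (Suc k) * h) (B x) = rs (real k * h) (B x) + rs h (B x)"
    unfolding rs_add_left[symmetric] by (simp add: distrib_right add.commute)
  have "(J h ^^ Suc k) x - x - rs (real (Suc k) * h) (B x)
      = ((J h ^^ k) x - x - rs (real k * h) (B x)) + (((J h ^^ Suc k) x - (J h ^^ k) x) - rs h (B x))"
    unfolding 2 by (simp add: algebra_simps)
  also have "((J h ^^ Suc k) x - (J h ^^ k) x) - rs h (B x) = rs h ((J h ^^ Suc k) (B x) - B x)"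
    unfolding 1 by (simp add: sm_diff_right)
  finally have eq: "(J h ^^ Suc k) x - x - rs (real (Suc k) * h) (B x)
      = ((J h ^^ k) x - x - rs (real k * h) (B x)) + rs h ((J h ^^ Suc k) (B x) - B x)" .
  from nrm_triangle[of "(J h ^^ k) x - x - rs (real k * h) (B x)" "rs h ((J h ^^ Suc k) (B x) - B x)"] Suc.IH
    nrm_rs[of h "(J h ^^ Suc k) (B x) - B x"] nrm_J_funpow_diff[OF h D2_B[OF x], of "Suc k"]
    Mb_ge_1 nrm_nonneg[of "B (B x)"]
  show ?case unfolding eq
  proof eventually_elim
    case (elim \<omega>)
    let ?c = "Mb \<omega> * nrm (B (B x)) \<omega>"
    have "nrm ((J h ^^ k) x - x - rs (real k * h) (B x) + rs h ((J h ^^ Suc k) (B x) - B x)) \<omega>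
        \<le> (real k * h)\<^sup>2 * ?c + h * nrm ((J h ^^ Suc k) (B x) - B x) \<omega>"
      using elim h by simp
    also have "\<dots> \<le> (real k * h)\<^sup>2 * ?c + h * (real (Suc k) * h * ?c)"
      using elim h by (intro add_left_mono mult_left_mono) auto
    also have "\<dots> = ((real k * h)\<^sup>2 + h * (real (Suc k) * h)) * ?c" by (simp add: algebra_simps)
    also have "\<dots> \<le> (real (Suc k) * h)\<^sup>2 * ?c"
      using elim h by (intro mult_right_mono) (auto simp: power2_eq_square algebra_simps)
    finally show ?case .
  qed
qed

text \<open>For two successive steps of different lengths. The square of \<open>Mb\<close> arises
  because \<open>J a\<close> acts on the expansion error of \<open>J b\<close>.\<close>

lemma nrm_J_J_taylor:
  assumes a: "0 < a" and b: "0 < b" and x: "x \<in> D2"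
  shows "AE \<omega> in M. nrm (J a (J b x) - x - rs (a + b) (B x)) \<omega>
    \<le> (a + b)\<^sup>2 * ((Mb \<omega>)\<^sup>2 * nrm (B (B x)) \<omega>)"
proof -
  \<comment> \<open>Expanding \<open>J b\<close> first, J a (J b x) = J a x + b J a (B x) + J a e1;
    then \<open>e2\<close> and \<open>e3\<close> are the errors of the first two terms.\<close>
  define e1 where "e1 = J b x - x - rs b (B x)"
  define e2 where "e2 = J a x - x - rs a (B x)"
  define e3 where "e3 = J a (B x) - B x"
  have eq: "J a (J b x) - x - rs (a + b) (B x) = J a e1 + e2 + rs b e3"
    unfolding e1_def e2_def e3_def rs_add_left
    by (simp add: hom_diff[OF J_hom[OF a]] hom_add[OF J_hom[OF a]] hom_sm[OF J_hom[OF a]] sm_diff_right algebra_simps)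
  have "AE \<omega> in M. nrm e1 \<omega> \<le> b\<^sup>2 * (Mb \<omega> * nrm (B (B x)) \<omega>)"
    using nrm_J_funpow_taylor[OF b x, of 1] by (simp add: e1_def)
  moreover have "AE \<omega> in M. nrm e2 \<omega> \<le> a\<^sup>2 * (Mb \<omega> * nrm (B (B x)) \<omega>)"
    using nrm_J_funpow_taylor[OF a x, of 1] by (simp add: e2_def)
  moreover have "AE \<omega> in M. nrm e3 \<omega> \<le> a * (Mb \<omega> * nrm (B (B x)) \<omega>)"
    using nrm_J_funpow_diff[OF a D2_B[OF x], of 1] by (simp add: e3_def)
  moreover note nrm_triangle[of "J a e1" "e2"] nrm_triangle[of "J a e1 + e2" "rs b e3"] nrm_rs[of b e3]
    bndD[OF J_bnd1[OF a], of e1] Mb_ge_1 nrm_nonneg[of "B (B x)"]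
  ultimately show ?thesis unfolding eq
  proof eventually_elim
    case (elim \<omega>)
    define c where "c = Mb \<omega> * nrm (B (B x)) \<omega>"
    have "0 \<le> c" unfolding c_def using elim by (intro mult_nonneg_nonneg) auto
    moreover from this have "c \<le> Mb \<omega> * c" using elim mult_right_mono[of 1 "Mb \<omega>" c] by simp
    ultimately have c: "0 \<le> c" "c \<le> Mb \<omega> * c" .
    have "Mb \<omega> * nrm e1 \<omega> \<le> Mb \<omega> * (b\<^sup>2 * c)" unfolding c_def using elim by (intro mult_left_mono) auto
    moreover have "b * nrm e3 \<omega> \<le> b * (a * c)" unfolding c_def using elim b by (intro mult_left_mono) auto
    moreover have "b * (a * c) \<le> b * (a * (Mb \<omega> * c))" "a\<^sup>2 * c \<le> a\<^sup>2 * (Mb \<omega> * c)"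
      using c a b by (auto intro!: mult_left_mono)
    ultimately have "nrm (J a e1 + e2 + rs b e3) \<omega> \<le> Mb \<omega> * (b\<^sup>2 * c) + a\<^sup>2 * (Mb \<omega> * c) + b * (a * (Mb \<omega> * c))"
      using elim unfolding c_def[symmetric] abs_of_pos[OF b] by linarith
    also have "\<dots> = (b\<^sup>2 + a\<^sup>2 + b * a) * (Mb \<omega> * c)" by (simp add: algebra_simps)
    also have "\<dots> \<le> (a + b)\<^sup>2 * (Mb \<omega> * c)"
      using c a b by (intro mult_right_mono) (auto simp: power2_eq_square algebra_simps)
    finally show ?case by (simp add: c_def power2_eq_square ac_simps)
  qed
qed

text \<open>Lax telescoping: the difference of the n-th powers is a sum of \<open>n\<close> mixed
  products applied to U x - V x. Stability is assumed for mixed products as a whole, since separate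
  bounds for \<open>U\<close> and \<open>V\<close> would multiply up.\<close>

lemma nrm_funpow_diff:
  assumes U: "hom U" and V: "hom V" and comm: "\<And>z. U (V z) = V (U z)"
    and K: "\<And>i j z. AE \<omega> in M. nrm ((V ^^ i) ((U ^^ j) z)) \<omega> \<le> K \<omega> * nrm z \<omega>"
  shows "AE \<omega> in M. nrm ((U ^^ n) x - (V ^^ n) x) \<omega> \<le> real n * (K \<omega> * nrm (U x - V x) \<omega>)"
proof -
  have commn: "(U ^^ n) (V z) = V ((U ^^ n) z)" for n z
    by (induction n) (simp_all add: comm)
  \<comment> \<open>The additional power of \<open>V\<close> in front collects the factors that the
    recursion splits off, so that \<open>K\<close> is applied only once to each summand.\<close>
  have "AE \<omega> in M. nrm ((V ^^ m) ((U ^^ n) x - (V ^^ n) x)) \<omega> \<le> real n * (K \<omega> * nrm (U x - V x) \<omega>)" for m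
  proof (induction n arbitrary: m)
    case 0
    show ?case using nrm_zero_le by (simp add: hom_zero[OF hom_funpow[OF V]])
  next
    case (Suc n)
    have "(U ^^ Suc n) x - (V ^^ Suc n) x = (U ^^ n) (U x - V x) + V ((U ^^ n) x - (V ^^ n) x)"
      by (simp add: hom_diff[OF hom_funpow[OF U]] hom_diff[OF V] funpow_swap1 commn)
    then have "(V ^^ m) ((U ^^ Suc n) x - (V ^^ Suc n) x)
        = (V ^^ m) ((U ^^ n) (U x - V x)) + (V ^^ Suc m) ((U ^^ n) x - (V ^^ n) x)"
      by (simp add: hom_add[OF hom_funpow[OF V]] funpow_swap1)
    then have "AE \<omega> in M. nrm ((V ^^ m) ((U ^^ Suc n) x - (V ^^ Suc n) x)) \<omega>
        \<le> nrm ((V ^^ m) ((U ^^ n) (U x - V x))) \<omega> + nrm ((V ^^ Suc m) ((U ^^ n) x - (V ^^ n) x)) \<omega>"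
      using nrm_triangle by simp
    with K[of m n "U x - V x"] Suc.IH[of "Suc m"]
    show ?case
    proof eventually_elim
      case (elim \<omega>)
      then show ?case unfolding of_nat_Suc distrib_right by linarith
    qed
  qed
  from this[of 0] show ?thesis by simp
qed

section \<open>Euler approximations with n + 1 steps, and their convergence\<close>

definition eul :: "real \<Rightarrow> nat \<Rightarrow> 'a \<Rightarrow> 'a" where
  "eul t n = J (t / real (Suc n)) ^^ Suc n"

lemma eul_hom: "0 < t \<Longrightarrow> hom (eul t n)"
  unfolding eul_def by (intro J_funpow_hom) simp

lemma eul_bnd: "0 < t \<Longrightarrow> bnd (eul t n) Mb"
  unfolding eul_def by (intro J_bnd) simp

lemma Mb2: "AE \<omega> in M. Mb \<omega> \<le> (Mb \<omega>)\<^sup>2" "AE \<omega> in M. 0 \<le> Mb \<omega>"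
  using Mb_ge_1 by (eventually_elim, simp add: power2_eq_square)+

lemma nrm_J_J: "0 < a \<Longrightarrow> 0 < b \<Longrightarrow> AE \<omega> in M. nrm ((J a ^^ i) ((J b ^^ j) z)) \<omega> \<le> (Mb \<omega>)\<^sup>2 * nrm z \<omega>"
  using bnd_comp[OF J_bnd J_bnd Mb2(2), of a b i j] by (simp add: bnd_def power2_eq_square)

text \<open>Both Euler approximations are compared with the one on the common refinement of the two
  partitions.\<close>

lemma eul_refine:
  assumes t: "0 < t" and x: "x \<in> D2"
  shows "AE \<omega> in M. nrm (eul t n x - (J (t / (real (Suc n) * real (Suc m))) ^^ (Suc n * Suc m)) x) \<omega>
    \<le> 2 * t\<^sup>2 / real (Suc n) * ((Mb \<omega>) ^ 3 * nrm (B (B x)) \<omega>)"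
proof -
  define s where "s = t / real (Suc n)"
  define h where "h = t / (real (Suc n) * real (Suc m))"
  have pos: "0 < s" "0 < h" using t by (auto simp: s_def h_def simp del: of_nat_Suc)
  have s: "real (Suc m) * h = s" using t by (simp add: s_def h_def field_simps del: of_nat_Suc)
  define U where "U = J s"
  \<comment> \<open>One coarse step of length \<open>s\<close> made of m + 1 fine steps. Each coarse
    step costs two Taylor errors of order s\<times>s with factor \<open>Mb\<close>; there are n + 1
    of them, with s = t / (n + 1), and stability adds two more factors \<open>Mb\<close>.\<close>
  define V where "V = J h ^^ Suc m"
  have Vn: "V ^^ i = J h ^^ (i * Suc m)" for i
    unfolding V_def by (simp only: funpow_mult mult.commute)
  have "AE \<omega> in M. nrm ((U ^^ Suc n) x - (V ^^ Suc n) x) \<omega>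
      \<le> real (Suc n) * ((Mb \<omega>)\<^sup>2 * nrm (U x - V x) \<omega>)"
  proof (rule nrm_funpow_diff)
    show "hom U" "hom V" unfolding U_def V_def by (intro J_hom J_funpow_hom pos)+
    show "U (V z) = V (U z)" for z
      unfolding U_def V_def using J_funpow_commute[OF pos, of 1 "Suc m" z] by simp
    show "AE \<omega> in M. nrm ((V ^^ i) ((U ^^ j) z)) \<omega> \<le> (Mb \<omega>)\<^sup>2 * nrm z \<omega>" for i j z
      unfolding Vn unfolding U_def by (intro nrm_J_J pos)
  qed
  moreover have "AE \<omega> in M. nrm (U x - x - rs s (B x)) \<omega> \<le> s\<^sup>2 * (Mb \<omega> * nrm (B (B x)) \<omega>)"
    using nrm_J_funpow_taylor[OF pos(1) x, of 1] by (simp add: U_def)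
  moreover have "AE \<omega> in M. nrm (V x - x - rs s (B x)) \<omega> \<le> s\<^sup>2 * (Mb \<omega> * nrm (B (B x)) \<omega>)"
    using nrm_J_funpow_taylor[OF pos(2) x, of "Suc m"] unfolding s V_def .
  moreover have "AE \<omega> in M. nrm (U x - V x) \<omega> \<le> nrm (U x - x - rs s (B x)) \<omega> + nrm (V x - x - rs s (B x)) \<omega>"
    using nrm_diff_le[of "U x - x - rs s (B x)" "V x - x - rs s (B x)"] by simp
  ultimately have "AE \<omega> in M. nrm ((U ^^ Suc n) x - (V ^^ Suc n) x) \<omega>
    \<le> 2 * t\<^sup>2 / real (Suc n) * ((Mb \<omega>) ^ 3 * nrm (B (B x)) \<omega>)"
  proof eventually_elim
    case (elim \<omega>)
    have "(Mb \<omega>)\<^sup>2 * nrm (U x - V x) \<omega> \<le> (Mb \<omega>)\<^sup>2 * (2 * s\<^sup>2 * (Mb \<omega> * nrm (B (B x)) \<omega>))"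
      using elim by (intro mult_left_mono) auto
    then have "real (Suc n) * ((Mb \<omega>)\<^sup>2 * nrm (U x - V x) \<omega>)
        \<le> real (Suc n) * ((Mb \<omega>)\<^sup>2 * (2 * s\<^sup>2 * (Mb \<omega> * nrm (B (B x)) \<omega>)))"
      by (rule mult_left_mono) simp
    also have "\<dots> = (real (Suc n) * s) * (2 * s) * ((Mb \<omega>) ^ 3 * nrm (B (B x)) \<omega>)"
      by (simp add: power2_eq_square power3_eq_cube ac_simps)
    also have "(real (Suc n) * s) * (2 * s) = 2 * t\<^sup>2 / real (Suc n)"
      by (simp add: s_def power2_eq_square del: of_nat_Suc)
    finally show ?case using elim by linarith
  qed
  then show ?thesis unfolding Vn unfolding U_def eul_def s_def h_def .
qed

text \<open>On \<open>D\<close>, J h x - x is of order \<open>h\<close>, and uniform boundedness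
  extends the convergence to all \<open>x\<close>. Density of \<open>D2\<close> follows since J h (J
  h x) lies in \<open>D2\<close> and tends to \<open>x\<close>.\<close>

lemma D2_dense: "\<exists>u. (\<forall>n::nat. u n \<in> D2) \<and> tends sequentially u x"
  and J_tends: "tends (at_right 0) (\<lambda>h. J h x) x"
proof -
  have J: "tends (at_right 0) (\<lambda>h. J h x) x" for x
  proof -
    obtain u where u: "\<And>n::nat. u n \<in> D" "tends sequentially u x" using D_dense by blast
    have "tends (at_right 0) (\<lambda>h. J h x - x) 0"
    proof (rule tends_zero_dense[where K="\<lambda>\<omega>. Mb \<omega> + 1", OF _ _ u(2)])
      have ev: "\<forall>\<^sub>F h in at_right 0. 0 < (h::real)" by (simp add: eventually_at_right_less)
      then show "\<forall>\<^sub>F h in at_right 0. hom (\<lambda>x. J h x - x) \<and> bnd (\<lambda>x. J h x - x) (\<lambda>\<omega>. Mb \<omega> + 1)"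
      proof eventually_elim
        case (elim h)
        have "hom (\<lambda>x. J h x - x)"
          using J_hom[OF elim] by (auto simp: hom_def sm_diff_right)
        moreover have "bnd (\<lambda>x. J h x - x) (\<lambda>\<omega>. Mb \<omega> + 1)"
          unfolding bnd_def
        proof
          fix x
          from bndD[OF J_bnd1[OF elim], of x] nrm_diff_le[of "J h x" x]
          show "AE \<omega> in M. nrm (J h x - x) \<omega> \<le> (Mb \<omega> + 1) * nrm x \<omega>"
            by eventually_elim (simp add: distrib_right)
        qed
        ultimately show ?case ..
      qed
      show "tends (at_right 0) (\<lambda>h. J h (u k) - u k) 0" for k
      proof (rule tendsI)
        show "cip M (at_right 0) (\<lambda>h \<omega>. h * (Mb \<omega> * nrm (B (u k)) \<omega>))"
          by (rule cip_scale) auto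
        from ev show "\<forall>\<^sub>F h in at_right 0. AE \<omega> in M. nrm (J h (u k) - u k - 0) \<omega> \<le> h * (Mb \<omega> * nrm (B (u k)) \<omega>)"
          by eventually_elim (use nrm_J_funpow_diff[OF _ u(1), of _ 1] in simp)
      qed auto
    qed auto
    then show ?thesis by (simp add: tends_zero_iff)
  qed
  then show "tends (at_right 0) (\<lambda>h. J h x) x" .
  define h where "h n = 1 / real (Suc n)" for n
  have h: "0 < h n" for n by (simp add: h_def)
  have lim: "filterlim h (at_right 0) sequentially"
    unfolding h_def[abs_def] by (rule inverse_Suc_at_right_0)
  have 1: "tends sequentially (\<lambda>n. J (h n) x) x" by (rule tends_compose[OF J lim])
  have "tends sequentially (\<lambda>n. J (h n) (J (h n) x - x)) 0"
    using 1[THEN tends_zero_iff[THEN iffD2]]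
    by (rule tends_bounded_family[OF _ Mb_measurable])
      (intro always_eventually[of _ sequentially] allI bndD[OF J_bnd1] h)
  from tends_add[OF this 1] have "tends sequentially (\<lambda>n. J (h n) (J (h n) x)) x"
    by (simp add: hom_diff[OF J_hom[OF h]])
  then show "\<exists>u. (\<forall>n::nat. u n \<in> D2) \<and> tends sequentially u x"
    by (intro exI[of _ "\<lambda>n. J (h n) (J (h n) x)"]) (simp add: J_in_D2 J_in_D h)
qed

text \<open>On \<open>D2\<close> two approximations differ by a multiple of 1 / (n + 1), whatever
  the larger index is. The uniform bound then gives the Cauchy property on the closure of
  \<open>D2\<close>.\<close>

lemma eul_convergent:
  assumes t: "0 < t"
  shows "\<exists>l. tends sequentially (\<lambda>n. eul t n x) l"
proof (rule tends_exists)
  fix m :: "nat \<Rightarrow> nat" assume m: "\<And>n. n \<le> m n"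
  obtain u where u: "\<And>n::nat. u n \<in> D2" "tends sequentially u x" using D2_dense by blast
  show "tends sequentially (\<lambda>n. eul t n x - eul t (m n) x) 0"
  proof (rule tends_zero_dense[OF _ _ u(2)])
    show "(\<lambda>\<omega>. Mb \<omega> + Mb \<omega>) \<in> borel_measurable M" by measurable
    show "\<forall>\<^sub>F n in sequentially. hom (\<lambda>x. eul t n x - eul t (m n) x)
        \<and> bnd (\<lambda>x. eul t n x - eul t (m n) x) (\<lambda>\<omega>. Mb \<omega> + Mb \<omega>)"
      by (intro always_eventually[of _ sequentially] allI bnd_diff_ops eul_hom eul_bnd t)
    fix k
    define g where "g \<omega> = (Mb \<omega>) ^ 3 * nrm (B (B (u k))) \<omega>" for \<omega>
    show "tends sequentially (\<lambda>n. eul t n (u k) - eul t (m n) (u k)) 0"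
    proof (rule tendsI)
      have "(\<lambda>n. 4 * t\<^sup>2 * (1 / real (Suc n))) \<longlonglongrightarrow> 4 * t\<^sup>2 * 0"
        by (intro tendsto_intros LIMSEQ_Suc[OF lim_1_over_n])
      then have "(\<lambda>n. 4 * t\<^sup>2 / real (Suc n)) \<longlonglongrightarrow> 0" by simp
      then show "cip M sequentially (\<lambda>n \<omega>. 4 * t\<^sup>2 / real (Suc n) * g \<omega>)"
        by (rule cip_scale) (simp add: g_def)
      have "AE \<omega> in M. nrm (eul t n (u k) - eul t (m n) (u k)) \<omega> \<le> 4 * t\<^sup>2 / real (Suc n) * g \<omega>" for n
      proof -
        \<comment> \<open>The common refinement is symmetric in \<open>n\<close> and
          \<open>m n\<close>, so \<open>eul_refine\<close> applies from both sides. As m n \<ge> n,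
          the two errors add up to the constant 4.\<close>
        define w where "w = (J (t / (real (Suc n) * real (Suc (m n)))) ^^ (Suc n * Suc (m n))) (u k)"
        from eul_refine[OF t u(1)[of k], of n "m n"]
        have 1: "AE \<omega> in M. nrm (eul t n (u k) - w) \<omega> \<le> 2 * t\<^sup>2 / real (Suc n) * g \<omega>"
          unfolding w_def g_def .
        from eul_refine[OF t u(1)[of k], of "m n" n]
        have 2: "AE \<omega> in M. nrm (eul t (m n) (u k) - w) \<omega> \<le> 2 * t\<^sup>2 / real (Suc (m n)) * g \<omega>"
          unfolding w_def g_def by (simp only: mult.commute[of "real (Suc (m n))"] mult.commute[of "Suc (m n)"])
        from 1 2 nrm_diff_le[of "eul t n (u k) - w" "eul t (m n) (u k) - w"] Mb2(2) nrm_nonneg[of "B (B (u k))"]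
        show ?thesis
        proof eventually_elim
          case (elim \<omega>)
          have "2 * t\<^sup>2 / real (Suc (m n)) * g \<omega> \<le> 2 * t\<^sup>2 / real (Suc n) * g \<omega>"
            using m[of n] elim by (intro mult_right_mono divide_left_mono) (auto simp: g_def)
          with elim show ?case by simp
        qed
      qed
      then show "\<forall>\<^sub>F n in sequentially. AE \<omega> in M. nrm (eul t n (u k) - eul t (m n) (u k) - 0) \<omega>
          \<le> 4 * t\<^sup>2 / real (Suc n) * g \<omega>"
        by (intro always_eventually[of _ sequentially] allI) simp
    qed (auto simp: g_def)
  qed
qed

text \<open>Nothing is assumed about \<open>J\<close> at 0, so time 0 is set to the identity by
  hand.\<close>

definition T :: "real \<Rightarrow> 'a \<Rightarrow> 'a" where
  "T t x = (if t = 0 then x else SOME l. tends sequentially (\<lambda>n. eul t n x) l)"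

lemma T_zero: "T 0 x = x"
  by (simp add: T_def)

lemma eul_tends: "0 < t \<Longrightarrow> tends sequentially (\<lambda>n. eul t n x) (T t x)"
  unfolding T_def using someI_ex[OF eul_convergent] by auto

lemma T_eqI: "0 < t \<Longrightarrow> tends sequentially (\<lambda>n. eul t n x) l \<Longrightarrow> T t x = l"
  using tends_unique[OF _ eul_tends] by auto

lemma T_hom:
  assumes "0 \<le> t"
  shows "hom (T t)"
proof (cases "t = 0")
  case True
  then show ?thesis by (simp add: hom_def T_zero)
next
  case False
  with assms have t: "0 < t" by simp
  show ?thesis
    unfolding hom_def
  proof (intro conjI allI impI)
    show "T t (x + y) = T t x + T t y" for x y
      using tends_add[OF eul_tends[OF t, of x] eul_tends[OF t, of y]]
      by (intro T_eqI t) (simp add: hom_add[OF eul_hom[OF t]])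
    show "T t (sm \<xi> x) = sm \<xi> (T t x)" if "\<xi> \<in> borel_measurable M" for \<xi> x
      using tends_sm[OF eul_tends[OF t, of x] that] that
      by (intro T_eqI t) (simp add: hom_sm[OF eul_hom[OF t]])
  qed
qed

lemma T_bnd:
  assumes "0 \<le> t"
  shows "bnd (T t) Mb"
  unfolding bnd_def
proof
  fix x
  show "AE \<omega> in M. nrm (T t x) \<omega> \<le> Mb \<omega> * nrm x \<omega>"
  proof (cases "t = 0")
    case True
    from Mb_ge_1 nrm_nonneg[of x] show ?thesis
      unfolding True T_zero by eventually_elim (use mult_right_mono in fastforce)
  next
    case False
    with assms have t: "0 < t" by simp
    show ?thesis by (rule tends_nrm_le[OF eul_tends[OF t] bndD[OF eul_bnd[OF t]]])
  qed
qed

text \<open>One step of length (s + t) / (n + 1) and the product of steps s / (n + 1) and t / (n +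
  1) both agree with the same first-order expansion. Since all these operators commute, the powers
  of the product are the composed Euler approximations.\<close>

lemma T_add_pos:
  assumes s: "0 < s" and t: "0 < t"
  shows "T (s + t) x = T s (T t x)"
proof -
  obtain u where u: "\<And>n::nat. u n \<in> D2" "tends sequentially u x" using D2_dense by blast
  have "tends sequentially (\<lambda>n. eul (s + t) n x - eul s n (eul t n x)) 0"
  proof (rule tends_zero_dense[OF _ _ u(2)])
    show "(\<lambda>\<omega>. Mb \<omega> + Mb \<omega> * Mb \<omega>) \<in> borel_measurable M" by measurable
    show "\<forall>\<^sub>F n in sequentially. hom (\<lambda>x. eul (s + t) n x - eul s n (eul t n x))
        \<and> bnd (\<lambda>x. eul (s + t) n x - eul s n (eul t n x)) (\<lambda>\<omega>. Mb \<omega> + Mb \<omega> * Mb \<omega>)"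
      using bnd_diff_ops[OF eul_hom hom_comp[OF eul_hom[OF s] eul_hom[OF t]] eul_bnd
          bnd_comp[OF eul_bnd[OF s] eul_bnd[OF t] Mb2(2)]] s t
      by (intro always_eventually[of _ sequentially] allI) simp
    fix k
    \<comment> \<open>The exponent is 3 + 2: mixed products contain powers of three different
      operators, and the Taylor error of the product of two steps carries the square of
      \<open>Mb\<close>.\<close>
    define g where "g \<omega> = (Mb \<omega>) ^ 5 * nrm (B (B (u k))) \<omega>" for \<omega>
    show "tends sequentially (\<lambda>n. eul (s + t) n (u k) - eul s n (eul t n (u k))) 0"
    proof (rule tendsI)
      have "(\<lambda>n. 2 * (s + t)\<^sup>2 * (1 / real (Suc n))) \<longlonglongrightarrow> 2 * (s + t)\<^sup>2 * 0"
        by (intro tendsto_intros LIMSEQ_Suc[OF lim_1_over_n])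
      then have "(\<lambda>n. 2 * (s + t)\<^sup>2 / real (Suc n)) \<longlonglongrightarrow> 0" by simp
      then show "cip M sequentially (\<lambda>n \<omega>. 2 * (s + t)\<^sup>2 / real (Suc n) * g \<omega>)"
        by (rule cip_scale) (simp add: g_def)
      have "AE \<omega> in M. nrm (eul (s + t) n (u k) - eul s n (eul t n (u k))) \<omega>
          \<le> 2 * (s + t)\<^sup>2 / real (Suc n) * g \<omega>" for n
      proof -
        define a where "a = s / real (Suc n)"
        define b where "b = t / real (Suc n)"
        have pos: "0 < a" "0 < b" "0 < a + b" using s t by (auto simp: a_def b_def intro!: add_pos_pos)
        have ab: "(s + t) / real (Suc n) = a + b" by (simp add: a_def b_def add_divide_distrib)
        define U where "U = J (a + b)"
        define V where "V x = J a (J b x)" for x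
        have Vn: "(V ^^ i) z = (J a ^^ i) ((J b ^^ i) z)" for i z
        proof (induction i arbitrary: z)
          case (Suc i)
          then show ?case
            using J_funpow_commute[OF pos(1,2), of 1 i] by (simp add: V_def)
              (simp add: J_funpow_commute[OF pos(1,2), of i 1, simplified])
        qed simp
        have "AE \<omega> in M. nrm ((U ^^ Suc n) (u k) - (V ^^ Suc n) (u k)) \<omega>
            \<le> real (Suc n) * ((Mb \<omega>) ^ 3 * nrm (U (u k) - V (u k)) \<omega>)"
        proof (rule nrm_funpow_diff)
          show "hom U" unfolding U_def by (rule J_hom[OF pos(3)])
          show "hom V" unfolding V_def[abs_def] by (rule hom_comp[OF J_hom[OF pos(1)] J_hom[OF pos(2)]])
          show "U (V z) = V (U z)" for z
            unfolding U_def V_def by (simp add: J_commute pos)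
          show "AE \<omega> in M. nrm ((V ^^ i) ((U ^^ j) z)) \<omega> \<le> (Mb \<omega>) ^ 3 * nrm z \<omega>" for i j z
            using nrm_J_J[OF pos(1,2), of i i "(U ^^ j) z"] bndD[OF J_bnd[OF pos(3)], of j z, folded U_def]
            unfolding Vn
          proof eventually_elim
            case (elim \<omega>)
            have "(Mb \<omega>)\<^sup>2 * nrm ((U ^^ j) z) \<omega> \<le> (Mb \<omega>)\<^sup>2 * (Mb \<omega> * nrm z \<omega>)"
              using elim by (intro mult_left_mono) auto
            with elim show ?case by (simp add: power2_eq_square power3_eq_cube mult.assoc)
          qed
        qed
        moreover have "AE \<omega> in M. nrm (U (u k) - u k - rs (a + b) (B (u k))) \<omega>
            \<le> (a + b)\<^sup>2 * (Mb \<omega> * nrm (B (B (u k))) \<omega>)"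
          using nrm_J_funpow_taylor[OF pos(3) u(1)[of k], of 1] by (simp add: U_def)
        moreover have "AE \<omega> in M. nrm (V (u k) - u k - rs (a + b) (B (u k))) \<omega>
            \<le> (a + b)\<^sup>2 * ((Mb \<omega>)\<^sup>2 * nrm (B (B (u k))) \<omega>)"
          using nrm_J_J_taylor[OF pos(1,2) u(1)[of k]] by (simp add: V_def)
        moreover have "AE \<omega> in M. nrm (U (u k) - V (u k)) \<omega>
            \<le> nrm (U (u k) - u k - rs (a + b) (B (u k))) \<omega> + nrm (V (u k) - u k - rs (a + b) (B (u k))) \<omega>"
          using nrm_diff_le[of "U (u k) - u k - rs (a + b) (B (u k))" "V (u k) - u k - rs (a + b) (B (u k))"] by simp
        moreover note Mb2 nrm_nonneg[of "B (B (u k))"]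
        ultimately have "AE \<omega> in M. nrm ((U ^^ Suc n) (u k) - (V ^^ Suc n) (u k)) \<omega> \<le> 2 * (s + t)\<^sup>2 / real (Suc n) * g \<omega>"
        proof eventually_elim
          case (elim \<omega>)
          let ?b = "nrm (B (B (u k))) \<omega>"
          have "(a + b)\<^sup>2 * (Mb \<omega> * ?b) \<le> (a + b)\<^sup>2 * ((Mb \<omega>)\<^sup>2 * ?b)"
            using elim by (intro mult_left_mono mult_right_mono) auto
          then have "nrm (U (u k) - V (u k)) \<omega> \<le> 2 * (a + b)\<^sup>2 * ((Mb \<omega>)\<^sup>2 * ?b)" using elim by linarith
          then have "real (Suc n) * ((Mb \<omega>) ^ 3 * nrm (U (u k) - V (u k)) \<omega>)
              \<le> real (Suc n) * ((Mb \<omega>) ^ 3 * (2 * (a + b)\<^sup>2 * ((Mb \<omega>)\<^sup>2 * ?b)))"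
            using elim by (intro mult_left_mono) auto
          also have "\<dots> = (real (Suc n) * (a + b)) * (2 * (a + b)) * (((Mb \<omega>) ^ 3 * (Mb \<omega>)\<^sup>2) * ?b)"
            by (simp add: power2_eq_square ac_simps)
          also have "(Mb \<omega>) ^ 3 * (Mb \<omega>)\<^sup>2 = (Mb \<omega>) ^ 5" by (simp flip: power_add)
          also have "(real (Suc n) * (a + b)) * (2 * (a + b)) = 2 * (s + t)\<^sup>2 / real (Suc n)"
            unfolding ab[symmetric] by (simp add: power2_eq_square del: of_nat_Suc)
          finally show ?case using elim by (simp add: g_def)
        qed
        then show ?thesis unfolding Vn unfolding U_def eul_def ab unfolding a_def b_def .
      qed
      then show "\<forall>\<^sub>F n in sequentially. AE \<omega> in M. nrm (eul (s + t) n (u k) - eul s n (eul t n (u k)) - 0) \<omega>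
          \<le> 2 * (s + t)\<^sup>2 / real (Suc n) * g \<omega>"
        by (intro always_eventually[of _ sequentially] allI) simp
    qed (auto simp: g_def)
  qed
  moreover have "tends sequentially (\<lambda>n. eul s n (eul t n x)) (T s (T t x))"
  proof -
    have "tends sequentially (\<lambda>n. eul s n (eul t n x - T t x)) 0"
      using eul_tends[OF t, of x, THEN tends_zero_iff[THEN iffD2]]
      by (rule tends_bounded_family[OF _ Mb_measurable])
        (intro always_eventually[of _ sequentially] allI bndD[OF eul_bnd] s)
    from tends_add[OF this eul_tends[OF s, of "T t x"]] show ?thesis
      by (simp add: hom_diff[OF eul_hom[OF s]])
  qed
  ultimately have "tends sequentially (\<lambda>n. (eul (s + t) n x - eul s n (eul t n x)) + eul s n (eul t n x))
      (0 + T s (T t x))"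
    by (rule tends_add)
  then show ?thesis using s t by (intro T_eqI) auto
qed

lemma T_add: "0 \<le> s \<Longrightarrow> 0 \<le> t \<Longrightarrow> T (s + t) x = T s (T t x)"
  using T_add_pos[of s t x] by (cases "s = 0"; cases "t = 0") (auto simp: T_zero)

lemma nrm_T_diff:
  assumes t: "0 < t" and x: "x \<in> D"
  shows "AE \<omega> in M. nrm (T t x - x) \<omega> \<le> t * (Mb \<omega> * nrm (B x) \<omega>)"
proof (rule tends_nrm_le[OF tends_diff[OF eul_tends[OF t] tends_const]])
  fix n
  have "real (Suc n) * (t / real (Suc n)) = t" by (simp del: of_nat_Suc)
  then show "AE \<omega> in M. nrm (eul t n x - x) \<omega> \<le> t * (Mb \<omega> * nrm (B x) \<omega>)"
    unfolding eul_def using nrm_J_funpow_diff[of "t / real (Suc n)" x "Suc n"] t x by simp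
qed

lemma nrm_T_taylor:
  assumes t: "0 < t" and x: "x \<in> D2"
  shows "AE \<omega> in M. nrm (T t x - x - rs t (B x)) \<omega> \<le> t\<^sup>2 * (Mb \<omega> * nrm (B (B x)) \<omega>)"
proof (rule tends_nrm_le[OF tends_diff[OF tends_diff[OF eul_tends[OF t] tends_const] tends_const]])
  fix n
  have eq: "real (Suc n) * (t / real (Suc n)) = t" by (simp del: of_nat_Suc)
  have "0 < t / real (Suc n)" using t by simp
  from nrm_J_funpow_taylor[OF this x, of "Suc n", unfolded eq]
  show "AE \<omega> in M. nrm (eul t n x - x - rs t (B x)) \<omega> \<le> t\<^sup>2 * (Mb \<omega> * nrm (B (B x)) \<omega>)"
    unfolding eul_def .
qed

lemma T_cont: "tends (at_right 0) (\<lambda>t. T t x) x"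
proof -
  obtain u where u: "\<And>n::nat. u n \<in> D" "tends sequentially u x" using D_dense by blast
  have ev: "\<forall>\<^sub>F t in at_right 0. 0 < (t::real)" by (simp add: eventually_at_right_less)
  have "tends (at_right 0) (\<lambda>t. T t x - x) 0"
  proof (rule tends_zero_dense[OF _ _ u(2)])
    show "(\<lambda>\<omega>. Mb \<omega> + 1) \<in> borel_measurable M" by measurable
    have "bnd (\<lambda>x. x) (\<lambda>_. 1)" by (simp add: bnd_def)
    from ev show "\<forall>\<^sub>F t in at_right 0. hom (\<lambda>x. T t x - x) \<and> bnd (\<lambda>x. T t x - x) (\<lambda>\<omega>. Mb \<omega> + 1)"
      by eventually_elim (rule bnd_diff_ops, use T_hom T_bnd hom_id \<open>bnd (\<lambda>x. x) (\<lambda>_. 1)\<close> in auto)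
    show "tends (at_right 0) (\<lambda>t. T t (u k) - u k) 0" for k
    proof (rule tendsI)
      show "cip M (at_right 0) (\<lambda>t \<omega>. t * (Mb \<omega> * nrm (B (u k)) \<omega>))"
        by (rule cip_scale) auto
      from ev show "\<forall>\<^sub>F t in at_right 0. AE \<omega> in M. nrm (T t (u k) - u k - 0) \<omega> \<le> t * (Mb \<omega> * nrm (B (u k)) \<omega>)"
        by eventually_elim (use nrm_T_diff[OF _ u(1)] in simp)
    qed auto
  qed
  then show ?thesis by (simp add: tends_zero_iff)
qed

section \<open>The generator of the limit semigroup\<close>

lemma gen_T_D2:
  assumes x: "x \<in> D2"
  shows "gen T x (B x)"
  unfolding gen_def
proof (rule tendsI)
  show "cip M (at_right 0) (\<lambda>t \<omega>. t * (Mb \<omega> * nrm (B (B x)) \<omega>))"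
    by (rule cip_scale) auto
  have "\<forall>\<^sub>F t in at_right 0. 0 < (t::real)" by (simp add: eventually_at_right_less)
  then show "\<forall>\<^sub>F t in at_right 0. AE \<omega> in M. nrm (rs (1 / t) (T t x - x) - B x) \<omega> \<le> t * (Mb \<omega> * nrm (B (B x)) \<omega>)"
  proof eventually_elim
    case (elim t)
    have "rs (1 / t) (rs t (B x)) = B x" unfolding rs_mult using elim by simp
    then have eq: "rs (1 / t) (T t x - x) - B x = rs (1 / t) (T t x - x - rs t (B x))"
      by (simp add: sm_diff_right)
    from nrm_T_taylor[OF elim x] nrm_rs[of "1 / t" "T t x - x - rs t (B x)"]
    show ?case unfolding eq
    proof eventually_elim
      fix \<omega>
      assume 1: "nrm (T t x - x - rs t (B x)) \<omega> \<le> t\<^sup>2 * (Mb \<omega> * nrm (B (B x)) \<omega>)"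
        and 2: "nrm (rs (1 / t) (T t x - x - rs t (B x))) \<omega> = \<bar>1 / t\<bar> * nrm (T t x - x - rs t (B x)) \<omega>"
      have "\<bar>1 / t\<bar> * nrm (T t x - x - rs t (B x)) \<omega> \<le> t * (Mb \<omega> * nrm (B (B x)) \<omega>)"
        using 1 elim by (simp add: pos_divide_le_eq power2_eq_square ac_simps)
      with 2 show "nrm (rs (1 / t) (T t x - x - rs t (B x))) \<omega> \<le> t * (Mb \<omega> * nrm (B (B x)) \<omega>)"
        by linarith
    qed
  qed
qed auto

text \<open>The Taylor bound is available only on \<open>D2\<close>. For \<open>x\<close> in
  \<open>D\<close> the vectors u n = J h x satisfy B (u n) \<rightarrow> B x, and the remainder y =
  x - u n contributes at most Mb nrm (B y) to the difference quotients, uniformly in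
  \<open>t\<close>.\<close>

lemma gen_T_D:
  assumes x: "x \<in> D"
  shows "gen T x (B x)"
proof -
  define h where "h n = 1 / real (Suc n)" for n
  define u where "u n = J (h n) x" for n
  have h: "0 < h n" for n by (simp add: h_def)
  have lim: "filterlim h (at_right 0) sequentially"
    unfolding h_def[abs_def] by (rule inverse_Suc_at_right_0)
  have u: "u n \<in> D2" for n unfolding u_def by (rule J_in_D2[OF h x])
  have "B (u n) = J (h n) (B x)" for n unfolding u_def by (rule B_J[OF h x])
  then have "tends sequentially (\<lambda>n. B (u n)) (B x)" using tends_compose[OF J_tends lim] by simp
  then have cipB: "cip M sequentially (\<lambda>n \<omega>. (1 + Mb \<omega>) * nrm (B (u n) - B x) \<omega>)"
    unfolding tends_def by (rule cip_mult) auto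
  have "tends (at_right 0) (\<lambda>t. rs (1 / t) (T t x - x) - B x) 0"
  proof (rule tends_zero_approx[OF _ cipB])
    show "cip M (at_right 0) (\<lambda>t. nrm (rs (1 / t) (T t (u n) - u n) - B (u n)))" for n
      using gen_T_D2[OF u, of n] by (simp add: gen_def tends_def)
    fix n
    have "\<forall>\<^sub>F t in at_right 0. 0 < (t::real)" by (simp add: eventually_at_right_less)
    then show "\<forall>\<^sub>F t in at_right 0. AE \<omega> in M. nrm (rs (1 / t) (T t x - x) - B x) \<omega>
      \<le> (1 + Mb \<omega>) * nrm (B (u n) - B x) \<omega> + nrm (rs (1 / t) (T t (u n) - u n) - B (u n)) \<omega>"
    proof eventually_elim
      case (elim t)
      define y where "y = x - u n"
      have y: "y \<in> D" unfolding y_def by (rule D_diff[OF x D2_D[OF u]])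
      have By: "B y = B x - B (u n)" unfolding y_def by (rule B_diff[OF x D2_D[OF u]])
      have "hom (T t)" using elim by (intro T_hom) simp
      then have eq: "rs (1 / t) (T t x - x) - B x
          = rs (1 / t) (T t y - y) + (rs (1 / t) (T t (u n) - u n) - B (u n)) + (B (u n) - B x)"
        by (simp add: y_def hom_diff sm_diff_right sm_add_right algebra_simps)
      from nrm_T_diff[OF elim y, unfolded By] nrm_rs[of "1 / t" "T t y - y"] nrm_commute[of "B x" "B (u n)"]
        nrm_triangle[of "rs (1 / t) (T t y - y) + (rs (1 / t) (T t (u n) - u n) - B (u n))" "B (u n) - B x"]
        nrm_triangle[of "rs (1 / t) (T t y - y)" "rs (1 / t) (T t (u n) - u n) - B (u n)"]
      show ?case unfolding eq
      proof eventually_elim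
        fix \<omega>
        assume 1: "nrm (T t y - y) \<omega> \<le> t * (Mb \<omega> * nrm (B x - B (u n)) \<omega>)"
          and 2: "nrm (rs (1 / t) (T t y - y)) \<omega> = \<bar>1 / t\<bar> * nrm (T t y - y) \<omega>"
          and 3: "nrm (B x - B (u n)) \<omega> = nrm (B (u n) - B x) \<omega>"
          and 4: "nrm (rs (1 / t) (T t y - y) + (rs (1 / t) (T t (u n) - u n) - B (u n)) + (B (u n) - B x)) \<omega>
            \<le> nrm (rs (1 / t) (T t y - y) + (rs (1 / t) (T t (u n) - u n) - B (u n))) \<omega> + nrm (B (u n) - B x) \<omega>"
          and 5: "nrm (rs (1 / t) (T t y - y) + (rs (1 / t) (T t (u n) - u n) - B (u n))) \<omega>
            \<le> nrm (rs (1 / t) (T t y - y)) \<omega> + nrm (rs (1 / t) (T t (u n) - u n) - B (u n)) \<omega>"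
        have "\<bar>1 / t\<bar> * nrm (T t y - y) \<omega> \<le> Mb \<omega> * nrm (B x - B (u n)) \<omega>"
          using 1 elim by (simp add: field_simps)
        with 2 3 4 5
        show "nrm (rs (1 / t) (T t y - y) + (rs (1 / t) (T t (u n) - u n) - B (u n)) + (B (u n) - B x)) \<omega>
          \<le> (1 + Mb \<omega>) * nrm (B (u n) - B x) \<omega> + nrm (rs (1 / t) (T t (u n) - u n) - B (u n)) \<omega>"
          by (simp add: distrib_right)
      qed
    qed
  qed auto
  then show ?thesis by (simp add: gen_def tends_zero_iff)
qed

text \<open>Only maximality remains. \<open>T\<close> commutes with \<open>J 1\<close>, so (J 1 x, J
  1 y) also lies on the graph of the generator; as J 1 x is in \<open>D\<close>, this forces J 1 y =
  B (J 1 x). Then x = J 1 x - J 1 y is a difference of elements of \<open>D\<close>.\<close>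

lemma gen_T_iff: "gen T x y \<longleftrightarrow> x \<in> D \<and> y = B x"
proof
  assume xy: "gen T x y"
  have one: "0 < (1::real)" by simp
  have comm: "T t (J 1 z) = J 1 (T t z)" if t: "0 < t" for t z
  proof (rule T_eqI[OF t])
    have "eul t n (J 1 z) = J 1 (eul t n z)" for n
      unfolding eul_def using J_funpow_commute[of "t / real (Suc n)" 1 "Suc n" 1 z] t by simp
    then show "tends sequentially (\<lambda>n. eul t n (J 1 z)) (J 1 (T t z))"
      using tends_op[OF eul_tends[OF t, of z] J_bnd1[OF one] J_hom[OF one] Mb_measurable] by simp
  qed
  have "tends (at_right 0) (\<lambda>t. J 1 (rs (1 / t) (T t x - x))) (J 1 y)"
    by (rule tends_op[OF xy[unfolded gen_def] J_bnd1[OF one] J_hom[OF one] Mb_measurable])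
  moreover have "\<forall>\<^sub>F t in at_right 0. J 1 (rs (1 / t) (T t x - x)) = rs (1 / t) (T t (J 1 x) - J 1 x)"
  proof -
    have "\<forall>\<^sub>F t in at_right 0. 0 < (t::real)" by (simp add: eventually_at_right_less)
    then show ?thesis
      by eventually_elim (simp add: comm hom_sm[OF J_hom[OF one]] hom_diff[OF J_hom[OF one]])
  qed
  ultimately have "gen T (J 1 x) (J 1 y)" unfolding gen_def by (simp add: tends_cong)
  moreover have "gen T (J 1 x) (B (J 1 x))" by (rule gen_T_D[OF J_in_D[OF one]])
  ultimately have "J 1 y = B (J 1 x)"
    unfolding gen_def by (rule tends_unique[rotated]) simp
  then have "x = J 1 x - J 1 y" using J_right[OF one, of x] by simp
  then have "x \<in> D" using D_diff[OF J_in_D[OF one] J_in_D[OF one]] by metis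
  then show "x \<in> D \<and> y = B x"
    using xy gen_T_D[of x] tends_unique[of "at_right (0::real)"] unfolding gen_def by auto
next
  assume "x \<in> D \<and> y = B x"
  then show "gen T x y" using gen_T_D by simp
qed

end

section \<open>The Hille--Yosida theorem\<close>

context complete_rn_module
begin

text \<open>Rescaling by exp (- \<xi> t) reduces everything to an exponentially stable semigroup
  with rate Re \<xi> - \<tau>. Closedness and density are read off from the same resolvent.\<close>

lemma generator_resolvent:
  fixes \<xi> :: "'w \<Rightarrow> complex" and \<tau> Mb :: "'w \<Rightarrow> real"
  assumes A: "module_hom_on M sm D A"
    and [measurable]: "Mb \<in> borel_measurable M" "\<tau> \<in> borel_measurable M" "\<xi> \<in> borel_measurable M"
    and Mb: "AE \<omega> in M. 1 \<le> Mb \<omega>"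
    and T_hom: "\<And>t. 0 \<le> t \<Longrightarrow> hom (T t)" and T_zero: "\<And>x. T 0 x = x"
    and T_add: "\<And>s t x. 0 \<le> s \<Longrightarrow> 0 \<le> t \<Longrightarrow> T (s + t) x = T s (T t x)"
    and T_bnd: "\<And>t. 0 \<le> t \<Longrightarrow> bnd (T t) (\<lambda>\<omega>. Mb \<omega> * exp (\<tau> \<omega> * t))"
    and T_cont: "\<And>x. tends (at_right 0) (\<lambda>t. T t x) x"
    and gen: "\<And>x y. gen T x y \<longleftrightarrow> x \<in> D \<and> y = A x"
    and \<xi>: "AE \<omega> in M. Re (\<xi> \<omega>) - \<tau> \<omega> > 0"
  shows "in_resolvent_set M sm nrm A D \<xi>"
    and "bnd (resolvent sm A D \<xi> ^^ n) (\<lambda>\<omega>. Mb \<omega> / (Re (\<xi> \<omega>) - \<tau> \<omega>) ^ n)"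
    and "closed_op M nrm A D" and "densely_defined M nrm D"
proof -
  define S where "S = exp_scaled (\<lambda>\<omega>. - \<xi> \<omega>) T"
  define \<delta> where "\<delta> \<omega> = Re (\<xi> \<omega>) - \<tau> \<omega>" for \<omega>
  have \<delta> [measurable]: "\<delta> \<in> borel_measurable M" unfolding \<delta>_def by measurable
  interpret S: stable_semigroup M sm nrm S Mb \<delta>
  proof
    show "AE \<omega> in M. 0 < \<delta> \<omega>" using \<xi> by (simp add: \<delta>_def)
    show "hom (S t)" if "0 \<le> t" for t
      unfolding S_def using T_hom[OF that] by (intro exp_scaled_hom) measurable
    show "S 0 x = x" for x by (simp add: S_def exp_scaled_def T_zero)
    show "S (s + t) x = S s (S t x)" if "0 \<le> s" "0 \<le> t" for s t x
      unfolding S_def using T_add[OF that] T_hom[OF that(1)] by (intro exp_scaled_add) measurable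
    show "bnd (S t) (\<lambda>\<omega>. Mb \<omega> * exp (- (\<delta> \<omega> * t)))" if "0 \<le> t" for t
    proof -
      have "bnd (S t) (\<lambda>\<omega>. exp (Re (- \<xi> \<omega>) * t) * (Mb \<omega> * exp (\<tau> \<omega> * t)))"
        unfolding S_def using T_bnd[OF that] by (intro exp_scaled_bnd) measurable
      then show ?thesis by (simp add: \<delta>_def mult_exp_exp algebra_simps)
    qed
    show "tends (at_right 0) (\<lambda>t. S t x) x" for x
      unfolding S_def exp_scaled_def by (intro tends_exp_sm T_cont) measurable
  qed (use Mb in auto)
  \<comment> \<open>The generator of \<open>S\<close> is A - \<xi>, so \<open>ex_gen\<close> yields
    surjectivity of \<xi> - A and \<open>gen_zero_imp_zero\<close> its injectivity.\<close>
  have genS: "gen S x y \<longleftrightarrow> x \<in> D \<and> sm \<xi> x - A x = - y" for x y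
  proof -
    have "gen S x y \<longleftrightarrow> gen T x (y - sm (\<lambda>\<omega>. - \<xi> \<omega>) x)"
      unfolding S_def by (rule gen_exp_scaled_iff) measurable
    then show ?thesis unfolding gen by (auto simp: sm_minus_left algebra_simps)
  qed
  have D: "x - y \<in> D" "A (x - y) = A x - A y" if "x \<in> D" "y \<in> D" for x y
  proof -
    have "sm (\<lambda>_. - 1) y \<in> D" "A (sm (\<lambda>_. - 1) y) = sm (\<lambda>_. - 1) (A y)"
      using A that(2) unfolding module_hom_on_def by auto
    then have neg: "- y \<in> D" "A (- y) = - A y" by (simp_all add: sm_minus_left)
    then show "x - y \<in> D" "A (x - y) = A x - A y"
      using A that(1) unfolding module_hom_on_def by (metis diff_conv_add_uminus)+
  qed
  have bij: "bij_betw (\<lambda>x. sm \<xi> x - A x) D UNIV"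
    unfolding bij_betw_def
  proof
    show "inj_on (\<lambda>x. sm \<xi> x - A x) D"
    proof (rule inj_onI)
      fix x y assume xy: "x \<in> D" "y \<in> D" "sm \<xi> x - A x = sm \<xi> y - A y"
      have "sm \<xi> (x - y) - A (x - y) = (sm \<xi> x - A x) - (sm \<xi> y - A y)"
        using D(2)[OF xy(1,2)] by (simp add: sm_diff_right)
      then have "gen S (x - y) 0" unfolding genS using D(1)[OF xy(1,2)] xy(3) by simp
      then have "x - y = 0" by (rule S.gen_zero_imp_zero)
      then show "x = y" by simp
    qed
    have "y \<in> (\<lambda>x. sm \<xi> x - A x) ` D" for y
      using S.ex_gen[of y] unfolding genS by force
    then show "(\<lambda>x. sm \<xi> x - A x) ` D = UNIV" by blast
  qed
  define R where "R = resolvent sm A D \<xi>"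
  have R: "R y \<in> D" "sm \<xi> (R y) - A (R y) = y" for y
    using bij_betw_the_inv_into[OF bij] f_the_inv_into_f_bij_betw[OF bij, of y]
    unfolding R_def resolvent_def by (auto simp: bij_betw_def)
  have R_left: "x \<in> D \<Longrightarrow> R (sm \<xi> x - A x) = x" for x
    unfolding R_def resolvent_def using bij by (intro the_inv_into_f_f) (auto simp: bij_betw_def)
  have Rgen: "gen S (R y) (- y)" for y unfolding genS using R by simp
  have bndR: "bnd (R ^^ n) (\<lambda>\<omega>. Mb \<omega> / \<delta> \<omega> ^ n)" for n
    by (rule S.nrm_iterated_inverse_le[OF Rgen])
  then show "bnd (resolvent sm A D \<xi> ^^ n) (\<lambda>\<omega>. Mb \<omega> / (Re (\<xi> \<omega>) - \<tau> \<omega>) ^ n)"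
    by (simp add: R_def \<delta>_def)
  have bnd1: "bnd R (\<lambda>\<omega>. Mb \<omega> / \<delta> \<omega>)" using bndR[of 1] by simp
  have homR: "hom R"
    unfolding hom_def
  proof (intro conjI allI impI)
    have add: "x + y \<in> D" "A (x + y) = A x + A y" if "x \<in> D" "y \<in> D" for x y
      using A that by (auto simp: module_hom_on_def)
    have scale: "sm \<eta> x \<in> D" "A (sm \<eta> x) = sm \<eta> (A x)" if "\<eta> \<in> borel_measurable M" "x \<in> D" for \<eta> x
      using A that by (auto simp: module_hom_on_def)
    show "R (x + y) = R x + R y" for x y
    proof -
      have "R (sm \<xi> (R x + R y) - A (R x + R y)) = R x + R y" by (intro R_left add R)
      also have "sm \<xi> (R x + R y) - A (R x + R y) = (sm \<xi> (R x) - A (R x)) + (sm \<xi> (R y) - A (R y))"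
        using add[OF R(1) R(1)] by (simp add: sm_add_right)
      finally show ?thesis by (simp add: R)
    qed
    show "R (sm \<eta> x) = sm \<eta> (R x)" if [measurable]: "\<eta> \<in> borel_measurable M" for \<eta> x
    proof -
      have "R (sm \<xi> (sm \<eta> (R x)) - A (sm \<eta> (R x))) = sm \<eta> (R x)" by (intro R_left scale R that)
      also have "sm \<xi> (sm \<eta> (R x)) - A (sm \<eta> (R x)) = sm \<eta> (sm \<xi> (R x) - A (R x))"
        using scale[OF that R(1)] hom_sm[OF hom_sm_scalar, of \<xi> \<eta>] that by (simp add: sm_diff_right)
      finally show ?thesis by (simp add: R)
    qed
  qed
  have meas: "(\<lambda>\<omega>. Mb \<omega> / \<delta> \<omega>) \<in> borel_measurable M" by measurable
  show "in_resolvent_set M sm nrm A D \<xi>"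
    unfolding in_resolvent_set_def using bij bounded_opI[OF bnd1 homR meas] by (simp add: R_def)
  have nonneg: "AE \<omega> in M. 0 \<le> Mb \<omega> / \<delta> \<omega>" using Mb S.\<delta>_pos by eventually_elim simp
  have bnd_id: "bnd (\<lambda>x. x) (\<lambda>_. 1)" by (simp add: bnd_def)
  have \<xi>m: "\<xi> \<in> borel_measurable M" by measurable
  note U = bnd_diff_ops[OF hom_comp[OF homR hom_sm_scalar[OF \<xi>m]] hom_id
      bnd_comp[OF bnd1 bnd_sm[OF \<xi>m] nonneg] bnd_id]
  show "closed_op M nrm A D"
  proof (rule closed_opI[OF U[THEN conjunct1] U[THEN conjunct2] _ homR bnd1 meas])
    show "(\<lambda>\<omega>. Mb \<omega> / \<delta> \<omega> * cmod (\<xi> \<omega>) + 1) \<in> borel_measurable M" by measurable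
    \<comment> \<open>Membership in the graph, rewritten with the bounded operator \<open>R\<close>
      only, as \<open>closed_opI\<close> expects.\<close>
    show "x \<in> D \<and> y = A x \<longleftrightarrow> R (sm \<xi> x) - x = R y" for x y
    proof
      assume "x \<in> D \<and> y = A x"
      then show "R (sm \<xi> x) - x = R y" using R_left[of x] by (simp add: hom_diff[OF homR] algebra_simps)
    next
      assume "R (sm \<xi> x) - x = R y"
      then have x: "x = R (sm \<xi> x - y)" by (simp add: hom_diff[OF homR] algebra_simps)
      then have "x \<in> D" using R(1) by metis
      moreover have "sm \<xi> x - A x = sm \<xi> x - y" using R(2)[of "sm \<xi> x - y"] x by metis
      ultimately show "x \<in> D \<and> y = A x" by simp
    qed
  qed
  show "densely_defined M nrm D"
    unfolding densely_defined_iff using S.gen_domain_dense unfolding genS by blast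
qed

lemma assertion_a_imp_c:
  assumes A: "module_hom_on M sm D A"
    and [measurable]: "\<tau> \<in> borel_measurable M" "Mb \<in> borel_measurable M"
    and Mb: "AE \<omega> in M. 1 \<le> Mb \<omega>"
    and a: "assertion_a M sm nrm A D \<tau> Mb"
  shows "assertion_c M sm nrm A D \<tau> Mb"
proof -
  obtain T where T: "C0_semigroup M sm nrm T" "generates M sm nrm A D T"
    "\<And>t. 0 \<le> t \<Longrightarrow> AE \<omega> in M. op_norm M nrm (T t) \<omega> \<le> ereal (Mb \<omega> * exp (\<tau> \<omega> * t))"
    using a unfolding assertion_a_def by blast
  have bnd: "bnd (T t) (\<lambda>\<omega>. Mb \<omega> * exp (\<tau> \<omega> * t))" if "0 \<le> t" for t
  proof (rule op_norm_le_iff_bnd[THEN iffD1, OF _ _ T(3)[OF that]])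
    show "AE \<omega> in M. 0 \<le> Mb \<omega> * exp (\<tau> \<omega> * t)" using Mb by eventually_elim simp
  qed measurable
  have hom: "hom (T t)" if "0 \<le> t" for t
    using T(1) that by (auto simp: C0_semigroup_def intro: bounded_op_hom)
  have zero: "T 0 x = x" for x using T(1) by (simp add: C0_semigroup_def)
  have add: "T (s + t) x = T s (T t x)" if "0 \<le> s" "0 \<le> t" for s t x
    using T(1) that unfolding C0_semigroup_def by (metis comp_apply)
  have cont: "tends (at_right 0) (\<lambda>t. T t x) x" for x
    using T(1) by (simp add: C0_semigroup_def limitin_iff_tends)
  have gen: "gen T x y \<longleftrightarrow> x \<in> D \<and> y = A x" for x y using T(2) unfolding generates_iff by blast
  note res = generator_resolvent[OF A \<open>Mb \<in> borel_measurable M\<close> \<open>\<tau> \<in> borel_measurable M\<close> _ Mb hom zero add bnd cont gen]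
  \<comment> \<open>Both properties follow from a single resolvent point; \<tau> + 1 is always
    admissible.\<close>
  have "closed_op M nrm A D" "densely_defined M nrm D"
    using res(3,4)[of "\<lambda>\<omega>. complex_of_real (\<tau> \<omega> + 1)"] by auto
  moreover have "in_resolvent_set M sm nrm A D \<xi>"
    "AE \<omega> in M. op_norm M nrm (resolvent sm A D \<xi> ^^ n) \<omega> \<le> ereal (Mb \<omega> / (Re (\<xi> \<omega>) - \<tau> \<omega>) ^ n)"
    if [measurable]: "\<xi> \<in> borel_measurable M" and \<xi>: "AE \<omega> in M. Re (\<xi> \<omega>) - \<tau> \<omega> > 0" for \<xi> n
  proof -
    show "in_resolvent_set M sm nrm A D \<xi>" by (rule res(1)) (use that in auto)
    show "AE \<omega> in M. op_norm M nrm (resolvent sm A D \<xi> ^^ n) \<omega> \<le> ereal (Mb \<omega> / (Re (\<xi> \<omega>) - \<tau> \<omega>) ^ n)"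
    proof (rule op_norm_le_iff_bnd[THEN iffD2])
      show "bnd (resolvent sm A D \<xi> ^^ n) (\<lambda>\<omega>. Mb \<omega> / (Re (\<xi> \<omega>) - \<tau> \<omega>) ^ n)" by (rule res(2)) (use that in auto)
      show "AE \<omega> in M. 0 \<le> Mb \<omega> / (Re (\<xi> \<omega>) - \<tau> \<omega>) ^ n" using Mb \<xi> by eventually_elim simp
    qed measurable
  qed
  ultimately show ?thesis unfolding assertion_c_def by blast
qed

lemma assertion_c_imp_b:
  assumes A: "module_hom_on M sm D A"
    and [measurable]: "\<tau> \<in> borel_measurable M" "Mb \<in> borel_measurable M"
    and Mb: "AE \<omega> in M. 1 \<le> Mb \<omega>"
    and c: "assertion_c M sm nrm A D \<tau> Mb"
  shows "assertion_b M sm nrm A D \<tau> Mb"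
  unfolding assertion_b_def
proof (intro conjI allI impI)
  show "closed_op M nrm A D" "densely_defined M nrm D" using c by (auto simp: assertion_c_def)
  fix \<xi> :: "'w \<Rightarrow> real" assume [measurable]: "\<xi> \<in> borel_measurable M" and \<xi>: "AE \<omega> in M. \<xi> \<omega> - \<tau> \<omega> > 0"
  define R where "R = resolvent sm A D (\<lambda>\<omega>. complex_of_real (\<xi> \<omega>))"
  have res: "in_resolvent_set M sm nrm A D (\<lambda>\<omega>. complex_of_real (\<xi> \<omega>))"
    "\<And>n. n \<ge> 1 \<Longrightarrow> AE \<omega> in M. op_norm M nrm (R ^^ n) \<omega> \<le> ereal (Mb \<omega> / (\<xi> \<omega> - \<tau> \<omega>) ^ n)"
    using c[unfolded assertion_c_def, THEN conjunct2, THEN conjunct2, rule_format, of "\<lambda>\<omega>. complex_of_real (\<xi> \<omega>)"] \<xi>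
    by (auto simp: R_def)
  show "in_resolvent_set M sm nrm A D (\<lambda>\<omega>. complex_of_real (\<xi> \<omega>))" by (rule res(1))
  fix n :: nat assume n: "n \<ge> 1"
  have R: "hom R" using res(1) by (auto simp: in_resolvent_set_def R_def intro: bounded_op_hom)
  have nonneg: "AE \<omega> in M. 0 \<le> Mb \<omega> / (\<xi> \<omega> - \<tau> \<omega>) ^ n" using Mb \<xi> by eventually_elim simp
  have bnd: "bnd (R ^^ n) (\<lambda>\<omega>. Mb \<omega> / (\<xi> \<omega> - \<tau> \<omega>) ^ n)"
    by (rule op_norm_le_iff_bnd[THEN iffD1, OF _ nonneg res(2)[OF n]]) measurable
  define d where "d \<omega> = complex_of_real (\<xi> \<omega> - \<tau> \<omega>)" for \<omega>
  have d [measurable]: "d \<in> borel_measurable M" unfolding d_def by measurable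
  have pow: "((\<lambda>x. sm d (R x)) ^^ n) x = sm (\<lambda>\<omega>. d \<omega> ^ n) ((R ^^ n) x)" for n x
  proof (induction n)
    case (Suc n)
    have "((\<lambda>x. sm d (R x)) ^^ Suc n) x = sm d (sm (\<lambda>\<omega>. d \<omega> ^ n) (R ((R ^^ n) x)))"
      using hom_sm[OF R, of "\<lambda>\<omega>. d \<omega> ^ n" "(R ^^ n) x"] by (simp add: Suc.IH)
    also have "\<dots> = sm (\<lambda>\<omega>. d \<omega> * d \<omega> ^ n) (R ((R ^^ n) x))"
      by (rule sm_mult[symmetric]) measurable
    finally show ?case by simp
  qed simp
  have "bnd ((\<lambda>x. sm d (R x)) ^^ n) Mb"
    unfolding bnd_def
  proof
    fix x
    have "AE \<omega> in M. nrm (sm (\<lambda>\<omega>. d \<omega> ^ n) ((R ^^ n) x)) \<omega> = cmod (d \<omega> ^ n) * nrm ((R ^^ n) x) \<omega>"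
      by (rule nrm_sm) measurable
    with bndD[OF bnd, of x] \<xi>
    show "AE \<omega> in M. nrm (((\<lambda>x. sm d (R x)) ^^ n) x) \<omega> \<le> Mb \<omega> * nrm x \<omega>"
      unfolding pow
    proof eventually_elim
      case (elim \<omega>)
      have "cmod (d \<omega> ^ n) = (\<xi> \<omega> - \<tau> \<omega>) ^ n"
        unfolding d_def norm_power norm_of_real using elim by simp
      moreover have "(\<xi> \<omega> - \<tau> \<omega>) ^ n * nrm ((R ^^ n) x) \<omega>
          \<le> (\<xi> \<omega> - \<tau> \<omega>) ^ n * (Mb \<omega> / (\<xi> \<omega> - \<tau> \<omega>) ^ n * nrm x \<omega>)"
        using elim by (intro mult_left_mono) auto
      moreover have "(\<xi> \<omega> - \<tau> \<omega>) ^ n * (Mb \<omega> / (\<xi> \<omega> - \<tau> \<omega>) ^ n * nrm x \<omega>) = Mb \<omega> * nrm x \<omega>"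
        using elim by simp
      ultimately show ?case using elim by simp
    qed
  qed
  moreover have "AE \<omega> in M. 0 \<le> Mb \<omega>" using Mb by eventually_elim simp
  ultimately show "AE \<omega> in M. op_norm M nrm ((\<lambda>x. sm (\<lambda>\<omega>. complex_of_real (\<xi> \<omega> - \<tau> \<omega>))
      (resolvent sm A D (\<lambda>\<omega>. complex_of_real (\<xi> \<omega>)) x)) ^^ n) \<omega> \<le> ereal (Mb \<omega>)"
    using op_norm_le_iff_bnd[of Mb] by (simp add: R_def d_def[abs_def])
qed

text \<open>Subtracting \<tau> from \<open>A\<close> turns (b) at \<xi> = \<tau> + 1 / h into the
  uniform bounds of \<open>hille_yosida\<close>. The Euler limit for \<open>B\<close> is then
  multiplied by exp (\<tau> t).\<close>

lemma assertion_b_imp_a: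
  assumes A: "module_hom_on M sm D A"
    and \<tau> [measurable]: "\<tau> \<in> borel_measurable M" and Mbm [measurable]: "Mb \<in> borel_measurable M"
    and Mb: "AE \<omega> in M. 1 \<le> Mb \<omega>"
    and b: "assertion_b M sm nrm A D \<tau> Mb"
  shows "assertion_a M sm nrm A D \<tau> Mb"
proof -
  define \<tau>c where "\<tau>c \<omega> = complex_of_real (\<tau> \<omega>)" for \<omega>
  have \<tau>c [measurable]: "\<tau>c \<in> borel_measurable M" unfolding \<tau>c_def by measurable
  define B where "B x = A x - sm \<tau>c x" for x
  \<comment> \<open>Here \<xi> - \<tau> = 1 / h, so (\<xi> - \<tau>) R equals the inverse of 1 - h
    B, and the scaled resolvent powers in (b) are exactly the powers of \<open>J h\<close>.\<close>
  define \<xi> where "\<xi> h \<omega> = complex_of_real (1 / h + \<tau> \<omega>)" for h \<omega>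
  define R where "R h = resolvent sm A D (\<xi> h)" for h
  define J where "J h x = rs (1 / h) (R h x)" for h x
  have Mb0: "AE \<omega> in M. 0 \<le> Mb \<omega>" using Mb by eventually_elim simp
  have A_add: "x + y \<in> D" "A (x + y) = A x + A y" if "x \<in> D" "y \<in> D" for x y
    using A that by (auto simp: module_hom_on_def)
  have A_sm: "sm \<eta> x \<in> D" "A (sm \<eta> x) = sm \<eta> (A x)" if "\<eta> \<in> borel_measurable M" "x \<in> D" for \<eta> x
    using A that by (auto simp: module_hom_on_def)
  have comm: "sm \<eta> (sm \<zeta> x) = sm \<zeta> (sm \<eta> x)" if "\<eta> \<in> borel_measurable M" "\<zeta> \<in> borel_measurable M" for \<eta> \<zeta> x
    by (rule hom_sm[OF hom_sm_scalar[OF that(1)] that(2)])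
  have \<xi>_sm: "sm (\<xi> h) x = rs (1 / h) x + sm \<tau>c x" for h x
    unfolding \<xi>_def[abs_def] \<tau>c_def[abs_def] of_real_add by (rule sm_add_left) measurable
  have res: "in_resolvent_set M sm nrm A D (\<xi> h)"
    "\<And>n. n \<ge> 1 \<Longrightarrow> AE \<omega> in M. op_norm M nrm (J h ^^ n) \<omega> \<le> ereal (Mb \<omega>)" if "0 < h" for h
    using b[unfolded assertion_b_def, THEN conjunct2, THEN conjunct2, rule_format, of "\<lambda>\<omega>. 1 / h + \<tau> \<omega>"] that
    by (auto simp: \<xi>_def[abs_def] J_def[abs_def] R_def)
  have bij: "bij_betw (\<lambda>x. sm (\<xi> h) x - A x) D UNIV" if "0 < h" for h
    using res(1)[OF that] by (simp add: in_resolvent_set_def)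
  have R: "R h y \<in> D" "sm (\<xi> h) (R h y) - A (R h y) = y" if "0 < h" for h y
    using bij_betw_the_inv_into[OF bij[OF that]] f_the_inv_into_f_bij_betw[OF bij[OF that], of y]
    unfolding R_def resolvent_def by (auto simp: bij_betw_def)
  have R_left: "R h (sm (\<xi> h) x - A x) = x" if "0 < h" "x \<in> D" for h x
    unfolding R_def resolvent_def using bij[OF that(1)] that(2)
    by (intro the_inv_into_f_f) (auto simp: bij_betw_def)
  interpret H: hille_yosida M sm nrm B D J Mb
  proof
    show "module_hom_on M sm D B"
      using A comm unfolding module_hom_on_def B_def by (simp add: sm_add_right sm_diff_right)
    show "\<exists>u. (\<forall>n::nat. u n \<in> D) \<and> tends sequentially u x" for x
      using b unfolding assertion_b_def densely_defined_iff by blast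
    show "J h x \<in> D" if "0 < h" for h x unfolding J_def using A_sm R[OF that] by simp
    show "J h x - rs h (B (J h x)) = x" if h: "0 < h" for h x
    proof -
      have "B (J h x) = rs (1 / h) (A (R h x) - sm \<tau>c (R h x))"
        unfolding B_def J_def using A_sm(2)[OF _ R(1)[OF h]] comm by (simp add: sm_diff_right)
      then have "rs h (B (J h x)) = A (R h x) - sm \<tau>c (R h x)"
        using h by (simp only: rs_mult) simp
      then have "J h x - rs h (B (J h x)) = sm (\<xi> h) (R h x) - A (R h x)"
        unfolding \<xi>_sm J_def by (simp add: algebra_simps)
      then show ?thesis using R(2)[OF h] by simp
    qed
    show "J h (x - rs h (B x)) = x" if h: "0 < h" and x: "x \<in> D" for h x
    proof -
      have "sm (\<xi> h) (rs h x) - A (rs h x) = rs (1 / h) (rs h x) + rs h (sm \<tau>c x) - rs h (A x)"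
        unfolding \<xi>_sm using A_sm(2)[OF _ x] comm by simp
      also have "\<dots> = x - rs h (B x)"
        unfolding rs_mult using h by (simp add: B_def sm_diff_right)
      finally have "R h (x - rs h (B x)) = rs h x" using R_left[OF h A_sm(1)[OF _ x], of "\<lambda>_. complex_of_real h"] by simp
      then show ?thesis unfolding J_def using h by (simp only: rs_mult) simp
    qed
    show "bnd (J h ^^ n) Mb" if "0 < h" for h n
    \<comment> \<open>(b) speaks of n \<ge> 1 only; the zeroth power is bounded by \<open>Mb\<close>
      because Mb \<ge> 1.\<close>
    proof (cases "n = 0")
      case True
      show ?thesis unfolding bnd_def
      proof
        fix x
        from Mb nrm_nonneg[of x] show "AE \<omega> in M. nrm ((J h ^^ n) x) \<omega> \<le> Mb \<omega> * nrm x \<omega>"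
        proof eventually_elim
          case (elim \<omega>)
          then show ?case using mult_right_mono[of 1 "Mb \<omega>" "nrm x \<omega>"] True by simp
        qed
      qed
    next
      case False
      then show ?thesis using op_norm_le_iff_bnd[OF Mbm Mb0] res(2)[OF that, of n] by simp
    qed
  qed (use Mb in auto)
  define T where "T = exp_scaled \<tau>c H.T"
  have T_hom: "hom (T t)" if "0 \<le> t" for t
    unfolding T_def by (rule exp_scaled_hom[where T=H.T, OF \<tau>c H.T_hom[OF that]])
  have T_bnd: "bnd (T t) (\<lambda>\<omega>. Mb \<omega> * exp (\<tau> \<omega> * t))" if "0 \<le> t" for t
    using exp_scaled_bnd[where T=H.T, OF \<tau>c H.T_bnd[OF that]] by (simp add: T_def \<tau>c_def mult.commute)
  have meas: "(\<lambda>\<omega>. Mb \<omega> * exp (\<tau> \<omega> * t)) \<in> borel_measurable M" for t by measurable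
  have op: "AE \<omega> in M. op_norm M nrm (T t) \<omega> \<le> ereal (Mb \<omega> * exp (\<tau> \<omega> * t))" if "0 \<le> t" for t
  proof (rule op_norm_le_iff_bnd[THEN iffD2, OF meas _ T_bnd[OF that]])
    show "AE \<omega> in M. 0 \<le> Mb \<omega> * exp (\<tau> \<omega> * t)" using Mb0 by eventually_elim simp
  qed
  have "C0_semigroup M sm nrm T"
    unfolding C0_semigroup_def limitin_iff_tends
  proof (intro conjI allI impI)
    show "bounded_op M sm nrm (T t)" if "0 \<le> t" for t
      using T_bnd[OF that] T_hom[OF that] meas by (rule bounded_opI)
    show "T 0 = id" by (auto simp: T_def exp_scaled_def H.T_zero)
    show "T s \<circ> T t = T (s + t)" if "0 \<le> s" "0 \<le> t" for s t
      using exp_scaled_add[where T=H.T, OF \<tau>c H.T_hom[OF that(1)] H.T_add[OF that]] by (auto simp: T_def)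
    show "tends (at_right 0) (\<lambda>t. T t x) x" for x
      unfolding T_def exp_scaled_def by (rule tends_exp_sm[OF \<tau>c H.T_cont])
  qed
  moreover have "generates M sm nrm A D T"
    unfolding generates_iff
  proof (intro allI)
    fix x y
    have "gen T x y \<longleftrightarrow> gen H.T x (y - sm \<tau>c x)" unfolding T_def by (rule gen_exp_scaled_iff[OF \<tau>c])
    then show "gen T x y \<longleftrightarrow> x \<in> D \<and> y = A x" unfolding H.gen_T_iff B_def by auto
  qed
  moreover have "as_bounded_semigroup M nrm T"
    unfolding as_bounded_semigroup_def
  proof (intro exI conjI)
    let ?H = "{op_norm M nrm (T t) | t. t \<in> {0..1::real}}"
    have sup: "is_L0_sup M ?H (L0_Sup M ?H)"
      by (rule is_L0_sup_L0_Sup) (auto intro: op_norm_measurable)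
    \<comment> \<open>A bound that does not depend on \<open>t\<close>: with L = 1, \<tau> t is at
      most \<bar>\<tau>\<bar>. The essential supremum lies below every such common bound, although
      uncountably many times are involved.\<close>
    have "\<forall>f\<in>?H. AE \<omega> in M. f \<omega> \<le> ereal (Mb \<omega> * exp \<bar>\<tau> \<omega>\<bar>)"
    proof
      fix f assume "f \<in> ?H"
      then obtain t where t: "0 \<le> t" "t \<le> 1" "f = op_norm M nrm (T t)" by auto
      from op[OF t(1)] Mb0 show "AE \<omega> in M. f \<omega> \<le> ereal (Mb \<omega> * exp \<bar>\<tau> \<omega>\<bar>)"
        unfolding t(3)
      proof eventually_elim
        case (elim \<omega>)
        have "\<tau> \<omega> * t \<le> \<bar>\<tau> \<omega>\<bar> * 1" using t by (intro mult_mono) auto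
        then have "Mb \<omega> * exp (\<tau> \<omega> * t) \<le> Mb \<omega> * exp \<bar>\<tau> \<omega>\<bar>" using elim by (intro mult_left_mono) auto
        with elim(1) show ?case by (metis ereal_less_eq(3) order_trans)
      qed
    qed
    then have "AE \<omega> in M. L0_Sup M ?H \<omega> \<le> ereal (Mb \<omega> * exp \<bar>\<tau> \<omega>\<bar>)"
      by (rule sup[unfolded is_L0_sup_def, THEN conjunct2, THEN conjunct2, THEN bspec, THEN mp, rotated]) measurable
    then show "AE \<omega> in M. L0_Sup M ?H \<omega> < \<infinity>"
      by eventually_elim (erule le_less_trans, simp)
  qed simp
  ultimately show ?thesis unfolding assertion_a_def using op by blast
qed

end

theorem theorem4p7:
  fixes M :: "'w measure"
    and sm :: "('w \<Rightarrow> complex) \<Rightarrow> 'a::ab_group_add \<Rightarrow> 'a"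
    and nrm :: "'a \<Rightarrow> 'w \<Rightarrow> real"
    and A :: "'a \<Rightarrow> 'a" and D :: "'a set"
    and \<tau> Mb :: "'w \<Rightarrow> real"
  assumes "RN_module M sm nrm"
    and "RN_complete M nrm"
    and "module_hom_on M sm D A"
    and "\<tau> \<in> borel_measurable M"
    and "Mb \<in> borel_measurable M"
    and "AE \<omega> in M. 1 \<le> Mb \<omega>"
  shows "(assertion_a M sm nrm A D \<tau> Mb \<longleftrightarrow> assertion_b M sm nrm A D \<tau> Mb) \<and>
         (assertion_b M sm nrm A D \<tau> Mb \<longleftrightarrow> assertion_c M sm nrm A D \<tau> Mb)"
proof -
  interpret prob_space M using assms(1) by (simp add: RN_module_def)
  interpret complete_rn_module M sm nrm by unfold_locales (use assms(1,2) in auto)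
  have "assertion_c M sm nrm A D \<tau> Mb" if "assertion_a M sm nrm A D \<tau> Mb"
    using assms(3-6) that by (intro assertion_a_imp_c)
  moreover have "assertion_b M sm nrm A D \<tau> Mb" if "assertion_c M sm nrm A D \<tau> Mb"
    using assms(3-6) that by (intro assertion_c_imp_b)
  moreover have "assertion_a M sm nrm A D \<tau> Mb" if "assertion_b M sm nrm A D \<tau> Mb"
    using assms(3-6) that by (intro assertion_b_imp_a)
  ultimately show ?thesis by blast
qed

end
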